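(* Let $A$ be a rational function of degree $n\geq 2$ (over $\mathbb{C}$) that is not conjugate to $z^{n}$ or to $z^{-n}$. Then the order of the group $\Sigma_\infty(A)$ is finite and bounded in terms of $n$ only. Moreover, for every $\sigma\in\Sigma_\infty(A)$ the relation $A\circ\sigma\sim A$ holds.
   Context: Rational functions are viewed as holomorphic maps $\mathbb{CP}^1\to\mathbb{CP}^1$, and $A^{\circ k}$ denotes the $k$-th iterate of $A$. "Conjugate" means conjugate by a Möbius transformation. For a rational function $F$ of degree at least two, $\Sigma(F)$ is the group of Möbius transformations $\sigma$ with $F\circ\sigma=F$. Define $\Sigma_\infty(A)=\bigcup_{k=1}^\infty\Sigma(A^{\circ k})$, which is a group since $\Sigma(A^{\circ k})\subseteq\Sigma(A^{\circ (k+1)})$. A rational function $\widetilde A$ is an elementary transformation of $A$ if there exist rational functions $U,V$ with $A=U\circ V$ and $\widetilde A=V\circ U$. Write $A\sim A'$ if there is a finite chain of elementary transformations between $A$ and $A'$. "Bounded in terms of $n$ only" means bounded by a number depending only on $n$. *)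

theory Defs
  imports
    Complex_Main
    "HOL-Computational_Algebra.Computational_Algebra"
    "HOL-Computational_Algebra.Field_as_Ring"
begin

datatype riemann_sphere = Fin complex | Infty

text \<open>
  The map \<open>z \<mapsto> p(z)/q(z)\<close> on the Riemann sphere. For coprime \<open>p\<close>, \<open>q\<close> and
  \<open>d = max (deg p) (deg q)\<close> this is \<open>[x : y] \<mapsto> [y\<^sup>d p(x/y) : y\<^sup>d q(x/y)]\<close>; at
  \<open>[1 : 0]\<close> only the coefficients of degree \<open>d\<close> survive. It is meaningful only for coprime
  \<open>p\<close>, \<open>q\<close>.
\<close>

definition rat_map :: "complex poly \<Rightarrow> complex poly \<Rightarrow> riemann_sphere \<Rightarrow> riemann_sphere" where
  "rat_map p q x =
     (case x of
        Fin z \<Rightarrow> if poly q z = 0 then Infty else Fin (poly p z / poly q z)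
      | Infty \<Rightarrow>
          (let d = max (degree p) (degree q)
           in if coeff q d = 0 then Infty else Fin (coeff p d / coeff q d)))"

definition rational_function :: "(riemann_sphere \<Rightarrow> riemann_sphere) \<Rightarrow> bool" where
  "rational_function F \<longleftrightarrow> (\<exists>p q. coprime p q \<and> q \<noteq> 0 \<and> F = rat_map p q)"

definition rat_degree :: "(riemann_sphere \<Rightarrow> riemann_sphere) \<Rightarrow> nat" where
  "rat_degree F =
     (THE d. \<exists>p q. coprime p q \<and> q \<noteq> 0 \<and> F = rat_map p q \<and> d = max (degree p) (degree q))"

lemma rat_map_eq_imp_cross_eq:
  assumes "q \<noteq> 0" "s \<noteq> 0" and eq: "rat_map p q = rat_map r s"
  shows "p * s = r * q"
proof (rule ccontr)
  assume ne: "p * s \<noteq> r * q"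
  have "poly ((p * s - r * q) * (q * s)) z = 0" for z
  proof (cases "poly q z = 0 \<or> poly s z = 0")
    case False
    have "rat_map p q (Fin z) = rat_map r s (Fin z)"
      using eq by simp
    with False show ?thesis
      by (simp add: rat_map_def field_simps)
  qed auto
  then have "(p * s - r * q) * (q * s) = 0"
    using poly_all_0_iff_0 by blast
  with ne assms show False
    by simp
qed

lemma rat_degree_rat_map:
  assumes "coprime p q" "q \<noteq> 0"
  shows "rat_degree (rat_map p q) = max (degree p) (degree q)"
  unfolding rat_degree_def
proof (rule the_equality)
  show "\<exists>p' q'. coprime p' q' \<and> q' \<noteq> 0 \<and> rat_map p q = rat_map p' q' \<and>
      max (degree p) (degree q) = max (degree p') (degree q')"
    using assms by blast
next
  fix d
  assume "\<exists>r s. coprime r s \<and> s \<noteq> 0 \<and> rat_map p q = rat_map r s \<and> d = max (degree r) (degree s)"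
  then obtain r s where rs: "coprime r s" "s \<noteq> 0" "rat_map p q = rat_map r s"
    and d: "d = max (degree r) (degree s)"
    by blast
  have cross: "p * s = r * q"
    using rat_map_eq_imp_cross_eq assms(2) rs(2,3) by blast
  have "q dvd p * s" "s dvd r * q"
    using cross by (auto, metis dvd_triv_right)
  moreover have "coprime q p" "coprime s r"
    using assms(1) rs(1) by (simp_all add: coprime_commute)
  ultimately have "q dvd s" "s dvd q"
    by (simp_all add: coprime_dvd_mult_right_iff)
  then have qs: "degree q = degree s"
    using assms(2) rs(2) by (meson dvd_imp_degree_le order_antisym)
  have "degree p = degree r"
  proof (cases "p = 0 \<or> r = 0")
    case True
    with cross assms rs show ?thesis by auto
  next
    case False
    with cross assms rs qs show ?thesis
      by (metis add_right_cancel degree_mult_eq)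
  qed
  with qs d show "d = max (degree p) (degree q)"
    by simp
qed

definition moebius :: "(riemann_sphere \<Rightarrow> riemann_sphere) \<Rightarrow> bool" where
  "moebius \<sigma> \<longleftrightarrow> (\<exists>a b c d. a * d - b * c \<noteq> 0 \<and> \<sigma> = rat_map [:b, a:] [:d, c:])"

definition conjugate ::
  "(riemann_sphere \<Rightarrow> riemann_sphere) \<Rightarrow> (riemann_sphere \<Rightarrow> riemann_sphere) \<Rightarrow> bool" where
  "conjugate F G \<longleftrightarrow> (\<exists>\<mu>. moebius \<mu> \<and> F = inv \<mu> \<circ> G \<circ> \<mu>)"

definition Sigma_group ::
  "(riemann_sphere \<Rightarrow> riemann_sphere) \<Rightarrow> (riemann_sphere \<Rightarrow> riemann_sphere) set" where
  "Sigma_group F = {\<sigma>. moebius \<sigma> \<and> F \<circ> \<sigma> = F}"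

definition Sigma_infinity ::
  "(riemann_sphere \<Rightarrow> riemann_sphere) \<Rightarrow> (riemann_sphere \<Rightarrow> riemann_sphere) set" where
  "Sigma_infinity A = (\<Union>k\<in>{1..}. Sigma_group (A ^^ k))"

definition elementary_transformation ::
  "(riemann_sphere \<Rightarrow> riemann_sphere) \<Rightarrow> (riemann_sphere \<Rightarrow> riemann_sphere) \<Rightarrow> bool" where
  "elementary_transformation A A' \<longleftrightarrow>
     (\<exists>U V. rational_function U \<and> rational_function V \<and> A = U \<circ> V \<and> A' = V \<circ> U)"

text \<open>
  Being an elementary transformation is a symmetric relation (exchange \<open>U\<close> and \<open>V\<close>), so the
  reflexive transitive closure is the equivalence relation generated by it.
\<close>

definition elementary_equiv ::
  "(riemann_sphere \<Rightarrow> riemann_sphere) \<Rightarrow> (riemann_sphere \<Rightarrow> riemann_sphere) \<Rightarrow> bool"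
  (infix "\<sim>\<^sub>e" 50) where
  "A \<sim>\<^sub>e A' \<longleftrightarrow> elementary_transformation\<^sup>*\<^sup>* A A'"

end

theory Submission
  imports Defs
begin

text \<open>
  The group \<open>\<Gamma>\<close> of \<open>\<sigma>\<close> with \<open>A\<^sup>k \<circ> \<sigma> = A\<^sup>k\<close> is finite, and it preserves the
  local degrees of \<open>A\<^sup>k\<close>; the stabilizer of a point \<open>z\<close> has order at most the local degree of
  \<open>A\<^sup>k\<close> at \<open>z\<close>. Since \<open>A\<close> has at most \<open>2n\<close> critical points, that local degree is at most
  \<open>n\<^sup>2\<^sup>n\<close> unless the orbit of \<open>z\<close> runs into a periodic critical point \<open>c\<close>. If the backward
  orbit of such a \<open>c\<close> has at least three points, a Lyapunov function on it singles out a
  \<open>\<Gamma>\<close>-invariant set of between \<open>3\<close> and \<open>4n\<close> points, and a Moebius transformation is determined by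
  its values at three points. Otherwise \<open>c\<close> is the only periodic critical point and is fixed by
  \<open>\<Gamma>\<close>, since a backward invariant pair of points would make \<open>A\<close> conjugate to \<open>z\<^sup>n\<close> or \<open>z\<^sup>-\<^sup>n\<close>; all
  other stabilizers are of bounded order, and Burnside's count of fixed points bounds \<open>\<Gamma>\<close>.

  For \<open>B = \<sigma> \<circ> A\<close> and \<open>X = A\<^sup>k\<close> one has \<open>A \<circ> X = X \<circ> B\<close>. As \<open>X\<close> is a left
  compositional factor of \<open>A\<^sup>k\<close>, the pair \<open>(X, B)\<close> is not generically injective unless \<open>deg X = 1\<close>,
  so Luroth's theorem yields a common right factor \<open>X = X' \<circ> V\<close>, \<open>B = B' \<circ> V\<close>. Then
  \<open>A \<circ> X' = X' \<circ> (V \<circ> B')\<close> with \<open>V \<circ> B'\<close> elementarily equivalent to \<open>B\<close>, and the degree of \<open>X\<close>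
  has dropped.
\<close>

section \<open>Rational functions in homogeneous coordinates\<close>

text \<open>The obstacle is uniformity in \<open>k\<close>: the degree \<open>n ^ k\<close> of
  \<open>A ^^ k\<close> bounds each single group, but the bound grows with \<open>k\<close>. Only
  data of \<open>A\<close> itself may enter, and products of local degrees along an orbit stay
  bounded except near a cycle with a critical point on it. There the unbounded growth is turned to
  use, because its exponential rate is intrinsic and hence respected by all symmetries at once.

  For the equivalence a semiconjugacy alone is not enough: \<open>z + 1/z\<close> semiconjugates
  \<open>z^n\<close> to a Chebyshev polynomial, yet the pair of \<open>z + 1/z\<close> and
  \<open>z^n\<close> is generically injective, so no common right factor can be split off. The
  equation \<open>X \<circ> W = A ^^ k\<close> excludes such cases and is inherited by the smaller
  factor.

  No complex analysis is used. The sphere is a bare datatype and rational functions are pairs of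
  binary forms; local degrees are orders of roots, and field-theoretic arguments are replaced by
  counting roots of generic specialisations.\<close>

text \<open>The point with homogeneous coordinates \<open>[x : y]\<close>; the value at \<open>[0 : 0]\<close> is junk.\<close>

definition proj_point :: "complex \<Rightarrow> complex \<Rightarrow> riemann_sphere" where
  "proj_point x y = (if y = 0 then Infty else Fin (x / y))"

text \<open>The value at \<open>(x, y)\<close> of the binary form \<open>y\<^sup>d f(x / y)\<close>, for \<open>f\<close> of degree at most \<open>d\<close>.\<close>

definition homog_val :: "nat \<Rightarrow> complex poly \<Rightarrow> complex \<Rightarrow> complex \<Rightarrow> complex" where
  "homog_val d f x y = (\<Sum>i\<le>d. coeff f i * x ^ i * y ^ (d - i))"

text \<open>The substitution of \<open>r / s\<close> into \<open>f\<close>, cleared by the power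
  \<open>s ^ d\<close> for a prescribed \<open>d\<close>, so that numerator and denominator of an
  outer function are cleared by the same factor.\<close>

definition homog_comp :: "nat \<Rightarrow> complex poly \<Rightarrow> complex poly \<Rightarrow> complex poly \<Rightarrow> complex poly" where
  "homog_comp d f r s = (\<Sum>i\<le>d. smult (coeff f i) (r ^ i * s ^ (d - i)))"

lemma proj_point_cases:
  obtains x y where "z = proj_point x y" "x \<noteq> 0 \<or> y \<noteq> 0"
proof (cases z)
  case (Fin w)
  then show ?thesis using that[of w 1] by (simp add: proj_point_def)
next
  case Infty
  then show ?thesis using that[of 1 0] by (simp add: proj_point_def)
qed

lemma proj_point_eq_iff:
  assumes "x \<noteq> 0 \<or> y \<noteq> 0" "u \<noteq> 0 \<or> v \<noteq> 0"
  shows "proj_point x y = proj_point u v \<longleftrightarrow> x * v = u * y"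
  using assms by (auto simp: proj_point_def field_simps)

lemma rat_map_Fin: "rat_map p q (Fin z) = proj_point (poly p z) (poly q z)"
  by (simp add: rat_map_def proj_point_def)

lemma rat_map_Infty:
  "max (degree p) (degree q) = d \<Longrightarrow> rat_map p q Infty = proj_point (coeff p d) (coeff q d)"
  by (auto simp: rat_map_def proj_point_def Let_def)

lemma homog_val_0: "homog_val d f x 0 = coeff f d * x ^ d"
proof -
  have "homog_val d f x 0 = (\<Sum>i\<le>d. if i = d then coeff f i * x ^ i else 0)"
    unfolding homog_val_def by (rule sum.cong) auto
  then show ?thesis by simp
qed

lemma homog_val_nz:
  assumes "degree f \<le> d" "y \<noteq> 0"
  shows "homog_val d f x y = y ^ d * poly f (x / y)"
proof -
  have "poly f (x / y) = (\<Sum>i\<le>d. coeff f i * (x / y) ^ i)"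
    unfolding poly_altdef using assms(1) by (intro sum.mono_neutral_left) (auto simp: coeff_eq_0)
  also have "y ^ d * \<dots> = (\<Sum>i\<le>d. coeff f i * x ^ i * y ^ (d - i))"
    unfolding sum_distrib_left
  proof (rule sum.cong)
    fix i assume "i \<in> {..d}"
    then have "y ^ d = y ^ i * y ^ (d - i)" by (simp flip: power_add)
    then show "y ^ d * (coeff f i * (x / y) ^ i) = coeff f i * x ^ i * y ^ (d - i)"
      using assms(2) by (simp add: power_divide)
  qed simp
  finally show ?thesis by (simp add: homog_val_def)
qed

lemma poly_homog_comp: "poly (homog_comp d f r s) z = homog_val d f (poly r z) (poly s z)"
  by (simp add: homog_comp_def homog_val_def poly_sum mult.assoc)

lemma degree_prod_pow_le:
  fixes r s :: "complex poly"
  assumes "degree r \<le> e" "degree s \<le> e" "i \<le> d"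
  shows "degree (r ^ i * s ^ (d - i)) \<le> d * e"
proof -
  have "degree (r ^ i * s ^ (d - i)) \<le> degree r * i + degree s * (d - i)"
    by (meson add_mono degree_mult_le degree_power_le order_trans)
  also have "\<dots> \<le> e * i + e * (d - i)"
    using assms by (intro add_mono mult_le_mono) auto
  also have "\<dots> = d * e"
    using assms(3) by (metis distrib_left le_add_diff_inverse mult.commute)
  finally show ?thesis .
qed

lemma degree_homog_comp_le:
  assumes "degree r \<le> e" "degree s \<le> e"
  shows "degree (homog_comp d f r s) \<le> d * e"
  unfolding homog_comp_def using degree_prod_pow_le[OF assms]
  by (intro degree_sum_le) (auto intro: order_trans[OF degree_smult_le])

text \<open>At \<open>Infty\<close> the coefficient at a formal degree takes the place of a value.
  It is multiplicative even where the true degree is smaller, for then both sides vanish.\<close>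

lemma coeff_mult_le:
  fixes r s :: "complex poly"
  assumes "degree r \<le> a" "degree s \<le> b"
  shows "coeff (r * s) (a + b) = coeff r a * coeff s b"
proof (cases "degree r = a \<and> degree s = b")
  case True
  then show ?thesis using coeff_mult_degree_sum[of r s] by simp
next
  case False
  then have "degree r + degree s < a + b" "coeff r a = 0 \<or> coeff s b = 0"
    using assms by (auto intro: coeff_eq_0)
  moreover have "degree (r * s) < a + b"
    using calculation(1) degree_mult_le[of r s] by linarith
  ultimately show ?thesis by (auto simp: coeff_eq_0)
qed

lemma coeff_power_le:
  fixes r :: "complex poly"
  assumes "degree r \<le> a"
  shows "coeff (r ^ i) (i * a) = coeff r a ^ i"
proof (induction i)
  case (Suc i)
  have "degree (r ^ i) \<le> i * a"
    using degree_power_le[of r i] mult_le_mono1[OF assms, of i] by (metis le_trans mult.commute)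
  then show ?case
    using coeff_mult_le[OF assms, of "r ^ i" "i * a"] Suc by simp
qed simp

text \<open>The counterpart at \<open>Infty\<close> of \<open>poly_homog_comp\<close>.\<close>

lemma coeff_homog_comp:
  assumes "degree r \<le> e" "degree s \<le> e"
  shows "coeff (homog_comp d f r s) (d * e) = homog_val d f (coeff r e) (coeff s e)"
proof -
  have "coeff (r ^ i * s ^ (d - i)) (d * e) = coeff r e ^ i * coeff s e ^ (d - i)" if "i \<le> d" for i
  proof -
    have de: "d * e = i * e + (d - i) * e"
      using that by (metis add_mult_distrib le_add_diff_inverse)
    have "degree (r ^ i) \<le> i * e" "degree (s ^ (d - i)) \<le> (d - i) * e"
      using assms by (auto intro!: order_trans[OF degree_power_le] simp: mult.commute)
    from coeff_mult_le[OF this] show ?thesis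
      unfolding de by (simp add: coeff_power_le assms)
  qed
  then show ?thesis
    by (auto simp: homog_comp_def homog_val_def coeff_sum mult.assoc intro!: sum.cong)
qed

lemma coprime_poly_nz:
  fixes p q :: "complex poly"
  assumes "coprime p q" 
  shows "poly p z \<noteq> 0 \<or> poly q z \<noteq> 0"
proof (rule ccontr)
  assume "\<not> ?thesis"
  then have "[:-z, 1:] dvd p" "[:-z, 1:] dvd q"
    by (auto simp: poly_eq_0_iff_dvd)
  then have "is_unit [:-z, 1:]"
    using assms coprime_common_divisor by blast
  then show False by (simp add: is_unit_poly_iff)
qed

lemma coprimeI_poly:
  fixes p q :: "complex poly"
  assumes "\<And>z. poly p z \<noteq> 0 \<or> poly q z \<noteq> 0"
  shows "coprime p q"
proof (rule coprimeI)
  fix c assume c: "c dvd p" "c dvd q"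
  have nr: "poly c z \<noteq> 0" for z
    using assms[of z] c by (auto elim!: dvdE)
  then have "degree c = 0"
    using fundamental_theorem_of_algebra_alt[of c] 
    by (metis degree_pCons_0)
  then obtain a where "c = [:a:]" by (metis degree_eq_zeroE)
  with nr[of 0] show "is_unit c" by (auto simp: is_unit_const_poly_iff dvd_field_iff)
qed

lemma coprime_coeff_nz:
  fixes p q :: "complex poly"
  assumes "coprime p q" "q \<noteq> 0" "d = max (degree p) (degree q)"
  shows "coeff p d \<noteq> 0 \<or> coeff q d \<noteq> 0"
proof (cases "degree p \<le> degree q")
  case True
  then show ?thesis using assms(2,3) by auto
next
  case False
  then have "d = degree p" "p \<noteq> 0" using assms(3) by auto
  then show ?thesis by simp
qed

lemma homog_val_nonzero:
  assumes "coprime p q" "q \<noteq> 0" "d = max (degree p) (degree q)" "x \<noteq> 0 \<or> y \<noteq> 0"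
  shows "homog_val d p x y \<noteq> 0 \<or> homog_val d q x y \<noteq> 0"
proof (cases "y = 0")
  case True
  then show ?thesis
    using coprime_coeff_nz[OF assms(1-3)] assms(4) by (auto simp: homog_val_0)
next
  case False
  then show ?thesis
    using coprime_poly_nz[OF assms(1), of "x / y"] assms(3) by (auto simp: homog_val_nz)
qed

lemma rat_map_proj_point:
  assumes "d = max (degree p) (degree q)" "x \<noteq> 0 \<or> y \<noteq> 0"
  shows "rat_map p q (proj_point x y) = proj_point (homog_val d p x y) (homog_val d q x y)"
proof (cases "y = 0")
  case True
  then show ?thesis
    using assms by (auto simp: homog_val_0 rat_map_Infty[of p q d] proj_point_def)
next
  case False
  then show ?thesis
    using assms by (auto simp: homog_val_nz rat_map_Fin proj_point_def)
qed

text \<open>Carries rationality and degree in one relation, which avoids reasoning about the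
  definite description in \<open>rat_degree\<close>.\<close>

definition rational_deg :: "nat \<Rightarrow> (riemann_sphere \<Rightarrow> riemann_sphere) \<Rightarrow> bool" where
  "rational_deg n F \<longleftrightarrow> (\<exists>p q. coprime p q \<and> q \<noteq> 0 \<and> F = rat_map p q \<and> max (degree p) (degree q) = n)"

lemma rational_deg_rational: "rational_deg n F \<Longrightarrow> rational_function F"
  by (auto simp: rational_deg_def rational_function_def)

lemma rational_deg_iff: "rational_deg n F \<longleftrightarrow> rational_function F \<and> rat_degree F = n"
proof
  assume "rational_deg n F"
  then show "rational_function F \<and> rat_degree F = n"
    using rat_degree_rat_map by (auto simp: rational_deg_def rational_function_def)
next
  assume "rational_function F \<and> rat_degree F = n"
  then show "rational_deg n F"
    using rat_degree_rat_map by (metis rational_function_def rational_deg_def)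
qed

lemma rational_deg_unique: "rational_deg n F \<Longrightarrow> rational_deg m F \<Longrightarrow> n = m"
  by (simp add: rational_deg_iff)

lemma rational_degE:
  assumes "rational_deg n F"
  obtains p q where "coprime p q" "q \<noteq> 0" "F = rat_map p q" "max (degree p) (degree q) = n"
  using assms by (auto simp: rational_deg_def)

lemma rational_degI:
  "coprime p q \<Longrightarrow> q \<noteq> 0 \<Longrightarrow> max (degree p) (degree q) = n \<Longrightarrow> rational_deg n (rat_map p q)"
  by (auto simp: rational_deg_def)

text \<open>Nothing cancels in a composition: the forms of \<open>p\<close> and \<open>q\<close>
  have no common zero besides the origin, and \<open>(r, s)\<close> never meets the origin, neither
  at finite points nor, through the coefficients of degree \<open>e\<close>, at
  \<open>Infty\<close>. Hence degrees multiply.\<close>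

lemma rat_map_comp:
  assumes pq: "coprime p q" "q \<noteq> 0" and d: "max (degree p) (degree q) = d" "d > 0"
    and rs: "coprime r s" "s \<noteq> 0" and e: "max (degree r) (degree s) = e" "e > 0"
  defines "P \<equiv> homog_comp d p r s" and "Q \<equiv> homog_comp d q r s"
  shows "coprime P Q" "Q \<noteq> 0" "max (degree P) (degree Q) = d * e"
    "rat_map p q \<circ> rat_map r s = rat_map P Q"
proof -
  have nz: "poly r z \<noteq> 0 \<or> poly s z \<noteq> 0" for z
    using coprime_poly_nz rs by blast
  show cop: "coprime P Q"
    by (rule coprimeI_poly) (use homog_val_nonzero[OF pq] d nz in \<open>auto simp: P_def Q_def poly_homog_comp\<close>)
  have le: "degree r \<le> e" "degree s \<le> e" using e by auto
  have nzc: "coeff r e \<noteq> 0 \<or> coeff s e \<noteq> 0"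
    using coprime_coeff_nz[OF rs] e by auto
  have cc: "coeff P (d * e) = homog_val d p (coeff r e) (coeff s e)"
    "coeff Q (d * e) = homog_val d q (coeff r e) (coeff s e)"
    using le by (simp_all add: P_def Q_def coeff_homog_comp)
  have "coeff P (d * e) \<noteq> 0 \<or> coeff Q (d * e) \<noteq> 0"
    unfolding cc using homog_val_nonzero[OF pq] d nzc by blast
  moreover have "degree P \<le> d * e" "degree Q \<le> d * e"
    using degree_homog_comp_le[OF le] by (auto simp: P_def Q_def)
  ultimately show deg: "max (degree P) (degree Q) = d * e"
    by (auto dest!: le_degree)
  show "Q \<noteq> 0"
  proof
    assume "Q = 0"
    with cop have "is_unit P" by simp
    then have "degree P = 0" by (auto simp: is_unit_poly_iff)
    with deg \<open>Q = 0\<close> d e show False by simp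
  qed
  show "rat_map p q \<circ> rat_map r s = rat_map P Q"
  proof
    fix x
    show "(rat_map p q \<circ> rat_map r s) x = rat_map P Q x"
    proof (cases x)
      case (Fin z)
      then show ?thesis
        using rat_map_proj_point[of d p q] d nz by (simp add: rat_map_Fin P_def Q_def poly_homog_comp)
    next
      case Infty
      then show ?thesis
        using rat_map_proj_point[of d p q] d nzc 
        by (simp add: rat_map_Infty[OF e(1)] rat_map_Infty[OF deg] cc)
    qed
  qed
qed

lemma rational_deg_comp:
  assumes "rational_deg d F" "rational_deg e G" "d > 0" "e > 0"
  shows "rational_deg (d * e) (F \<circ> G)"
proof -
  from assms(1) obtain p q where pq: "coprime p q" "q \<noteq> 0" "F = rat_map p q" "max (degree p) (degree q) = d"
    by (rule rational_degE)
  from assms(2) obtain r s where rs: "coprime r s" "s \<noteq> 0" "G = rat_map r s" "max (degree r) (degree s) = e"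
    by (rule rational_degE)
  show ?thesis
    unfolding rational_deg_def pq(3) rs(3)
    using rat_map_comp[OF pq(1,2,4) assms(3) rs(1,2,4) assms(4)] by blast
qed

lemma rational_deg_id: "rational_deg 1 id"
proof -
  have "id = rat_map [:0, 1:] 1"
    by (rule ext) (simp add: rat_map_def split: riemann_sphere.split)
  then show ?thesis
    unfolding rational_deg_def by (intro exI[of _ "[:0,1:]"] exI[of _ 1]) auto
qed

lemma rational_deg_funpow:
  assumes "rational_deg n A" "n > 0"
  shows "rational_deg (n ^ k) (A ^^ k)"
proof (induction k)
  case 0
  then show ?case using rational_deg_id by (simp add: id_def)
next
  case (Suc k)
  then show ?case using rational_deg_comp[OF assms(1) Suc] assms(2) by (simp add: o_def)
qed

text \<open>Two functions agree exactly at the zeros on the sphere of the binary form of degree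
  \<open>a + b\<close> that dehomogenises to \<open>p * s - r * q\<close>, and a form with more than
  \<open>a + b\<close> zeros is zero.\<close>

lemma rational_deg_agree:
  assumes F: "rational_deg a F" and G: "rational_deg b G" and S: "finite S" "card S > a + b"
    and eq: "\<And>x. x \<in> S \<Longrightarrow> F x = G x"
  shows "F = G"
proof -
  from F obtain p q where pq: "coprime p q" "q \<noteq> 0" "F = rat_map p q" "max (degree p) (degree q) = a"
    by (rule rational_degE)
  from G obtain r s where rs: "coprime r s" "s \<noteq> 0" "G = rat_map r s" "max (degree r) (degree s) = b"
    by (rule rational_degE)
  have agree: "F x = G x \<longleftrightarrow> (case x of Fin z \<Rightarrow> poly (p * s - r * q) z = 0 
      | Infty \<Rightarrow> coeff (p * s - r * q) (a + b) = 0)" for x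
  proof (cases x)
    case (Fin z)
    then show ?thesis
      using proj_point_eq_iff coprime_poly_nz[OF pq(1)] coprime_poly_nz[OF rs(1)]
      by (simp add: pq(3) rs(3) rat_map_Fin)
  next
    case Infty
    have "coeff (p * s) (a + b) = coeff p a * coeff s b" "coeff (r * q) (b + a) = coeff r b * coeff q a"
      using pq(4) rs(4) by (auto intro!: coeff_mult_le)
    then show ?thesis
      using proj_point_eq_iff coprime_coeff_nz[OF pq(1,2)] coprime_coeff_nz[OF rs(1,2)] pq(4) rs(4) Infty
      by (simp add: pq(3) rs(3) rat_map_Infty[OF pq(4)] rat_map_Infty[OF rs(4)] add.commute)
  qed
  define f where "f = p * s - r * q"
  have dle: "degree f \<le> a + b"
    unfolding f_def using pq(4) rs(4)
    by (intro degree_diff_le) (auto intro!: order_trans[OF degree_mult_le])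
  have f0: "f = 0"
  proof (rule ccontr)
    assume f: "f \<noteq> 0"
    let ?R = "Fin ` {z. poly f z = 0}"
    have fin: "finite ?R" using f poly_roots_finite by auto
    have card: "card ?R \<le> degree f"
      using card_image_le[OF poly_roots_finite[OF f], of Fin] card_poly_roots_bound[OF f] by linarith
    have sub: "S \<subseteq> (if Infty \<in> S then insert Infty ?R else ?R)"
    proof
      fix x assume "x \<in> S"
      then show "x \<in> (if Infty \<in> S then insert Infty ?R else ?R)"
        using eq[of x] agree[of x] by (cases x) (auto simp: f_def)
    qed
    show False
    proof (cases "Infty \<in> S")
      case True
      then have "coeff f (a + b) = 0"
        using eq[of Infty] agree[of Infty] by (auto simp: f_def)
      \<comment> \<open>Agreement at \<open>Infty\<close> lowers the degree, which pays for the
        extra point.\<close>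
      then have "degree f \<noteq> a + b" using f by (metis leading_coeff_0_iff)
      then have "degree f < a + b" using dle by simp
      moreover have "card S \<le> card (insert Infty ?R)"
        using True sub fin by (intro card_mono) auto
      moreover have "card (insert Infty ?R) \<le> Suc (card ?R)" 
        by (simp add: card_insert_le_m1 fin card_insert_if)
      ultimately show False using S card by linarith
    next
      case False
      then have "card S \<le> card ?R"
        using sub fin by (intro card_mono) auto
      then show False using S card dle by linarith
    qed
  qed
  show ?thesis
  proof
    fix x
    show "F x = G x"
      unfolding agree f0[unfolded f_def] by (cases x) auto
  qed
qed

lemma rational_deg_agree_infinite:
  assumes "rational_deg a F" "rational_deg b G" "infinite {x. F x = G x}"
  shows "F = G"
proof -
  obtain S where S: "finite S" "card S = Suc (a + b)" "S \<subseteq> {x. F x = G x}"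
    using infinite_arbitrarily_large[OF assms(3), of "Suc (a + b)"] by (elim exE conjE)
  show ?thesis
    by (rule rational_deg_agree[OF assms(1,2) S(1)]) (use S(2,3) in auto)
qed

text \<open>A fibre is the set of agreement with a constant function.\<close>

lemma rational_deg_fibre_finite_card:
  assumes F: "rational_deg d F" "d > 0"
  shows "finite {x. F x = y}" "card {x. F x = y} \<le> d"
proof -
  have *: "card S \<le> d" if S: "finite S" "S \<subseteq> {x. F x = y}" for S
  proof (rule ccontr)
    assume "\<not> card S \<le> d"
    show False
    proof (cases y)
      case (Fin c)
      have "rational_deg 0 (rat_map [:c:] 1)" by (intro rational_degI) auto
      moreover have "rat_map [:c:] 1 x = Fin c" for x
        by (auto simp: rat_map_def split: riemann_sphere.split)
      ultimately have "F = rat_map [:c:] 1"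
        by (intro rational_deg_agree[OF F(1) _ S(1)]) (use \<open>\<not> card S \<le> d\<close> S(2) Fin in auto)
      then show False using \<open>rational_deg 0 _\<close> F rational_deg_unique by blast
    next
      case Infty
      \<comment> \<open>The constant \<open>Infty\<close> has no representation with nonzero
        denominator, so the fibre is first moved over \<open>Fin 0\<close> by
        \<open>1 / z\<close>.\<close>
      have i: "rational_deg 1 (rat_map 1 [:0,1:])" by (intro rational_degI) auto
      have "rat_map 1 [:0,1:] Infty = Fin 0" by (simp add: rat_map_def)
      have "rational_deg (1 * d) (rat_map 1 [:0,1:] \<circ> F)"
        by (rule rational_deg_comp[OF i F(1)]) (use F in auto)
      then have i: "rational_deg d (rat_map 1 [:0,1:] \<circ> F)" by simp
      have "rational_deg 0 (rat_map [:0:] 1)" by (intro rational_degI) auto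
      moreover have "rat_map [:0:] 1 x = Fin 0" for x
        by (auto simp: rat_map_def split: riemann_sphere.split)
      ultimately have "rat_map 1 [:0,1:] \<circ> F = rat_map [:0:] 1"
        by (intro rational_deg_agree[OF i _ S(1)])
          (use \<open>\<not> card S \<le> d\<close> S(2) Infty \<open>rat_map 1 [:0,1:] Infty = Fin 0\<close> in auto)
      then show False using rational_deg_unique[OF \<open>rational_deg 0 _\<close>, of d] F i by simp
    qed
  qed
  show "finite {x. F x = y}"
  proof (rule ccontr)
    assume "infinite {x. F x = y}"
    then obtain S where S: "finite S" "card S = Suc d" "S \<subseteq> {x. F x = y}"
      using infinite_arbitrarily_large[OF \<open>infinite {x. F x = y}\<close>, of "Suc d"] by (elim exE conjE)
    show False using *[OF S(1,3)] S(2) by simp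
  qed
  then show "card {x. F x = y} \<le> d" using *[of "{x. F x = y}"] by simp
qed

text \<open>The equation \<open>F x = y\<close> is linear in \<open>p\<close> and \<open>q\<close>:
  either the polynomial \<open>f\<close> has a root, or its coefficient of degree \<open>d\<close>
  vanishes and \<open>Infty\<close> is a solution.\<close>

lemma rational_deg_surj:
  assumes F: "rational_deg d F" "d > 0"
  shows "\<exists>x. F x = y"
proof -
  from F obtain p q where pq: "coprime p q" "q \<noteq> 0" "F = rat_map p q" "max (degree p) (degree q) = d"
    by (auto elim: rational_degE)
  obtain u v where y: "y = proj_point u v" "u \<noteq> 0 \<or> v \<noteq> 0" by (rule proj_point_cases)
  define f where "f = smult v p - smult u q"
  have eq: "F x = y \<longleftrightarrow> (case x of Fin z \<Rightarrow> poly f z = 0 | Infty \<Rightarrow> coeff f d = 0)" for x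
  proof (cases x)
    case (Fin z)
    then show ?thesis
      using proj_point_eq_iff coprime_poly_nz[OF pq(1)] y
      by (simp add: pq(3) rat_map_Fin f_def algebra_simps)
  next
    case Infty
    then show ?thesis
      using proj_point_eq_iff coprime_coeff_nz[OF pq(1,2)] y pq(4) 
      by (simp add: pq(3) rat_map_Infty[OF pq(4)] f_def algebra_simps)
  qed
  show ?thesis
  proof (cases "coeff f d = 0")
    case True
    then show ?thesis using eq[of Infty] by auto
  next
    case False
    then have "degree f > 0" using F(2) le_degree by fastforce
    then obtain z where "poly f z = 0"
      using fundamental_theorem_of_algebra[of f] constant_degree[of f] by auto
    then show ?thesis using eq[of "Fin z"] by auto
  qed
qed

lemma infinite_riemann_sphere: "infinite (UNIV :: riemann_sphere set)"
proof -
  have "inj Fin" by (simp add: inj_def)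
  then have "infinite (range Fin)"
    using infinite_UNIV_char_0[where 'a=complex] finite_imageD by blast
  then show ?thesis using finite_subset[of "range Fin" UNIV] by auto
qed

section \<open>Moebius transformations and local degrees\<close>

lemma moebius_rational_deg: "moebius \<sigma> \<longleftrightarrow> rational_deg 1 \<sigma>"
proof
  assume "moebius \<sigma>"
  then obtain a b c d where ad: "a * d - b * c \<noteq> 0" "\<sigma> = rat_map [:b, a:] [:d, c:]"
    by (auto simp: moebius_def)
  have "coprime [:b, a:] [:d, c:]"
  proof (rule coprimeI_poly)
    fix z
    have "a * (d + z * c) - c * (b + z * a) = a * d - b * c" by (simp add: algebra_simps)
    then show "poly [:b, a:] z \<noteq> 0 \<or> poly [:d, c:] z \<noteq> 0" using ad(1) by auto
  qed
  moreover have "[:d, c:] \<noteq> 0" using ad(1) by auto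
  moreover have "max (degree [:b, a:]) (degree [:d, c:]) = 1" using ad(1) by auto
  ultimately show "rational_deg 1 \<sigma>" unfolding ad(2) by (rule rational_degI)
next
  assume "rational_deg 1 \<sigma>"
  then obtain p q where pq: "coprime p q" "q \<noteq> 0" "\<sigma> = rat_map p q" "max (degree p) (degree q) = 1"
    by (rule rational_degE)
  have lin: "f = [:coeff f 0, coeff f 1:]" if "degree f \<le> 1" for f :: "complex poly"
  proof (rule poly_eqI)
    fix n show "coeff f n = coeff [:coeff f 0, coeff f 1:] n"
      using that by (cases n; cases "n - 1") (auto simp: coeff_eq_0 coeff_pCons split: nat.split)
  qed
  obtain a b where p: "p = [:b, a:]" using lin[of p] pq(4) by force
  obtain c d where q: "q = [:d, c:]" using lin[of q] pq(4) by force
  have "a * d - b * c \<noteq> 0"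
  proof
    assume 0: "a * d - b * c = 0"
    show False
    proof (cases "c = 0")
      case True
      then have "a \<noteq> 0" using pq(4) by (auto simp: p q)
      then show False using True 0 pq(2) by (auto simp: q)
    next
      case False
      then show False using coprime_poly_nz[OF pq(1), of "- d / c"] 0 
        by (auto simp: p q field_simps)
    qed
  qed
  then show "moebius \<sigma>" unfolding moebius_def using pq(3) p q by blast
qed

lemma moebius_proj_point:
  assumes "a * d - b * c \<noteq> 0" "x \<noteq> 0 \<or> y \<noteq> 0"
  shows "rat_map [:b, a:] [:d, c:] (proj_point x y) = proj_point (a * x + b * y) (c * x + d * y)"
proof -
  have 1: "1 = max (degree [:b, a:]) (degree [:d, c:])" using assms by auto
  show ?thesis
    using rat_map_proj_point[OF 1 assms(2)] by (simp add: homog_val_def algebra_simps)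
qed

lemma moebius_comp: "moebius \<sigma> \<Longrightarrow> moebius \<tau> \<Longrightarrow> moebius (\<sigma> \<circ> \<tau>)"
  using rational_deg_comp[of 1 \<sigma> 1 \<tau>] by (simp add: moebius_rational_deg)

lemma moebius_id: "moebius id"
  using rational_deg_id by (simp add: moebius_rational_deg)

lemma moebius_inverse:
  assumes "moebius \<sigma>"
  obtains \<tau> where "moebius \<tau>" "\<tau> \<circ> \<sigma> = id" "\<sigma> \<circ> \<tau> = id"
proof -
  from assms obtain a b c d where ad: "a * d - b * c \<noteq> 0" "\<sigma> = rat_map [:b, a:] [:d, c:]"
    by (auto simp: moebius_def)
  have ad': "d * a - (-b) * (-c) \<noteq> 0" using ad(1) by (simp add: mult.commute)
  \<comment> \<open>The adjugate matrix.\<close>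
  define \<tau> where "\<tau> = rat_map [:-b, d:] [:a, -c:]"
  have m: "moebius \<tau>" using ad' unfolding moebius_def \<tau>_def by blast
  have nz: "a * x + b * y \<noteq> 0 \<or> c * x + d * y \<noteq> 0" if "x \<noteq> 0 \<or> y \<noteq> 0" for x y
  proof (rule ccontr)
    assume n: "\<not> ?thesis"
    have "d * (a * x + b * y) - b * (c * x + d * y) = (a * d - b * c) * x"
      "a * (c * x + d * y) - c * (a * x + b * y) = (a * d - b * c) * y" by (simp_all add: algebra_simps)
    then show False using n that ad(1) by auto
  qed
  have "\<tau> (\<sigma> z) = z" for z
  proof -
    obtain x y where z: "z = proj_point x y" "x \<noteq> 0 \<or> y \<noteq> 0" by (rule proj_point_cases)
    have "\<tau> (\<sigma> z) = proj_point (d * (a * x + b * y) + (-b) * (c * x + d * y)) ((-c) * (a * x + b * y) + a * (c * x + d * y))"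
      unfolding ad(2) z(1) moebius_proj_point[OF ad(1) z(2)] \<tau>_def using moebius_proj_point[OF ad' nz[OF z(2)]] .
    also have "\<dots> = proj_point ((a * d - b * c) * x) ((a * d - b * c) * y)" by (simp add: algebra_simps)
    also have "\<dots> = proj_point x y" using ad(1) by (auto simp: proj_point_def)
    finally show ?thesis by (simp add: z)
  qed
  then have 1: "\<tau> \<circ> \<sigma> = id" by (simp add: fun_eq_iff)
  have "\<sigma> (\<tau> z) = z" for z
  proof -
    obtain x where x: "z = \<sigma> x" 
      using rational_deg_surj[of 1 \<sigma> z] assms by (auto simp: moebius_rational_deg)
    show ?thesis using \<open>\<And>z. \<tau> (\<sigma> z) = z\<close> by (simp add: x)
  qed
  then have "\<sigma> \<circ> \<tau> = id" by (simp add: fun_eq_iff)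
  with 1 m show ?thesis using that by blast
qed

lemma moebius_bij: "moebius \<sigma> \<Longrightarrow> bij \<sigma>"
  by (metis moebius_inverse o_bij)

lemma moebius_eq:
  assumes "moebius \<sigma>" "moebius \<tau>" "a \<noteq> b" "b \<noteq> c" "a \<noteq> c" "\<sigma> a = \<tau> a" "\<sigma> b = \<tau> b" "\<sigma> c = \<tau> c"
  shows "\<sigma> = \<tau>"
  by (rule rational_deg_agree[of 1 _ 1 _ "{a, b, c}"]) (use assms in \<open>auto simp: moebius_rational_deg\<close>)

lemma moebius_to_Infty: obtains \<mu> where "moebius \<mu>" "\<mu> z = Infty"
proof (cases z)
  case (Fin w)
  have "moebius (rat_map [:1, 0:] [:-w, 1:])"
    unfolding moebius_def by (rule exI[of _ 0], rule exI[of _ 1], rule exI[of _ 1], rule exI[of _ "-w"]) simp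
  then show ?thesis using that Fin by (auto simp: rat_map_def)
next
  case Infty
  then show ?thesis using that moebius_id by auto
qed

lemma moebius_to_Infty_0:
  assumes "z \<noteq> w"
  obtains \<mu> where "moebius \<mu>" "\<mu> z = Infty" "\<mu> w = Fin 0"
proof -
  obtain \<mu> where mu: "moebius \<mu>" "\<mu> z = Infty" by (rule moebius_to_Infty)
  have "\<mu> w \<noteq> Infty" using moebius_bij[OF mu(1)] mu(2) assms by (metis bij_is_inj inj_eq)
  then obtain c where c: "\<mu> w = Fin c" by (cases "\<mu> w") auto
  let ?t = "rat_map [:-c, 1:] [:1, 0:]"
  have "moebius ?t"
    unfolding moebius_def by (rule exI[of _ 1], rule exI[of _ "-c"], rule exI[of _ 0], rule exI[of _ 1]) simp
  then have "moebius (?t \<circ> \<mu>)" using mu(1) by (rule moebius_comp)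
  moreover have "(?t \<circ> \<mu>) z = Infty" "(?t \<circ> \<mu>) w = Fin 0" using mu c by (simp_all add: rat_map_def)
  ultimately show ?thesis using that by blast
qed

section \<open>Local degrees as orders of vanishing\<close>

definition flip :: "riemann_sphere \<Rightarrow> riemann_sphere" where "flip = rat_map 1 [:0, 1:]"

lemma flip_rational_deg: "rational_deg 1 flip" unfolding flip_def by (intro rational_degI) auto

lemma flip_simps [simp]: "flip Infty = Fin 0" "flip (Fin 0) = Infty" "z \<noteq> 0 \<Longrightarrow> flip (Fin z) = Fin (inverse z)"
  by (simp_all add: flip_def rat_map_def divide_inverse)

lemma flip_flip: "flip \<circ> flip = id"
proof
  fix z show "(flip \<circ> flip) z = id z"
  proof (cases z)
    case (Fin w) then show ?thesis by (cases "w = 0") auto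
  qed simp
qed

lemma rat_map_eq_imp_smult:
  assumes "coprime p q" "q \<noteq> 0" "coprime r s" "s \<noteq> 0" "rat_map p q = rat_map r s"
  obtains c where "c \<noteq> 0" "r = smult c p" "s = smult c q"
proof -
  have cross: "p * s = r * q" using rat_map_eq_imp_cross_eq assms by blast
  have "q dvd p * s" "s dvd r * q" using cross by (auto, metis dvd_triv_right)
  then have "q dvd s" "s dvd q"
    using assms(1,3) by (simp_all add: coprime_dvd_mult_right_iff coprime_commute)
  then obtain u where u: "s = q * u" by auto
  obtain k where "q = s * k" using \<open>s dvd q\<close> by (rule dvdE)
  then have "q * (u * k) = q * 1" using u by (simp add: mult.assoc)
  then have "u * k = 1" using assms(2) by (simp only: mult_cancel_left) simp
  then have "u dvd 1" by (metis dvd_triv_left)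
  then obtain c where c: "u = [:c:]" "c \<noteq> 0" by (auto simp: is_unit_poly_iff dvd_field_iff)
  have s: "s = smult c q" using u c by simp
  then have "r * q = smult c p * q" using cross by simp
  then have "r = smult c p" using assms(2) by (metis mult_cancel_right)
  then show ?thesis using that[OF c(2)] s by simp
qed

text \<open>The multiplicity of \<open>w\<close> as a solution of \<open>F x = F w\<close>. The
  polynomial \<open>q(w) p - p(w) q\<close> covers poles together with finite values, and coprime
  representations differ by a scalar only, which leaves the order unchanged.\<close>

definition finite_local_degree :: "(riemann_sphere \<Rightarrow> riemann_sphere) \<Rightarrow> complex \<Rightarrow> nat" where
  "finite_local_degree F w = (THE e. \<exists>p q. coprime p q \<and> q \<noteq> 0 \<and> F = rat_map p q \<and>
     e = order w (smult (poly q w) p - smult (poly p w) q))"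

definition local_degree :: "(riemann_sphere \<Rightarrow> riemann_sphere) \<Rightarrow> riemann_sphere \<Rightarrow> nat" where
  "local_degree F z = (case z of Fin w \<Rightarrow> finite_local_degree F w | Infty \<Rightarrow> finite_local_degree (F \<circ> flip) 0)"

lemma order_smult_complex: "c \<noteq> 0 \<Longrightarrow> order w (smult c (f :: complex poly)) = order w f"
  by (simp add: order_smult)

lemma order_pow: "f \<noteq> 0 \<Longrightarrow> order w (f ^ a) = a * order w (f :: complex poly)"
  by (induction a) (auto simp: order_mult)

lemma finite_local_degree_rat_map:
  assumes "coprime p q" "q \<noteq> 0"
  shows "finite_local_degree (rat_map p q) w = order w (smult (poly q w) p - smult (poly p w) q)"
  unfolding finite_local_degree_def
proof (rule the_equality)
  show "\<exists>r s. coprime r s \<and> s \<noteq> 0 \<and> rat_map p q = rat_map r s \<and>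
     order w (smult (poly q w) p - smult (poly p w) q) = order w (smult (poly s w) r - smult (poly r w) s)"
    using assms by blast
next
  fix e assume "\<exists>r s. coprime r s \<and> s \<noteq> 0 \<and> rat_map p q = rat_map r s \<and>
     e = order w (smult (poly s w) r - smult (poly r w) s)"
  then obtain r s where rs: "coprime r s" "s \<noteq> 0" "rat_map p q = rat_map r s"
    and e: "e = order w (smult (poly s w) r - smult (poly r w) s)" by blast
  obtain c where c: "c \<noteq> 0" "r = smult c p" "s = smult c q"
    by (rule rat_map_eq_imp_smult[OF assms rs])
  have "smult (poly s w) r - smult (poly r w) s = smult (c * c) (smult (poly q w) p - smult (poly p w) q)"
    by (simp add: c smult_diff_right ac_simps)
  then show "e = order w (smult (poly q w) p - smult (poly p w) q)"
    using e c(1) order_smult_complex[of "c * c"] by simp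
qed

text \<open>Otherwise \<open>p / q\<close> would be constant, against the positive degree.\<close>

lemma comb_nonzero:
  fixes p q :: "complex poly"
  assumes "coprime p q" "max (degree p) (degree q) > 0" "u \<noteq> 0 \<or> v \<noteq> 0"
  shows "smult v p - smult u q \<noteq> 0"
proof
  assume "smult v p - smult u q = 0"
  then have eq: "smult v p = smult u q" by simp
  have "is_unit p \<and> degree q = 0 \<or> is_unit q \<and> degree p = 0"
  proof (cases "v = 0")
    case False
    then have p: "p = smult (u / v) q"
      using eq by (metis (no_types, lifting) divide_inverse left_inverse mult.commute smult_1_left smult_smult)
    then have "q dvd p" by (simp add: dvd_smult)
    then have "is_unit q" using assms(1) by (meson coprime_common_divisor dvd_refl)
    then show ?thesis using p by (auto simp: is_unit_poly_iff)
  next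
    case True
    then have "u \<noteq> 0" using assms(3) by auto
    then have "q = 0" using eq True by auto
    then have "is_unit p" using assms(1) by simp
    then show ?thesis using \<open>q = 0\<close> by simp
  qed
  then show False using assms(2) by (auto simp: is_unit_poly_iff)
qed

lemma homog_comp_nz_poly:
  assumes "degree f \<le> d" "poly s z \<noteq> 0"
  shows "poly (homog_comp d f r s) z = poly s z ^ d * poly f (poly r z / poly s z)"
  using assms by (simp add: poly_homog_comp homog_val_nz)

lemma poly_eq_cofinite:
  fixes f g s :: "complex poly"
  assumes "s \<noteq> 0" "\<And>z. poly s z \<noteq> 0 \<Longrightarrow> poly f z = poly g z"
  shows "f = g"
proof -
  have "poly ((f - g) * s) z = 0" for z using assms(2)[of z] by auto
  then have "(f - g) * s = 0" using poly_all_0_iff_0 by blast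
  then show ?thesis using assms(1) by simp
qed

lemma homog_comp_mult:
  assumes "degree f \<le> a" "degree g \<le> b" "s \<noteq> 0"
  shows "homog_comp (a + b) (f * g) r s = homog_comp a f r s * homog_comp b g r s"
proof (rule poly_eq_cofinite[OF assms(3)])
  fix z assume "poly s z \<noteq> 0"
  moreover have "degree (f * g) \<le> a + b" using assms degree_mult_le[of f g] by linarith
  ultimately show "poly (homog_comp (a + b) (f * g) r s) z = poly (homog_comp a f r s * homog_comp b g r s) z"
    using assms by (simp add: homog_comp_nz_poly power_add)
qed

lemma homog_comp_linear_power:
  assumes "s \<noteq> 0"
  shows "homog_comp a ([:-v, 1:] ^ a) r s = (r - smult v s) ^ a"
proof (rule poly_eq_cofinite[OF assms])
  fix z assume z: "poly s z \<noteq> 0"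
  have "degree ([:-v, 1:] ^ a) \<le> a" using degree_power_le[of "[:-v, 1:]" a] by simp
  then show "poly (homog_comp a ([:-v, 1:] ^ a) r s) z = poly ((r - smult v s) ^ a) z"
    using z by (simp add: homog_comp_nz_poly power_mult_distrib[symmetric] field_simps)
qed

lemma homog_comp_diff_smult: "homog_comp d (smult a f - smult b g) r s = smult a (homog_comp d f r s) - smult b (homog_comp d g r s)"
proof -
  have "poly (homog_comp d (smult a f - smult b g) r s) z = poly (smult a (homog_comp d f r s) - smult b (homog_comp d g r s)) z" for z
    by (simp add: poly_homog_comp homog_val_def sum_distrib_left algebra_simps flip: sum_subtractf)
  then show ?thesis using poly_eq_poly_eq_iff by blast
qed

text \<open>The chain rule for multiplicities. If \<open>g\<close> is
  \<open>[:-v, 1:] ^ a * h\<close> with \<open>h\<close> nonzero at \<open>v\<close>, then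
  substituting \<open>r / s\<close> gives \<open>(r - smult v s) ^ a\<close> times a polynomial that
  does not vanish at \<open>w\<close>.\<close>

lemma finite_local_degree_comp_Fin:
  assumes F: "rational_deg d F" "d > 0" and G: "rational_deg e G" "e > 0" and v: "G (Fin w) = Fin v"
  shows "finite_local_degree (F \<circ> G) w = finite_local_degree F v * finite_local_degree G w"
proof -
  from F(1) obtain p q where pq: "coprime p q" "q \<noteq> 0" "F = rat_map p q" "max (degree p) (degree q) = d"
    by (rule rational_degE)
  from G(1) obtain r s where rs: "coprime r s" "s \<noteq> 0" "G = rat_map r s" "max (degree r) (degree s) = e"
    by (rule rational_degE)
  have sw: "poly s w \<noteq> 0" and vv: "v = poly r w / poly s w"
    using v by (auto simp: rs(3) rat_map_def split: if_splits)
  define P Q where "P = homog_comp d p r s" and "Q = homog_comp d q r s"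
  note comp = rat_map_comp[OF pq(1,2,4) F(2) rs(1,2,4) G(2), folded P_def Q_def]
  define g where "g = smult (poly q v) p - smult (poly p v) q"
  have gnz: "g \<noteq> 0" unfolding g_def
    by (rule comb_nonzero[OF pq(1)]) (use pq(4) F(2) coprime_poly_nz[OF pq(1)] in auto)
  define a where "a = order v g"
  obtain h where h: "g = [:-v, 1:] ^ a * h" "\<not> [:-v, 1:] dvd h"
    using order_decomp[OF gnz, of v] unfolding a_def by blast
  have hv: "poly h v \<noteq> 0" using h(2) by (simp add: poly_eq_0_iff_dvd)
  have dp: "degree p \<le> d" "degree q \<le> d" using pq(4) by auto
  have dg: "degree g \<le> d" unfolding g_def using dp
    by (intro degree_diff_le order_trans[OF degree_smult_le])
  have dg': "degree g = a + degree h"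
    using h(1) gnz by (simp add: degree_mult_eq degree_power_eq)
  have QP: "poly Q w = poly s w ^ d * poly q v" "poly P w = poly s w ^ d * poly p v"
    using dp sw by (simp_all add: P_def Q_def homog_comp_nz_poly vv)
  have "smult (poly Q w) P - smult (poly P w) Q = homog_comp d (smult (poly Q w) p - smult (poly P w) q) r s"
    by (simp add: homog_comp_diff_smult P_def Q_def)
  also have "smult (poly Q w) p - smult (poly P w) q = smult (poly s w ^ d) g"
    by (simp add: QP g_def smult_diff_right)
  also have "homog_comp d (smult (poly s w ^ d) g) r s = smult (poly s w ^ d) (homog_comp d g r s)"
    using homog_comp_diff_smult[of d _ g 0 0] by simp
  also have "homog_comp d g r s = (r - smult v s) ^ a * homog_comp (d - a) h r s"
  proof -
    have "homog_comp (a + (d - a)) ([:-v, 1:] ^ a * h) r s = homog_comp a ([:-v, 1:] ^ a) r s * homog_comp (d - a) h r s"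
      by (rule homog_comp_mult) (use dg dg' degree_power_le[of "[:-v, 1:]" a] rs(2) in auto)
    then show ?thesis using h(1) dg dg' by (simp add: homog_comp_linear_power[OF rs(2)])
  qed
  finally have eq: "smult (poly Q w) P - smult (poly P w) Q =
      smult (poly s w ^ d) ((r - smult v s) ^ a * homog_comp (d - a) h r s)" .
  have "poly (homog_comp (d - a) h r s) w \<noteq> 0"
    using homog_comp_nz_poly[of h "d - a" s w r] dg dg' sw hv by (simp add: vv)
  then have o0: "order w (homog_comp (d - a) h r s) = 0" "homog_comp (d - a) h r s \<noteq> 0"
    using order_root by auto
  have rvs: "smult (poly s w) r - smult (poly r w) s = smult (poly s w) (r - smult v s)"
    using sw by (simp add: vv smult_diff_right)
  have nz: "smult (poly s w) r - smult (poly r w) s \<noteq> 0"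
    by (rule comb_nonzero[OF rs(1)]) (use rs(4) G(2) coprime_poly_nz[OF rs(1)] in auto)
  have nz': "r - smult v s \<noteq> 0" using nz rvs by auto
  have "finite_local_degree (F \<circ> G) w = order w (smult (poly Q w) P - smult (poly P w) Q)"
    unfolding pq(3) rs(3) comp(4) by (rule finite_local_degree_rat_map[OF comp(1,2)])
  also have "\<dots> = order w ((r - smult v s) ^ a * homog_comp (d - a) h r s)"
    unfolding eq by (rule order_smult_complex) (use sw in simp)
  also have "\<dots> = a * order w (r - smult v s)"
    using o0(2) nz' order_mult[of "(r - smult v s) ^ a" "homog_comp (d - a) h r s" w]
    unfolding o0(1) order_pow[OF nz'] by simp
  also have "order w (r - smult v s) = finite_local_degree G w"
    unfolding rs(3) finite_local_degree_rat_map[OF rs(1,2)] rvs by (rule order_smult_complex[symmetric]) (use sw in simp)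
  also have "a = finite_local_degree F v"
    unfolding pq(3) finite_local_degree_rat_map[OF pq(1,2)] a_def g_def ..
  finally show ?thesis .
qed

text \<open>Exchanging numerator and denominator only changes the sign of the polynomial whose order
  is taken.\<close>

lemma finite_local_degree_flip_comp:
  assumes G: "rational_deg e G" "e > 0" and v: "G (Fin w) = Infty"
  shows "finite_local_degree (flip \<circ> G) w = finite_local_degree G w"
proof -
  from G(1) obtain r s where rs: "coprime r s" "s \<noteq> 0" "G = rat_map r s" "max (degree r) (degree s) = e"
    by (rule rational_degE)
  have sw: "poly s w = 0" using v by (auto simp: rs(3) rat_map_def split: if_splits)
  then have "r \<noteq> 0" using coprime_poly_nz[OF rs(1), of w] by auto
  have "flip \<circ> G = rat_map s r"
  proof
    fix x
    show "(flip \<circ> G) x = rat_map s r x"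
    proof (cases x)
      case (Fin z)
      then show ?thesis using coprime_poly_nz[OF rs(1), of z]
        by (cases "poly s z = 0"; cases "poly r z = 0") (auto simp: rs(3) rat_map_def)
    next
      case Infty
      have "coeff r e \<noteq> 0 \<or> coeff s e \<noteq> 0" using coprime_coeff_nz[OF rs(1,2)] rs(4) by auto
      then show ?thesis using Infty rs(4)
        by (cases "coeff s e = 0"; cases "coeff r e = 0") (auto simp: rs(3) rat_map_def Let_def max.commute)
    qed
  qed
  then have "finite_local_degree (flip \<circ> G) w = order w (smult (poly r w) s - smult (poly s w) r)"
    using finite_local_degree_rat_map[of s r w] rs(1) \<open>r \<noteq> 0\<close> by (simp add: coprime_commute)
  also have "\<dots> = order w (smult (-1) (smult (poly s w) r - smult (poly r w) s))" by simp
  also have "\<dots> = finite_local_degree G w" unfolding rs(3) finite_local_degree_rat_map[OF rs(1,2)] by (subst order_smult_complex) auto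
  finally show ?thesis .
qed

lemma finite_local_degree_comp:
  assumes F: "rational_deg d F" "d > 0" and G: "rational_deg e G" "e > 0"
  shows "finite_local_degree (F \<circ> G) w = local_degree F (G (Fin w)) * finite_local_degree G w"
proof (cases "G (Fin w)")
  case (Fin v)
  then show ?thesis using finite_local_degree_comp_Fin[OF F G Fin] by (simp add: local_degree_def)
next
  case Infty
  have "rational_deg d (F \<circ> flip)" "rational_deg e (flip \<circ> G)"
    using rational_deg_comp[OF F(1) flip_rational_deg F(2)] rational_deg_comp[OF flip_rational_deg G(1) _ G(2)] by auto
  moreover have "F \<circ> G = (F \<circ> flip) \<circ> (flip \<circ> G)" by (metis comp_assoc comp_id flip_flip)
  moreover have "(flip \<circ> G) (Fin w) = Fin 0" by (simp add: Infty)
  ultimately have "finite_local_degree (F \<circ> G) w = finite_local_degree (F \<circ> flip) 0 * finite_local_degree (flip \<circ> G) w"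
    using finite_local_degree_comp_Fin F(2) G(2) by metis
  then show ?thesis using finite_local_degree_flip_comp[OF G Infty] Infty by (simp add: local_degree_def)
qed

lemma local_degree_comp:
  assumes F: "rational_deg d F" "d > 0" and G: "rational_deg e G" "e > 0"
  shows "local_degree (F \<circ> G) z = local_degree F (G z) * local_degree G z"
proof (cases z)
  case (Fin w)
  then show ?thesis using finite_local_degree_comp[OF F G] by (simp add: local_degree_def)
next
  case Infty
  have "rational_deg e (G \<circ> flip)"
    using rational_deg_comp[OF G(1) flip_rational_deg G(2)] by auto
  from finite_local_degree_comp[OF F this G(2), of 0]
  show ?thesis by (simp add: local_degree_def Infty comp_assoc[symmetric])
qed

lemma finite_local_degree_bounds:
  assumes F: "rational_deg d F" "d > 0"
  shows "1 \<le> finite_local_degree F w" "finite_local_degree F w \<le> d"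
proof -
  from F(1) obtain p q where pq: "coprime p q" "q \<noteq> 0" "F = rat_map p q" "max (degree p) (degree q) = d"
    by (rule rational_degE)
  define f where "f = smult (poly q w) p - smult (poly p w) q"
  have l: "finite_local_degree F w = order w f" unfolding pq(3) finite_local_degree_rat_map[OF pq(1,2)] f_def ..
  have "f \<noteq> 0" unfolding f_def
    by (rule comb_nonzero[OF pq(1)]) (use pq(4) F(2) coprime_poly_nz[OF pq(1)] in auto)
  moreover have "poly f w = 0" by (simp add: f_def)
  ultimately show "1 \<le> finite_local_degree F w" unfolding l using order_root[of f w] by simp
  have "degree f \<le> d" unfolding f_def using pq(4)
    by (intro degree_diff_le order_trans[OF degree_smult_le]) auto
  then show "finite_local_degree F w \<le> d" unfolding l using order_degree[OF \<open>f \<noteq> 0\<close>, of w] by simp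
qed

lemma local_degree_bounds:
  assumes F: "rational_deg d F" "d > 0"
  shows "1 \<le> local_degree F z" "local_degree F z \<le> d"
proof -
  have "rational_deg d (F \<circ> flip)" using rational_deg_comp[OF F(1) flip_rational_deg F(2)] by auto
  then show "1 \<le> local_degree F z" "local_degree F z \<le> d"
    using finite_local_degree_bounds F by (auto simp: local_degree_def split: riemann_sphere.split)
qed

lemma local_degree_moebius: "moebius \<sigma> \<Longrightarrow> local_degree \<sigma> z = 1"
  using local_degree_bounds[of 1 \<sigma> z] by (simp add: moebius_rational_deg)

text \<open>This is the numerator of the derivative of \<open>p / q\<close>. If it vanished,
  coprimality would make \<open>q\<close> divide its own derivative, so that both derivatives vanish
  and \<open>p / q\<close> is constant.\<close>

lemma wronskian_nonzero:
  fixes p q :: "complex poly"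
  assumes "coprime p q" "max (degree p) (degree q) > 0" "q \<noteq> 0"
  shows "pderiv p * q - p * pderiv q \<noteq> 0"
proof
  assume "pderiv p * q - p * pderiv q = 0"
  then have eq: "p * pderiv q = pderiv p * q" by simp
  then have "q dvd p * pderiv q" by simp
  then have "q dvd pderiv q" using assms(1) by (simp add: coprime_dvd_mult_right_iff coprime_commute)
  have "pderiv q = 0"
  proof (rule ccontr)
    assume n: "pderiv q \<noteq> 0"
    then have "degree q \<le> degree (pderiv q)" using \<open>q dvd pderiv q\<close> by (rule dvd_imp_degree_le[rotated])
    then have "degree q = 0" by (simp add: degree_pderiv)
    then show False using n by (simp add: pderiv_eq_0_iff)
  qed
  moreover have "pderiv p = 0" using eq calculation assms(3) by simp
  ultimately show False using assms(2) by (simp add: pderiv_eq_0_iff)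
qed

lemma finite_local_degree_ge_2:
  assumes pq: "coprime p q" "q \<noteq> 0" and "finite_local_degree (rat_map p q) w \<ge> 2"
  shows "poly (pderiv p * q - p * pderiv q) w = 0"
proof -
  define f where "f = smult (poly q w) p - smult (poly p w) q"
  have "[:-w, 1:] ^ 2 dvd f"
    using assms(3) unfolding finite_local_degree_rat_map[OF pq] f_def by (rule dvd_trans[OF le_imp_power_dvd order_1])
  then obtain k where "f = [:-w, 1:] ^ 2 * k" by (rule dvdE)
  then have k: "f = [:-w, 1:] * ([:-w, 1:] * k)" by (simp only: power2_eq_square mult.assoc)
  have "poly (pderiv f) w = 0"
    unfolding k pderiv_mult poly_add poly_mult by simp
  then show ?thesis by (simp add: f_def pderiv_diff pderiv_smult algebra_simps)
qed

text \<open>Finite critical points are roots of the Wronskian, of degree at most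
  \<open>2 * d - 1\<close>; \<open>Infty\<close> is counted in any case. Riemann-Hurwitz would give
  \<open>2 * d - 2\<close>, but any bound in terms of \<open>d\<close> serves.\<close>

lemma card_critical:
  assumes F: "rational_deg d F" "d > 0"
  shows "finite {z. local_degree F z \<ge> 2}" "card {z. local_degree F z \<ge> 2} \<le> 2 * d"
proof -
  from F(1) obtain p q where pq: "coprime p q" "q \<noteq> 0" "F = rat_map p q" "max (degree p) (degree q) = d"
    by (rule rational_degE)
  define W where "W = pderiv p * q - p * pderiv q"
  have W: "W \<noteq> 0" unfolding W_def by (rule wronskian_nonzero) (use pq F(2) in auto)
  have fin: "finite {z. poly W z = 0}" using W by (rule poly_roots_finite)
  have "degree W \<le> 2 * d - 1" unfolding W_def
  proof (rule degree_diff_le)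
    show "degree (pderiv p * q) \<le> 2 * d - 1"
      using degree_mult_le[of "pderiv p" q] pq(4) F(2) by (simp add: degree_pderiv)
    show "degree (p * pderiv q) \<le> 2 * d - 1"
      using degree_mult_le[of p "pderiv q"] pq(4) F(2) by (simp add: degree_pderiv)
  qed
  then have "card {z. poly W z = 0} \<le> 2 * d - 1"
    using card_poly_roots_bound[OF W] by linarith
  moreover have "card (Fin ` {z. poly W z = 0}) \<le> card {z. poly W z = 0}"
    by (rule card_image_le[OF fin])
  moreover have "card (insert Infty (Fin ` {z. poly W z = 0})) \<le> Suc (card (Fin ` {z. poly W z = 0}))"
    by (rule card_insert_le_m1) auto
  ultimately have c: "card (insert Infty (Fin ` {z. poly W z = 0})) \<le> 2 * d" using F(2) by linarith
  have sub: "{z. local_degree F z \<ge> 2} \<subseteq> insert Infty (Fin ` {z. poly W z = 0})"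
  proof
    fix z assume "z \<in> {z. local_degree F z \<ge> 2}"
    then show "z \<in> insert Infty (Fin ` {z. poly W z = 0})"
      using finite_local_degree_ge_2[OF pq(1,2)] by (cases z) (auto simp: local_degree_def pq(3) W_def)
  qed
  then show "finite {z. local_degree F z \<ge> 2}" using fin finite_subset by blast
  show "card {z. local_degree F z \<ge> 2} \<le> 2 * d"
    using card_mono[OF _ sub] c fin by simp
qed

section \<open>Symmetry groups and exceptional pairs\<close>

text \<open>Iterating the translation would put infinitely many points into one fibre. This is what
  excludes parabolic symmetries.\<close>

lemma no_translation:
  assumes G: "rational_deg d G" "d > 0" and eq: "\<And>v. G (Fin (v + \<delta>)) = G (Fin v)"
  shows "\<delta> = 0"
proof (rule ccontr)
  assume d: "\<delta> \<noteq> 0"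
  have *: "G (Fin (of_nat k * \<delta>)) = G (Fin 0)" for k
  proof (induction k)
    case (Suc k)
    then show ?case using eq[of "of_nat k * \<delta>"] by (simp add: algebra_simps)
  qed simp
  have "inj (\<lambda>k. Fin (of_nat k * \<delta>))" using d by (auto simp: inj_def)
  then have "infinite (range (\<lambda>k. Fin (of_nat k * \<delta>)))" using finite_imageD by blast
  moreover have "range (\<lambda>k. Fin (of_nat k * \<delta>)) \<subseteq> {x. G x = G (Fin 0)}" using * by auto
  ultimately show False using rational_deg_fibre_finite_card(1)[OF G] finite_subset by blast
qed

lemma Sigma_group_moebius: "\<sigma> \<in> Sigma_group F \<Longrightarrow> moebius \<sigma>"
  by (simp add: Sigma_group_def)

lemma Sigma_group_apply: "\<sigma> \<in> Sigma_group F \<Longrightarrow> F (\<sigma> z) = F z"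
  by (simp add: Sigma_group_def fun_eq_iff)

lemma id_Sigma_group: "id \<in> Sigma_group F"
  by (simp add: Sigma_group_def moebius_id)

lemma comp_Sigma_group: "\<sigma> \<in> Sigma_group F \<Longrightarrow> \<tau> \<in> Sigma_group F \<Longrightarrow> \<sigma> \<circ> \<tau> \<in> Sigma_group F"
  by (simp add: Sigma_group_def moebius_comp comp_assoc[symmetric])

lemma inverse_Sigma_group:
  assumes "\<sigma> \<in> Sigma_group F"
  shows "\<exists>\<tau>\<in>Sigma_group F. \<tau> \<circ> \<sigma> = id \<and> \<sigma> \<circ> \<tau> = id"
proof -
  obtain \<tau> where t: "moebius \<tau>" "\<tau> \<circ> \<sigma> = id" "\<sigma> \<circ> \<tau> = id"
    using moebius_inverse[OF Sigma_group_moebius[OF assms]] by metis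
  have "F \<circ> \<tau> = F \<circ> \<sigma> \<circ> \<tau>" using assms by (simp add: Sigma_group_def)
  also have "\<dots> = F" by (simp add: comp_assoc t)
  finally show ?thesis using t by (auto simp: Sigma_group_def)
qed

text \<open>Evaluation at three points of \<open>T\<close> embeds \<Gamma> into a product of three
  sets \<open>X x\<close>. These sets are fibres when only finiteness is wanted, and one invariant
  set when the bound has to be uniform.\<close>

lemma card_moebius_le:
  assumes fin: "finite T" and three: "card T \<ge> 3"
    and G: "\<And>\<sigma>. \<sigma> \<in> \<Gamma> \<Longrightarrow> moebius \<sigma>" and fibre: "\<And>x. x \<in> T \<Longrightarrow> finite (X x) \<and> card (X x) \<le> B"
    and maps: "\<And>\<sigma> x. \<sigma> \<in> \<Gamma> \<Longrightarrow> x \<in> T \<Longrightarrow> \<sigma> x \<in> X x"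
  shows "finite \<Gamma>" "card \<Gamma> \<le> B ^ 3"
proof -
  obtain T' where T': "T' \<subseteq> T" "card T' = 3" using three by (metis obtain_subset_with_card_n)
  then obtain a b c where abc: "T' = {a, b, c}" "a \<noteq> b" "b \<noteq> c" "a \<noteq> c" by (auto simp: card_3_iff)
  let ?f = "\<lambda>\<sigma>. (\<sigma> a, \<sigma> b, \<sigma> c)"
  have inj: "inj_on ?f \<Gamma>"
    using moebius_eq[OF G G abc(2-4)] by (auto simp: inj_on_def)
  have sub: "?f ` \<Gamma> \<subseteq> X a \<times> X b \<times> X c" using maps T' abc(1) by auto
  have fin': "finite (X a \<times> X b \<times> X c)" using fibre T' abc(1) by auto
  show "finite \<Gamma>" using inj sub fin' by (meson finite_imageD finite_subset)
  have "card \<Gamma> \<le> card (X a \<times> X b \<times> X c)"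
    using card_mono[OF fin' sub] card_image[OF inj] by simp
  also have "\<dots> \<le> B * (B * B)"
    unfolding card_cartesian_product using fibre T' abc(1) by (intro mult_le_mono) auto
  finally show "card \<Gamma> \<le> B ^ 3" by (simp add: power3_eq_cube)
qed

lemma finite_Sigma_group:
  assumes F: "rational_deg d F" "d > 0"
  shows "finite (Sigma_group F)"
proof -
  obtain T :: "riemann_sphere set" where T: "finite T" "card T = 3"
    using infinite_arbitrarily_large[OF infinite_riemann_sphere, of 3] by (elim exE conjE)
  show ?thesis
  proof (rule card_moebius_le(1)[OF T(1)])
    show "card T \<ge> 3" using T(2) by simp
    show "moebius \<sigma>" if "\<sigma> \<in> Sigma_group F" for \<sigma>
      using that by (rule Sigma_group_moebius)
    show "finite {z. F z = F x} \<and> card {z. F z = F x} \<le> d" for x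
      using rational_deg_fibre_finite_card[OF F] by simp
    show "\<sigma> x \<in> {z. F z = F x}" if "\<sigma> \<in> Sigma_group F" for \<sigma> x
      using Sigma_group_apply[OF that] by simp
  qed
qed

lemma proj_point_scale: "k \<noteq> 0 \<Longrightarrow> proj_point (k * x) (k * y) = proj_point x y"
  by (simp add: proj_point_def)

text \<open>A symmetry that fixes 0 has the form \<open>\<alpha> z / (1 + \<gamma> z)\<close>. Its
  multiplier \<alpha> determines it, since two with the same multiplier differ by a parabolic map;
  and comparing lowest terms in \<open>F \<circ> \<sigma> = F\<close> makes \<alpha> a root of unity
  of order dividing the local degree.\<close>

lemma card_stabilizer_0:
  assumes F: "rational_deg d F" "d > 0" and F0: "F (Fin 0) = Fin 0"
  shows "card {\<sigma> \<in> Sigma_group F. \<sigma> (Fin 0) = Fin 0} \<le> local_degree F (Fin 0)"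
proof -
  define e where "e = local_degree F (Fin 0)"
  define S where "S = {\<sigma> \<in> Sigma_group F. \<sigma> (Fin 0) = Fin 0}"
  define nf where "nf = (\<lambda>\<alpha> \<gamma>. rat_map [:0, \<alpha>:] [:1, \<gamma>:])"
  have e: "e > 0" using local_degree_bounds(1)[OF F, of "Fin 0"] by (simp add: e_def)
  have ex: "\<exists>\<alpha>. \<exists>\<gamma>. \<alpha> \<noteq> 0 \<and> \<sigma> = nf \<alpha> \<gamma>" if "\<sigma> \<in> S" for \<sigma>
  proof -
    from that obtain a b c d where abcd: "a * d - b * c \<noteq> 0" "\<sigma> = rat_map [:b, a:] [:d, c:]"
      by (auto simp: S_def Sigma_group_def moebius_def)
    have "\<sigma> (Fin 0) = Fin 0" using that by (simp add: S_def)
    then have "d \<noteq> 0" "b = 0" by (auto simp: abcd(2) rat_map_def split: if_splits)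
    then have "a \<noteq> 0" using abcd(1) by auto
    have eq: "\<sigma> = nf (a / d) (c / d)"
    proof
      fix z
      obtain x y where z: "z = proj_point x y" "x \<noteq> 0 \<or> y \<noteq> 0" by (rule proj_point_cases)
      have "\<sigma> z = proj_point (a * x + b * y) (c * x + d * y)"
        unfolding abcd(2) z(1) by (rule moebius_proj_point[OF abcd(1) z(2)])
      moreover have "nf (a / d) (c / d) z = proj_point (a / d * x + 0 * y) (c / d * x + 1 * y)"
        unfolding nf_def z(1) by (rule moebius_proj_point) (use \<open>a \<noteq> 0\<close> \<open>d \<noteq> 0\<close> z(2) in auto)
      moreover have "proj_point (a * x + b * y) (c * x + d * y) =
          proj_point (d * (a / d * x + 0 * y)) (d * (c / d * x + 1 * y))"
        using \<open>d \<noteq> 0\<close> \<open>b = 0\<close> by (simp add: distrib_left)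
      ultimately show "\<sigma> z = nf (a / d) (c / d) z"
        by (simp only: proj_point_scale[OF \<open>d \<noteq> 0\<close>])
    qed
    show ?thesis
      by (rule exI[of _ "a / d"], rule exI[of _ "c / d"]) (use eq \<open>a \<noteq> 0\<close> \<open>d \<noteq> 0\<close> in simp)
  qed
  then obtain \<alpha> where "\<forall>\<sigma>\<in>S. \<exists>\<gamma>. \<alpha> \<sigma> \<noteq> 0 \<and> \<sigma> = nf (\<alpha> \<sigma>) \<gamma>" by metis
  then obtain \<gamma> where nf: "\<And>\<sigma>. \<sigma> \<in> S \<Longrightarrow> \<alpha> \<sigma> \<noteq> 0" "\<And>\<sigma>. \<sigma> \<in> S \<Longrightarrow> \<sigma> = nf (\<alpha> \<sigma>) (\<gamma> \<sigma>)" by metis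
  have inj: "inj_on \<alpha> S"
  proof (rule inj_onI)
    fix \<sigma> \<tau> assume st: "\<sigma> \<in> S" "\<tau> \<in> S" "\<alpha> \<sigma> = \<alpha> \<tau>"
    let ?a = "\<alpha> \<sigma>" and ?\<delta> = "(\<gamma> \<tau> - \<gamma> \<sigma>) / \<alpha> \<sigma>"
    have a: "?a \<noteq> 0" using nf st by auto
    have G: "rational_deg d (F \<circ> flip)" using rational_deg_comp[OF F(1) flip_rational_deg F(2)] by simp
    have fl: "flip (Fin v) = proj_point 1 v" for v
      by (cases "v = 0") (auto simp: proj_point_def inverse_eq_divide)
    have "?\<delta> = 0"
    proof (rule no_translation[OF G F(2)])
      fix v
      \<comment> \<open>In the coordinate \<open>1 / z\<close> the two maps are
        \<open>(w + \<gamma>) / \<alpha>\<close> with the same \<alpha>. The point \<open>?z\<close>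
        is the preimage of \<open>1 / v\<close> under \<sigma>, and \<tau> sends it to
        \<open>1 / (v + ?\<delta>)\<close>.\<close>
      let ?z = "proj_point (1 / ?a) (v - \<gamma> \<sigma> / ?a)"
      have nz: "1 / ?a \<noteq> 0 \<or> v - \<gamma> \<sigma> / ?a \<noteq> 0" using a by simp
      have "nf ?a (\<gamma> \<sigma>) ?z = proj_point (?a * (1 / ?a) + 0 * (v - \<gamma> \<sigma> / ?a)) (\<gamma> \<sigma> * (1 / ?a) + 1 * (v - \<gamma> \<sigma> / ?a))"
        unfolding nf_def by (rule moebius_proj_point[OF _ nz]) (use a in auto)
      also have "\<dots> = flip (Fin v)" using a by (simp add: fl)
      finally have 1: "\<sigma> ?z = flip (Fin v)" using nf(2)[OF st(1)] by simp
      have "nf ?a (\<gamma> \<tau>) ?z = proj_point (?a * (1 / ?a) + 0 * (v - \<gamma> \<sigma> / ?a)) (\<gamma> \<tau> * (1 / ?a) + 1 * (v - \<gamma> \<sigma> / ?a))"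
        unfolding nf_def by (rule moebius_proj_point[OF _ nz]) (use a in auto)
      also have "\<dots> = flip (Fin (v + ?\<delta>))" using a by (simp add: fl field_simps)
      finally have 2: "\<tau> ?z = flip (Fin (v + ?\<delta>))" using nf(2)[OF st(2)] st(3) by simp
      have "F (\<tau> ?z) = F (\<sigma> ?z)"
        using st(1,2) Sigma_group_apply[of \<sigma> F] Sigma_group_apply[of \<tau> F] by (simp add: S_def)
      then show "(F \<circ> flip) (Fin (v + ?\<delta>)) = (F \<circ> flip) (Fin v)" by (simp only: 1 2 o_apply)
    qed
    then have "\<gamma> \<tau> = \<gamma> \<sigma>" using a by simp
    then show "\<sigma> = \<tau>" using nf(2)[OF st(1)] nf(2)[OF st(2)] st(3) by simp
  qed
  have root: "\<alpha> \<sigma> ^ e = 1" if "\<sigma> \<in> S" for \<sigma>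
  proof -
    from F(1) obtain p q where pq: "coprime p q" "q \<noteq> 0" "F = rat_map p q" "max (degree p) (degree q) = d"
      by (rule rational_degE)
    have p0: "poly p 0 = 0" "poly q 0 \<noteq> 0" using F0 by (auto simp: pq(3) rat_map_def split: if_splits)
    have pnz: "p \<noteq> 0" using comb_nonzero[OF pq(1), of 0 1] pq(4) F(2) by simp
    have "e = order 0 (smult (poly q 0) p - smult (poly p 0) q)"
      by (simp add: e_def local_degree_def pq(3) finite_local_degree_rat_map[OF pq(1,2)])
    then have oe: "e = order 0 p" using p0 by (simp add: order_smult_complex)
    obtain h where h: "p = [:-0, 1:] ^ e * h" "\<not> [:-0, 1:] dvd h"
      using order_decomp[OF pnz, of 0] unfolding oe by blast
    have h0: "poly h 0 \<noteq> 0" using h(2) poly_eq_0_iff_dvd[of h 0] by simp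
    have "degree p = e + degree h"
      using h(1) pnz by (simp add: degree_mult_eq degree_power_eq)
    then have dh: "degree h \<le> d - e" "e \<le> d" using pq(4) by auto
    define a g where "a = \<alpha> \<sigma>" and "g = \<gamma> \<sigma>"
    let ?r = "[:0, a:]" and ?s = "[:1, g:]"
    have s: "\<sigma> = rat_map ?r ?s" using nf(2)[OF that] by (simp only: nf_def a_def g_def)
    have anz: "a \<noteq> 0" using nf(1)[OF that] by (simp add: a_def)
    have cop: "coprime ?r ?s"
    proof (rule coprimeI_poly)
      fix z show "poly ?r z \<noteq> 0 \<or> poly ?s z \<noteq> 0" using anz by (cases "z = 0") auto
    qed
    have deg: "max (degree ?r) (degree ?s) = 1" using anz by auto
    have snz: "?s \<noteq> 0" by simp
    define P Q where "P = homog_comp d p ?r ?s" and "Q = homog_comp d q ?r ?s"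
    note comp = rat_map_comp[OF pq(1,2,4) F(2) cop snz deg zero_less_one, folded P_def Q_def]
    have "F \<circ> \<sigma> = F" using that by (simp add: S_def Sigma_group_def)
    then have "rat_map P Q = rat_map p q"
      using comp(4) unfolding pq(3) s by simp
    then have eq: "P * q = p * Q" using rat_map_eq_imp_cross_eq comp(2) pq(2) by blast
    have "P = homog_comp (e + (d - e)) ([:-0, 1:] ^ e * h) ?r ?s"
      unfolding P_def using h(1) dh(2) by simp
    also have "\<dots> = homog_comp e ([:-0, 1:] ^ e) ?r ?s * homog_comp (d - e) h ?r ?s"
      by (rule homog_comp_mult) (use dh degree_power_le[of "[:0, 1::complex:]" e] in auto)
    also have "homog_comp e ([:-0, 1:] ^ e) ?r ?s = (?r - smult 0 ?s) ^ e"
      by (rule homog_comp_linear_power) simp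
    also have "?r - smult 0 ?s = smult a [:-0, 1:]" by simp
    finally have P: "P = smult a [:-0, 1:] ^ e * homog_comp (d - e) h ?r ?s" .
    have "P = [:-0, 1:] ^ e * (smult (a ^ e) (homog_comp (d - e) h ?r ?s))"
      unfolding P smult_power by (simp only: mult_smult_left mult_smult_right)
    with eq have "[:-0, 1:] ^ e * (smult (a ^ e) (homog_comp (d - e) h ?r ?s) * q) = [:-0, 1:] ^ e * (h * Q)"
      using h(1) by (simp add: mult.assoc)
    then have "smult (a ^ e) (homog_comp (d - e) h ?r ?s) * q = h * Q"
      by (simp only: mult_cancel_left) simp
    \<comment> \<open>With \<open>z ^ e\<close> cancelled, the values at 0 are
      \<open>a ^ e * h(0) * q(0)\<close> and \<open>h(0) * q(0)\<close>.\<close>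
    then have "poly (smult (a ^ e) (homog_comp (d - e) h ?r ?s) * q) 0 = poly (h * Q) 0" by simp
    moreover have "poly (homog_comp (d - e) h ?r ?s) 0 = poly h 0"
      using homog_comp_nz_poly[OF dh(1), of ?s 0 ?r] by simp
    moreover have "poly Q 0 = poly q 0"
      unfolding Q_def using homog_comp_nz_poly[of q d ?s 0 ?r] pq(4) by simp
    ultimately have "a ^ e = 1" using h0 p0(2) by simp
    then show ?thesis by (simp only: a_def)
  qed
  have fin: "finite {z::complex. z ^ e = 1}" using e by (rule finite_nth_roots)
  have "card S = card (\<alpha> ` S)" using card_image[OF inj] by simp
  also have "\<dots> \<le> card {z::complex. z ^ e = 1}" using root by (intro card_mono fin) auto
  also have "\<dots> = e" using e by (rule card_roots_unity_eq)
  finally show ?thesis by (simp add: S_def e_def)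
qed

lemma moebius_to_0: obtains \<mu> where "moebius \<mu>" "\<mu> z = Fin 0"
proof -
  obtain \<mu> where "moebius \<mu>" "\<mu> z = Infty" by (rule moebius_to_Infty)
  then show ?thesis using that[of "flip \<circ> \<mu>"] moebius_comp[of flip \<mu>] flip_rational_deg by (simp add: moebius_rational_deg)
qed

lemma rational_deg_moebius_comp:
  assumes "rational_deg d F" "d > 0" "moebius \<mu>"
  shows "rational_deg d (\<mu> \<circ> F)" "rational_deg d (F \<circ> \<mu>)"
  using rational_deg_comp[of 1 \<mu> d F] rational_deg_comp[of d F 1 \<mu>] assms by (simp_all add: moebius_rational_deg)

text \<open>Source and target are normalised by different Moebius maps, since \<open>F\<close> need
  not fix \<open>z\<close>. Only \<mu> conjugates the symmetries; composing with \<nu> on the left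
  does not affect them.\<close>

lemma card_stabilizer:
  assumes F: "rational_deg d F" "d > 0"
  shows "card {\<sigma> \<in> Sigma_group F. \<sigma> z = z} \<le> local_degree F z"
proof -
  obtain \<mu> where mu: "moebius \<mu>" "\<mu> z = Fin 0" by (rule moebius_to_0)
  obtain \<nu> where nu: "moebius \<nu>" "\<nu> (F z) = Fin 0" by (rule moebius_to_0)
  obtain \<mu>' where mu': "moebius \<mu>'" "\<mu>' \<circ> \<mu> = id" "\<mu> \<circ> \<mu>' = id" using moebius_inverse[OF mu(1)] by metis
  have mz: "\<mu>' (Fin 0) = z" using fun_cong[OF mu'(2), of z] mu(2) by simp
  define F' where "F' = \<nu> \<circ> (F \<circ> \<mu>')"
  have Fm: "rational_deg d (F \<circ> \<mu>')" by (rule rational_deg_moebius_comp(2)[OF F mu'(1)])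
  then have F': "rational_deg d F'" unfolding F'_def by (rule rational_deg_moebius_comp(1)[OF _ F(2) nu(1)])
  have F0: "F' (Fin 0) = Fin 0" by (simp add: F'_def mz nu)
  have r1: "rational_deg 1 \<nu>" "rational_deg 1 \<mu>'" using nu(1) mu'(1) by (simp_all only: moebius_rational_deg)
  have "local_degree F' (Fin 0) = local_degree F z"
    using local_degree_comp[OF r1(1) _ Fm F(2), of "Fin 0"] local_degree_comp[OF F r1(2), of "Fin 0"]
    by (simp add: F'_def local_degree_moebius nu(1) mu'(1) mz)
  let ?S = "{\<sigma> \<in> Sigma_group F. \<sigma> z = z}" and ?S' = "{\<sigma> \<in> Sigma_group F'. \<sigma> (Fin 0) = Fin 0}"
  let ?f = "\<lambda>\<sigma>. \<mu> \<circ> \<sigma> \<circ> \<mu>'"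
  have "inj_on ?f ?S"
  proof (rule inj_onI)
    fix \<sigma> \<tau> assume "?f \<sigma> = ?f \<tau>"
    then have "\<mu>' \<circ> ?f \<sigma> \<circ> \<mu> = \<mu>' \<circ> ?f \<tau> \<circ> \<mu>" by simp
    moreover have "\<mu>' \<circ> ?f \<rho> \<circ> \<mu> = \<rho>" for \<rho>
      using mu'(2) by (simp add: fun_eq_iff)
    ultimately show "\<sigma> = \<tau>" by simp
  qed
  moreover have "?f ` ?S \<subseteq> ?S'"
  proof
    fix \<tau> assume "\<tau> \<in> ?f ` ?S"
    then obtain \<sigma> where s: "\<tau> = ?f \<sigma>" "\<sigma> \<in> Sigma_group F" "\<sigma> z = z" by auto
    have "moebius \<tau>" unfolding s(1) using s(2) mu(1) mu'(1) by (intro moebius_comp) (auto intro: Sigma_group_moebius)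
    moreover have "F' \<circ> \<tau> = F'"
    proof
      fix x
      have "\<mu>' (\<mu> y) = y" for y using mu'(2) by (simp add: fun_eq_iff)
      then show "(F' \<circ> \<tau>) x = F' x" by (simp add: s(1) F'_def Sigma_group_apply[OF s(2)])
    qed
    moreover have "\<tau> (Fin 0) = Fin 0" by (simp add: s mz mu)
    ultimately show "\<tau> \<in> ?S'" by (simp add: Sigma_group_def)
  qed
  moreover have "finite ?S'" using finite_Sigma_group[OF F' F(2)] by simp
  ultimately have "card ?S \<le> card ?S'" by (rule card_inj_on_le)
  also have "\<dots> \<le> local_degree F' (Fin 0)" by (rule card_stabilizer_0[OF F' F(2) F0])
  finally show ?thesis by (simp add: \<open>local_degree F' (Fin 0) = local_degree F z\<close>)
qed

text \<open>A fixed point is moved to \<open>Infty\<close>, which makes the symmetry affine. Its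
  linear part is not 1, as it would then be a translation, so there is a second fixed point; a third
  would force the identity.\<close>

lemma Sigma_group_fixed_points:
  assumes F: "rational_deg d F" "d > 0" and s: "\<sigma> \<in> Sigma_group F" "\<sigma> \<noteq> id"
  shows "card {z. \<sigma> z = z} = 2"
proof -
  have m: "moebius \<sigma>" using s(1) by (rule Sigma_group_moebius)
  have ex: "\<exists>z. \<sigma> z = z"
  proof -
    from m obtain a b c d where abcd: "a * d - b * c \<noteq> 0" "\<sigma> = rat_map [:b, a:] [:d, c:]"
      by (auto simp: moebius_def)
    show ?thesis
    proof (cases "c = 0")
      case True
      then have "\<sigma> Infty = Infty" using abcd by (auto simp: rat_map_def)
      then show ?thesis by blast
    next
      case False
      \<comment> \<open>The finite fixed points are the roots of
        \<open>c z^2 + (d - a) z - b\<close>.\<close>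
      then have "degree [:-b, d - a, c:] > 0" by simp
      then obtain z where "poly [:-b, d - a, c:] z = 0"
        using fundamental_theorem_of_algebra[of "[:-b, d - a, c:]"] constant_degree[of "[:-b, d - a, c:]"] by auto
      then have z: "a * z + b * 1 = z * (c * z + d * 1)" by (simp add: algebra_simps)
      have "\<sigma> (proj_point z 1) = proj_point (a * z + b * 1) (c * z + d * 1)"
        unfolding abcd(2) by (rule moebius_proj_point[OF abcd(1)]) simp
      moreover have "c * z + d * 1 \<noteq> 0"
      proof
        assume 0: "c * z + d * 1 = 0"
        have "a * (c * z + d * 1) - c * (a * z + b * 1) = a * d - b * c" by (simp add: algebra_simps)
        then show False using abcd(1) z 0 by simp
      qed
      ultimately have "\<sigma> (proj_point z 1) = proj_point z 1" using z by (simp add: proj_point_def)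
      then show ?thesis by blast
    qed
  qed
  then obtain z where z: "\<sigma> z = z" by blast
  obtain \<mu> where mu: "moebius \<mu>" "\<mu> z = Infty" by (rule moebius_to_Infty)
  obtain \<mu>' where mu': "moebius \<mu>'" "\<mu>' \<circ> \<mu> = id" "\<mu> \<circ> \<mu>' = id" using moebius_inverse[OF mu(1)] by metis
  have mm: "\<mu>' (\<mu> y) = y" "\<mu> (\<mu>' y) = y" for y using mu'(2,3) by (simp_all add: fun_eq_iff)
  define \<tau> where "\<tau> = \<mu> \<circ> \<sigma> \<circ> \<mu>'"
  have mt: "moebius \<tau>" unfolding \<tau>_def by (intro moebius_comp m mu mu')
  have ti: "\<tau> Infty = Infty" using mm(1)[of z] by (simp add: \<tau>_def mu(2) z)
  obtain w where w: "\<sigma> w = w" "w \<noteq> z"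
  proof -
    from mt obtain a b c d' where abcd: "a * d' - b * c \<noteq> 0" "\<tau> = rat_map [:b, a:] [:d', c:]"
      by (auto simp: moebius_def)
    have "c = 0" using ti abcd by (auto simp: rat_map_def Let_def split: if_splits)
    then have nz: "a \<noteq> 0" "d' \<noteq> 0" using abcd(1) by auto
    have tv: "\<tau> (Fin v) = Fin ((a * v + b) / d')" for v
      using nz by (simp add: abcd(2) \<open>c = 0\<close> rat_map_def algebra_simps)
    have "a \<noteq> d'"
    proof
      assume ad: "a = d'"
      have G: "rational_deg d (F \<circ> \<mu>')" by (rule rational_deg_moebius_comp(2)[OF F mu'(1)])
      have "b / d' = 0"
      proof (rule no_translation[OF G F(2)])
        fix v
        have "(a * v + b) / d' = v + b / d'" using nz(2) unfolding ad by (simp add: add_divide_distrib)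
        then have "\<tau> (Fin v) = Fin (v + b / d')" by (simp only: tv)
        then have "(F \<circ> \<mu>') (Fin (v + b / d')) = F (\<mu>' (\<tau> (Fin v)))" by simp
        also have "\<dots> = F (\<sigma> (\<mu>' (Fin v)))" by (simp add: \<tau>_def mm)
        also have "\<dots> = (F \<circ> \<mu>') (Fin v)" by (simp add: Sigma_group_apply[OF s(1)])
        finally show "(F \<circ> \<mu>') (Fin (v + b / d')) = (F \<circ> \<mu>') (Fin v)" .
      qed
      then have "b = 0" using nz(2) by simp
      then have "\<tau> (Fin v) = Fin v" for v unfolding tv ad using nz(2) by simp
      then have "\<tau> x = x" for x using ti by (cases x) auto
      then have "\<sigma> x = x" for x using arg_cong[OF \<open>\<And>x. \<tau> x = x\<close>, of \<mu>' "\<mu> x"] by (simp add: \<tau>_def mm(1))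
      then show False using s(2) by (simp add: fun_eq_iff)
    qed
    define v where "v = b / (d' - a)"
    have "b = (d' - a) * v" using \<open>a \<noteq> d'\<close> by (simp add: v_def)
    then have "a * v + b = v * d'" by (simp add: algebra_simps)
    then have "(a * v + b) / d' = v" using nz(2) by simp
    then have "\<tau> (Fin v) = Fin v" by (simp only: tv)
    then have "\<mu>' (\<tau> (Fin v)) = \<mu>' (Fin v)" by simp
    then have "\<sigma> (\<mu>' (Fin v)) = \<mu>' (Fin v)" by (simp add: \<tau>_def mm(1))
    moreover have "\<mu>' (Fin v) \<noteq> z"
    proof
      assume "\<mu>' (Fin v) = z"
      then have "Fin v = Infty" using mu(2) mm(2)[of "Fin v"] by simp
      then show False by simp
    qed
    ultimately show ?thesis using that by blast
  qed
  have "{x. \<sigma> x = x} = {z, w}"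
  proof (rule antisym; rule subsetI)
    fix x assume x: "x \<in> {x. \<sigma> x = x}"
    show "x \<in> {z, w}"
    proof (rule ccontr)
      assume "x \<notin> {z, w}"
      then have "\<sigma> = id"
        by (intro moebius_eq[OF m moebius_id, of z w x]) (use z w x in auto)
      then show False using s(2) by simp
    qed
  qed (use z w in auto)
  then show ?thesis using w(2) by simp
qed

lemma complex_root_exists:
  fixes c :: complex
  assumes "m > 0" "c \<noteq> 0"
  obtains z where "z ^ m = c"
proof -
  have "card {z. z ^ m = c} \<noteq> 0" using card_nth_roots[OF assms(2,1)] assms(1) by simp
  then have "{z. z ^ m = c} \<noteq> {}" by (intro notI) simp
  then show ?thesis using that by blast
qed

lemma root_0_monom:
  fixes p :: "complex poly"
  assumes "p \<noteq> 0" "\<And>z. poly p z = 0 \<Longrightarrow> z = 0"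
  obtains c where "c \<noteq> 0" "p = monom c (degree p)"
proof -
  define k where "k = order 0 p"
  obtain h where h: "p = [:-0, 1:] ^ k * h" "\<not> [:-0, 1:] dvd h"
    using order_decomp[OF assms(1), of 0] unfolding k_def by blast
  have "poly h z \<noteq> 0" for z
  proof
    assume z: "poly h z = 0"
    then have "poly p z = 0" unfolding h(1) poly_mult by simp
    then have "z = 0" by (rule assms(2))
    then show False using z h(2) poly_eq_0_iff_dvd[of h 0] by simp
  qed
  then have "degree h = 0"
    using fundamental_theorem_of_algebra[of h] constant_degree[of h] by auto
  then obtain c where c: "h = [:c:]" by (metis degree_eq_zeroE)
  have "c \<noteq> 0" using assms(1) unfolding h(1) c by auto
  have "p = monom c k" unfolding h(1) c by (simp add: monom_altdef)
  moreover from this have "degree p = k" using \<open>c \<noteq> 0\<close> by (simp add: degree_monom_eq)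
  ultimately show ?thesis using that[OF \<open>c \<noteq> 0\<close>] by simp
qed

text \<open>With the pair at \<open>Infty\<close> and 0, all zeros and poles lie in the pair, so
  numerator and denominator are monomials, one of them constant by coprimality. A scaling then
  normalises the coefficient.\<close>

lemma exceptional_pair_conjugate:
  assumes A: "rational_deg n A" "n \<ge> 2" and ab: "a \<noteq> b" and inv: "\<And>z. A z \<in> {a, b} \<Longrightarrow> z \<in> {a, b}"
  shows "conjugate A (rat_map (monom 1 n) 1) \<or> conjugate A (rat_map 1 (monom 1 n))"
proof -
  obtain \<mu> where mu: "moebius \<mu>" "\<mu> a = Infty" "\<mu> b = Fin 0" by (rule moebius_to_Infty_0[OF ab])
  obtain \<mu>' where mu': "moebius \<mu>'" "\<mu>' \<circ> \<mu> = id" "\<mu> \<circ> \<mu>' = id" using moebius_inverse[OF mu(1)] by metis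
  have mm: "\<mu>' (\<mu> y) = y" "\<mu> (\<mu>' y) = y" for y using mu'(2,3) by (simp_all add: fun_eq_iff)
  define B where "B = \<mu> \<circ> (A \<circ> \<mu>')"
  have B: "rational_deg n B" unfolding B_def using A by (intro rational_deg_moebius_comp mu mu') auto
  have Binv: "x \<in> {Infty, Fin 0}" if "B x \<in> {Infty, Fin 0}" for x
  proof -
    have "\<mu>' Infty = a" "\<mu>' (Fin 0) = b" using mm(1)[of a] mm(1)[of b] mu(2,3) by simp_all
    moreover have "\<mu>' (B x) = A (\<mu>' x)" by (simp add: B_def mm(1))
    ultimately have "A (\<mu>' x) \<in> {a, b}" using that by auto
    then have "\<mu>' x \<in> {a, b}" by (rule inv)
    then have "\<mu> (\<mu>' x) \<in> {Infty, Fin 0}" using mu(2,3) by auto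
    then show ?thesis by (simp add: mm(2))
  qed
  have conj: "conjugate A G" if k: "\<kappa> \<noteq> 0" and G: "\<And>x. rat_map [:0, \<kappa>:] [:1, 0:] (B x) = G (rat_map [:0, \<kappa>:] [:1, 0:] x)" for G \<kappa>
  proof -
    let ?s = "rat_map [:0, \<kappa>:] [:1, 0:]"
    have "moebius ?s" unfolding moebius_def
      by (rule exI[of _ \<kappa>], rule exI[of _ 0], rule exI[of _ 0], rule exI[of _ 1]) (use k in simp)
    then have m: "moebius (?s \<circ> \<mu>)" using mu(1) by (rule moebius_comp)
    have "(?s \<circ> \<mu>) (A x) = G ((?s \<circ> \<mu>) x)" for x
      using G[of "\<mu> x"] by (simp add: B_def mm)
    then have "A x = (inv (?s \<circ> \<mu>) \<circ> G \<circ> (?s \<circ> \<mu>)) x" for x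
      using inv_f_f[OF bij_is_inj[OF moebius_bij[OF m]], of "A x"] by simp
    then show ?thesis unfolding conjugate_def using m by blast
  qed
  from B obtain p q where pq: "coprime p q" "q \<noteq> 0" "B = rat_map p q" "max (degree p) (degree q) = n"
    by (rule rational_degE)
  have pnz: "p \<noteq> 0" using comb_nonzero[OF pq(1), of 0 1] pq(4) A(2) by simp
  have "z = 0" if "poly p z = 0" for z
    using Binv[of "Fin z"] that coprime_poly_nz[OF pq(1), of z] by (auto simp: pq(3) rat_map_def)
  then obtain c where c: "c \<noteq> 0" "p = monom c (degree p)" using root_0_monom[OF pnz] by blast
  have "z = 0" if "poly q z = 0" for z
    using Binv[of "Fin z"] that by (auto simp: pq(3) rat_map_def)
  then obtain c' where c': "c' \<noteq> 0" "q = monom c' (degree q)" using root_0_monom[OF pq(2)] by blast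
  have pz: "poly p z = c * z ^ degree p" "poly q z = c' * z ^ degree q" for z
    by (subst c(2), simp add: poly_monom) (subst c'(2), simp add: poly_monom)
  have "degree p = 0 \<or> degree q = 0"
    using coprime_poly_nz[OF pq(1), of 0] by (auto simp: pz)
  then show ?thesis
  proof
    assume dq: "degree q = 0"
    then have dp: "degree p = n" using pq(4) by simp
    \<comment> \<open>Conjugation by \<open>\<kappa> z\<close> turns \<open>C z^n\<close> into
      \<open>C \<kappa>^(1 - n) z^n\<close>.\<close>
    obtain \<kappa> where \<kappa>: "\<kappa> ^ (n - 1) = c / c'"
      by (rule complex_root_exists[of "n - 1" "c / c'"]) (use A(2) c(1) c'(1) in auto)
    have k0: "\<kappa> \<noteq> 0" using \<kappa> c(1) c'(1) A(2) by (auto simp: power_0_left)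
    have "c / c' * \<kappa> = \<kappa> ^ n" using \<kappa> A(2) power_minus_mult[of n \<kappa>] by simp
    then have *: "\<kappa> * (c * z ^ n / c') = (\<kappa> * z) ^ n" for z
      unfolding power_mult_distrib by (metis (no_types, lifting) mult.assoc mult.commute times_divide_eq_right)
    have cq: "coeff q n = 0" "coeff p n \<noteq> 0"
      using dq A(2) leading_coeff_neq_0[OF pnz] unfolding dp by (simp_all add: coeff_eq_0)
    have "conjugate A (rat_map (monom 1 n) 1)"
    proof (rule conj[OF k0])
      fix x show "rat_map [:0, \<kappa>:] [:1, 0:] (B x) = rat_map (monom 1 n) 1 (rat_map [:0, \<kappa>:] [:1, 0:] x)"
      proof (cases x)
        case (Fin z)
        then show ?thesis using * c'(1) k0 by (simp add: pq(3) rat_map_def pz dq dp poly_monom mult.commute)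
      next
        case Infty
        then show ?thesis using cq k0 A(2) pq(4) by (simp add: pq(3) rat_map_def Let_def degree_monom_eq)
      qed
    qed
    then show ?thesis ..
  next
    assume dp: "degree p = 0"
    then have dq: "degree q = n" using pq(4) by simp
    \<comment> \<open>Conjugation by \<open>\<kappa> z\<close> turns \<open>C z^(-n)\<close> into
      \<open>C \<kappa>^(n + 1) z^(-n)\<close>.\<close>
    obtain \<kappa> where \<kappa>: "\<kappa> ^ (n + 1) = c' / c"
      by (rule complex_root_exists[of "n + 1" "c' / c"]) (use c(1) c'(1) in auto)
    have k0: "\<kappa> \<noteq> 0" using \<kappa> c(1) c'(1) by auto
    have *: "\<kappa> * (c / (c' * z ^ n)) = 1 / (\<kappa> * z) ^ n" if "z \<noteq> 0" for z
      using \<kappa> k0 that c(1) c'(1) by (simp add: power_mult_distrib field_simps)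
    have cq: "coeff q n \<noteq> 0" "coeff p n = 0"
      using dp A(2) leading_coeff_neq_0[OF pq(2)] unfolding dq by (simp_all add: coeff_eq_0)
    have "conjugate A (rat_map 1 (monom 1 n))"
    proof (rule conj[OF k0])
      fix x show "rat_map [:0, \<kappa>:] [:1, 0:] (B x) = rat_map 1 (monom 1 n) (rat_map [:0, \<kappa>:] [:1, 0:] x)"
      proof (cases x)
        case (Fin z)
        then show ?thesis using *[of z] c'(1) k0 A(2)
          by (cases "z = 0") (simp_all add: pq(3) rat_map_def pz dq dp poly_monom mult.commute)
      next
        case Infty
        then show ?thesis using cq k0 A(2) pq(4) by (simp add: pq(3) rat_map_def Let_def degree_monom_eq)
      qed
    qed
    then show ?thesis ..
  qed
qed

section \<open>Finite groups of maps\<close>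

text \<open>Each orbit contributes \<open>f x * card (orb x)\<close>. This is applied with the order
  of the stabilizer and with a constant as \<open>f\<close>.\<close>

lemma card_dvd_sum_invariant:
  fixes X :: "'a set" and orb :: "'a \<Rightarrow> 'a set" and f :: "'a \<Rightarrow> nat"
  assumes "finite X"
    and orb: "\<And>x. x \<in> X \<Longrightarrow> x \<in> orb x" "\<And>x. x \<in> X \<Longrightarrow> orb x \<subseteq> X"
      "\<And>x y. x \<in> X \<Longrightarrow> y \<in> orb x \<Longrightarrow> orb y = orb x"
    and f: "\<And>x y. x \<in> X \<Longrightarrow> y \<in> orb x \<Longrightarrow> f y = f x"
    and dvd: "\<And>x. x \<in> X \<Longrightarrow> N dvd f x * card (orb x)"
  shows "N dvd (\<Sum>x\<in>X. f x)"
proof -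
  have disj: "A \<inter> B = {}" if "A \<in> orb ` X" "B \<in> orb ` X" "A \<noteq> B" for A B
    using that orb(3) by blast
  have un: "\<Union>(orb ` X) = X" using orb(1,2) by blast
  have fin: "\<forall>A\<in>orb ` X. finite A" using orb(2) assms(1) finite_subset by blast
  have "(\<Sum>x\<in>X. f x) = (\<Sum>x\<in>\<Union>(orb ` X). f x)" unfolding un ..
  also have "\<dots> = (sum \<circ> sum) f (orb ` X)"
    by (rule sum.Union_disjoint[OF fin]) (use disj in blast)
  also have "\<dots> = (\<Sum>A\<in>orb ` X. \<Sum>x\<in>A. f x)" by simp
  also have "N dvd \<dots>"
  proof (rule dvd_sum)
    fix A assume "A \<in> orb ` X"
    then obtain x where x: "x \<in> X" "A = orb x" by blast
    have "(\<Sum>y\<in>A. f y) = (\<Sum>y\<in>A. f x)" using f[OF x(1)] x(2) by (intro sum.cong) auto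
    also have "\<dots> = f x * card (orb x)" using x(2) by (simp add: mult.commute)
    finally show "N dvd (\<Sum>y\<in>A. f y)" using dvd[OF x(1)] by simp
  qed
  finally show ?thesis .
qed

locale finite_map_group =
  fixes \<Gamma> :: "('a \<Rightarrow> 'a) set"
  assumes finite_group: "finite \<Gamma>"
    and id_mem: "id \<in> \<Gamma>"
    and comp_mem: "\<sigma> \<in> \<Gamma> \<Longrightarrow> \<tau> \<in> \<Gamma> \<Longrightarrow> \<sigma> \<circ> \<tau> \<in> \<Gamma>"
    and inverse_mem: "\<sigma> \<in> \<Gamma> \<Longrightarrow> \<exists>\<tau>\<in>\<Gamma>. \<tau> \<circ> \<sigma> = id \<and> \<sigma> \<circ> \<tau> = id"
begin

definition orb :: "'a \<Rightarrow> 'a set" where "orb x = (\<lambda>\<sigma>. \<sigma> x) ` \<Gamma>"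
definition stab :: "'a \<Rightarrow> ('a \<Rightarrow> 'a) set" where "stab x = {\<sigma> \<in> \<Gamma>. \<sigma> x = x}"

lemma orb_refl: "x \<in> orb x"
  unfolding orb_def using id_mem by (metis id_apply image_eqI)

lemma card_fibre: 
  assumes s: "\<sigma> \<in> \<Gamma>"
  shows "card {\<tau> \<in> \<Gamma>. \<tau> x = \<sigma> x} = card (stab x)"
proof -
  obtain \<sigma>' where s': "\<sigma>' \<in> \<Gamma>" "\<sigma>' \<circ> \<sigma> = id" "\<sigma> \<circ> \<sigma>' = id" using inverse_mem[OF s] by blast
  have 1: "\<sigma>' (\<sigma> y) = y" "\<sigma> (\<sigma>' y) = y" for y using s'(2,3) by (simp_all add: fun_eq_iff)
  have "bij_betw (\<lambda>\<rho>. \<sigma> \<circ> \<rho>) (stab x) {\<tau> \<in> \<Gamma>. \<tau> x = \<sigma> x}"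
    by (rule bij_betw_byWitness[where f' = "\<lambda>\<tau>. \<sigma>' \<circ> \<tau>"])
      (auto simp: stab_def comp_mem s s'(1) 1 fun_eq_iff)
  then show ?thesis by (rule bij_betw_same_card[symmetric])
qed

lemma orbit_stabilizer: "card \<Gamma> = card (orb x) * card (stab x)"
proof -
  have "card \<Gamma> = (\<Sum>y\<in>orb x. card {\<tau> \<in> \<Gamma>. \<tau> x = y})"
    unfolding orb_def card_eq_sum by (rule sum.image_gen[OF finite_group])
  also have "\<dots> = (\<Sum>y\<in>orb x. card (stab x))"
    by (rule sum.cong) (auto simp: orb_def card_fibre)
  finally show ?thesis by simp
qed

lemma orb_eq:
  assumes "y \<in> orb x"
  shows "orb y = orb x"
proof -
  have sub: "orb y \<subseteq> orb x" if y: "y \<in> orb x" for x y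
  proof
    fix z assume "z \<in> orb y"
    then obtain \<sigma> \<tau> where "\<sigma> \<in> \<Gamma>" "y = \<sigma> x" "\<tau> \<in> \<Gamma>" "z = \<tau> y" using y by (auto simp: orb_def)
    then have "z = (\<tau> \<circ> \<sigma>) x" "\<tau> \<circ> \<sigma> \<in> \<Gamma>" by (auto intro: comp_mem)
    then show "z \<in> orb x" unfolding orb_def by blast
  qed
  from assms obtain \<sigma> where s: "\<sigma> \<in> \<Gamma>" "y = \<sigma> x" by (auto simp: orb_def)
  obtain \<sigma>' where "\<sigma>' \<in> \<Gamma>" "\<sigma>' \<circ> \<sigma> = id" using inverse_mem[OF s(1)] by blast
  then have "x = \<sigma>' y" using s(2) by (simp add: fun_eq_iff)
  then have "x \<in> orb y" using \<open>\<sigma>' \<in> \<Gamma>\<close> unfolding orb_def by blast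
  then show ?thesis using sub assms by blast
qed

lemma card_stab_pos: "card (stab x) > 0"
proof -
  have "finite (stab x)" unfolding stab_def using finite_group by simp
  moreover have "id \<in> stab x" by (simp add: stab_def id_mem)
  ultimately show ?thesis by (auto simp: card_gt_0_iff)
qed

lemma card_stab_eq:
  assumes "y \<in> orb x" 
  shows "card (stab y) = card (stab x)"
proof -
  have "card (orb x) > 0"
    using orb_refl[of x] finite_group unfolding orb_def by (auto simp: card_gt_0_iff)
  moreover have "card (orb x) * card (stab y) = card (orb x) * card (stab x)"
    using orbit_stabilizer[of x] orbit_stabilizer[of y] by (simp add: orb_eq[OF assms])
  ultimately show ?thesis by simp
qed

text \<open>Burnside's count of the pairs of a nontrivial group element and one of its two fixed points,
  the points of \<open>E\<close> being left out.\<close>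

lemma card_group_le:
  assumes fix2: "\<And>\<sigma>. \<sigma> \<in> \<Gamma> \<Longrightarrow> \<sigma> \<noteq> id \<Longrightarrow> card {x. \<sigma> x = x} = 2"
    and E: "finite E" "card E \<le> 1" "\<And>\<sigma> x. \<sigma> \<in> \<Gamma> \<Longrightarrow> x \<in> E \<Longrightarrow> \<sigma> x = x"
    and M: "\<And>x. x \<notin> E \<Longrightarrow> card (stab x) \<le> M"
  shows "card \<Gamma> \<le> 2 * fact M"
proof -
  define N where "N = card \<Gamma>"
  define P where "P = (\<Union>\<sigma>\<in>\<Gamma> - {id}. {x. \<sigma> x = x}) - E"
  \<comment> \<open>The number of fixed points that each nontrivial element has outside
    \<open>E\<close>.\<close>
  define k where "k = 2 - card E"
  have finfix: "finite {x. \<sigma> x = x}" if "\<sigma> \<in> \<Gamma> - {id}" for \<sigma>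
    using fix2[of \<sigma>] that by (intro card_ge_0_finite) simp
  have finP: "finite P" unfolding P_def using finite_group finfix by auto
  have orbP: "orb x \<subseteq> P" if x: "x \<in> P" for x
  proof
    fix y assume "y \<in> orb x"
    then obtain \<tau> where t: "\<tau> \<in> \<Gamma>" "y = \<tau> x" by (auto simp: orb_def)
    obtain \<tau>' where t': "\<tau>' \<in> \<Gamma>" "\<tau>' \<circ> \<tau> = id" "\<tau> \<circ> \<tau>' = id" using inverse_mem[OF t(1)] by blast
    have tt: "\<tau>' (\<tau> z) = z" "\<tau> (\<tau>' z) = z" for z using t'(2,3) by (simp_all add: fun_eq_iff)
    obtain \<sigma> where s: "\<sigma> \<in> \<Gamma>" "\<sigma> \<noteq> id" "\<sigma> x = x" "x \<notin> E" using x by (auto simp: P_def)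
    have "\<tau> \<circ> \<sigma> \<circ> \<tau>' \<in> \<Gamma>" by (intro comp_mem t t' s)
    moreover have "\<tau> \<circ> \<sigma> \<circ> \<tau>' \<noteq> id"
    proof
      assume "\<tau> \<circ> \<sigma> \<circ> \<tau>' = id"
      then have "\<tau>' (\<tau> (\<sigma> (\<tau>' (\<tau> z)))) = \<tau>' (\<tau> z)" for z by (simp add: fun_eq_iff)
      then show False using s(2) by (simp add: tt fun_eq_iff)
    qed
    moreover have "(\<tau> \<circ> \<sigma> \<circ> \<tau>') y = y" by (simp add: t(2) tt s(3))
    moreover have "y \<notin> E"
    proof
      assume "y \<in> E"
      then have "\<tau>' y = y" using E(3) t'(1) by blast
      then have "y = x" using t(2) tt by simp
      then show False using s(4) \<open>y \<in> E\<close> by simp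
    qed
    ultimately show "y \<in> P" unfolding P_def by blast
  qed
  have ec: "card E * (N - 1) + (\<Sum>x\<in>P. card (stab x - {id})) = 2 * (N - 1)"
  proof -
    have "(\<Sum>\<sigma>\<in>\<Gamma> - {id}. card {x. \<sigma> x = x}) = (\<Sum>\<sigma>\<in>\<Gamma> - {id}. 2)"
      by (rule sum.cong) (auto simp: fix2)
    also have "\<dots> = 2 * (N - 1)" using id_mem by (simp add: N_def card_Diff_singleton)
    finally have 1: "(\<Sum>\<sigma>\<in>\<Gamma> - {id}. card {x. \<sigma> x = x}) = 2 * (N - 1)" .
    have 2: "card {x. \<sigma> x = x} = card E + card {x \<in> P. \<sigma> x = x}" if s: "\<sigma> \<in> \<Gamma> - {id}" for \<sigma>
    proof -
      have "{x. \<sigma> x = x} = E \<union> {x \<in> P. \<sigma> x = x}" using s E(3) by (auto simp: P_def)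
      moreover have "E \<inter> {x \<in> P. \<sigma> x = x} = {}" by (auto simp: P_def)
      ultimately show ?thesis using E(1) finP by (simp add: card_Un_disjoint)
    qed
    have "(\<Sum>\<sigma>\<in>\<Gamma> - {id}. card {x \<in> P. \<sigma> x = x}) = (\<Sum>x\<in>P. card {\<sigma> \<in> \<Gamma> - {id}. \<sigma> x = x})"
      by (rule sum_multicount_gen) (use finite_group finP in auto)
    also have "\<dots> = (\<Sum>x\<in>P. card (stab x - {id}))"
      by (rule sum.cong) (auto simp: stab_def intro!: arg_cong[of _ _ card])
    finally have 3: "(\<Sum>\<sigma>\<in>\<Gamma> - {id}. card {x \<in> P. \<sigma> x = x}) = (\<Sum>x\<in>P. card (stab x - {id}))" .
    have "2 * (N - 1) = (\<Sum>\<sigma>\<in>\<Gamma> - {id}. card E + card {x \<in> P. \<sigma> x = x})"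
      unfolding 1[symmetric] by (rule sum.cong) (auto simp: 2)
    also have "\<dots> = card E * (N - 1) + (\<Sum>x\<in>P. card (stab x - {id}))"
      unfolding sum.distrib 3 using id_mem by (simp add: N_def card_Diff_singleton)
    finally show ?thesis by simp
  qed
  have stab1: "card (stab x) = Suc (card (stab x - {id}))" for x
  proof -
    have "finite (stab x)" "id \<in> stab x" using finite_group id_mem by (auto simp: stab_def)
    then show ?thesis by (metis card.remove)
  qed
  have "(\<Sum>x\<in>P. card (stab x)) = card P + (\<Sum>x\<in>P. card (stab x - {id}))"
    unfolding stab1 by (simp add: sum_Suc)
  moreover have "card E * (N - 1) + k * (N - 1) = 2 * (N - 1)"
    unfolding k_def using E(2) by (simp flip: add_mult_distrib)
  ultimately have count: "(\<Sum>x\<in>P. card (stab x)) = card P + k * (N - 1)" using ec by linarith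
  have Npos: "N > 0" unfolding N_def using finite_group id_mem by (auto simp: card_gt_0_iff)
  have d1: "N dvd (\<Sum>x\<in>P. card (stab x))"
    by (rule card_dvd_sum_invariant[OF finP, of orb])
      (use orb_refl orbP orb_eq card_stab_eq orbit_stabilizer in \<open>auto simp: N_def mult.commute\<close>)
  \<comment> \<open>\<open>card P\<close> itself need not be a multiple of \<open>N\<close>.
    Weighting every point by \<open>fact M\<close>, a common multiple of the stabilizer orders,
    makes each orbit contribute one.\<close>
  have d2: "N dvd (\<Sum>x\<in>P. fact M)"
  proof (rule card_dvd_sum_invariant[OF finP, of orb])
    fix x assume "x \<in> P"
    then have "card (stab x) \<le> M" by (intro M) (auto simp: P_def)
    then have "card (stab x) dvd fact M" using card_stab_pos[of x] by (intro dvd_fact) auto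
    then have "card (stab x) * card (orb x) dvd fact M * card (orb x)" by (rule mult_dvd_mono) simp
    then show "N dvd fact M * card (orb x)" using orbit_stabilizer[of x] by (simp add: N_def mult.commute)
  qed (use orb_refl orbP orb_eq in auto)
  \<comment> \<open>The count times \<open>fact M\<close>, arranged without subtraction: modulo
    \<open>N\<close> it says that \<open>fact M * k\<close> vanishes, and this bounds
    \<open>N\<close>.\<close>
  have "fact M * (\<Sum>x\<in>P. card (stab x)) + fact M * k = (\<Sum>x\<in>P. fact M) + fact M * k * N"
  proof -
    have "k * (N - 1) + k = k * N" using Npos by (metis Suc_diff_1 add.commute mult_Suc_right)
    then have "fact M * (card P + k * (N - 1)) + fact M * k = fact M * card P + fact M * (k * N)"
      by (metis (no_types, lifting) add.assoc distrib_left)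
    then show ?thesis unfolding count by (simp add: mult.commute mult.left_commute)
  qed
  moreover have "N dvd (\<Sum>x\<in>P. fact M) + fact M * k * N" using d2 by simp
  ultimately have "N dvd fact M * (\<Sum>x\<in>P. card (stab x)) + fact M * k" by simp
  then have "N dvd fact M * k" using d1 by (meson dvd_add_right_iff dvd_mult)
  moreover have "fact M * k > 0" using E(2) by (simp add: k_def)
  ultimately have "N \<le> fact M * k" by (rule dvd_imp_le)
  also have "\<dots> \<le> fact M * 2" by (simp add: k_def)
  finally show ?thesis by (simp add: N_def mult.commute)
qed

end

section \<open>Periodic critical points\<close>

locale rational_iteration =
  fixes A :: "riemann_sphere \<Rightarrow> riemann_sphere" and n :: nat
  assumes A: "rational_deg n A" and n: "n \<ge> 2"
begin

lemma n0: "n > 0" using n by simp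

lemma rational_deg_iterate: "rational_deg (n ^ k) (A ^^ k)"
  by (rule rational_deg_funpow[OF A n0])

lemma pow_pos: "n ^ k > 0" using n0 by simp

lemma iterate_add: "(A ^^ (i + j)) z = (A ^^ i) ((A ^^ j) z)"
  by (simp add: funpow_add)

abbreviation ld :: "nat \<Rightarrow> riemann_sphere \<Rightarrow> nat" where
  "ld k z \<equiv> local_degree (A ^^ k) z"

lemma ld_add: "ld (i + j) z = ld i ((A ^^ j) z) * ld j z"
  unfolding funpow_add by (rule local_degree_comp[OF rational_deg_iterate pow_pos rational_deg_iterate pow_pos])

lemma ld_pos: "ld k z > 0"
  using local_degree_bounds(1)[OF rational_deg_iterate pow_pos, of k z] by simp

lemma ld_1: "ld 1 z = local_degree A z"
  by (simp add: eq_id_iff[symmetric])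

lemma ld_0: "ld 0 z = 1"
  using local_degree_moebius[OF moebius_id] by (simp add: id_def)

lemma ld_Suc: "ld (Suc k) z = local_degree A ((A ^^ k) z) * ld k z"
  using ld_add[of 1 k z] by (simp add: ld_1)

lemma ld_Suc': "ld (Suc k) z = ld k (A z) * local_degree A z"
  using ld_add[of k 1 z] by (simp add: ld_1)

lemma ld_prod: "ld k z = (\<Prod>j<k. local_degree A ((A ^^ j) z))"
  by (induction k) (simp_all only: ld_0 ld_Suc prod.lessThan_Suc mult.commute lessThan_0 prod.empty)

text \<open>By the chain rule only critical points on the orbit contribute a factor, at most
  \<open>n\<close> each; without a repeated critical point there are at most \<open>2 * n\<close>
  such factors.\<close>

lemma ld_le_or_recurrent:
  "ld k z \<le> n ^ (2 * n) \<or> (\<exists>i j. i < j \<and> j < k \<and> (A ^^ i) z = (A ^^ j) z \<and> local_degree A ((A ^^ i) z) \<ge> 2)"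
proof -
  define J where "J = {j. j < k \<and> local_degree A ((A ^^ j) z) \<ge> 2}"
  have finJ: "finite J" unfolding J_def by simp
  show ?thesis
  proof (cases "inj_on (\<lambda>j. (A ^^ j) z) J")
    case True
    have "card J = card ((\<lambda>j. (A ^^ j) z) ` J)" using card_image[OF True] by simp
    also have "\<dots> \<le> card {z. local_degree A z \<ge> 2}"
      by (rule card_mono[OF card_critical(1)[OF A n0]]) (auto simp: J_def)
    also have "\<dots> \<le> 2 * n" by (rule card_critical(2)[OF A n0])
    finally have cJ: "card J \<le> 2 * n" .
    have "ld k z = (\<Prod>j\<in>J. local_degree A ((A ^^ j) z))"
      unfolding ld_prod
    proof (rule prod.mono_neutral_right)
      show "\<forall>j\<in>{..<k} - J. local_degree A ((A ^^ j) z) = 1"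
      proof
        fix j assume "j \<in> {..<k} - J"
        then show "local_degree A ((A ^^ j) z) = 1"
          using local_degree_bounds(1)[OF A n0, of "(A ^^ j) z"] by (auto simp: J_def)
      qed
    qed (auto simp: J_def)
    also have "\<dots> \<le> (\<Prod>j\<in>J. n)"
      by (rule prod_mono) (use local_degree_bounds(2)[OF A n0] in auto)
    also have "\<dots> = n ^ card J" by simp
    also have "\<dots> \<le> n ^ (2 * n)" using cJ n0 by (intro power_increasing) auto
    finally show ?thesis ..
  next
    case False
    then obtain i j where ij: "i \<in> J" "j \<in> J" "i \<noteq> j" "(A ^^ i) z = (A ^^ j) z" by (auto simp: inj_on_def)
    have J: "l < k" "local_degree A ((A ^^ l) z) \<ge> 2" if "l \<in> J" for l
      using that by (simp_all add: J_def)
    from \<open>i \<noteq> j\<close> have "i < j \<or> j < i" by linarith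
    then show ?thesis
    proof
      assume "i < j"
      then show ?thesis using ij(4) J[OF ij(1)] J[OF ij(2)] by blast
    next
      assume "j < i"
      then show ?thesis using ij(4)[symmetric] J[OF ij(1)] J[OF ij(2)] by blast
    qed
  qed
qed

lemma Sigma_group_iterate:
  assumes "\<sigma> \<in> Sigma_group (A ^^ k)" "i \<ge> k"
  shows "\<sigma> \<in> Sigma_group (A ^^ i)"
proof -
  have "A ^^ i = A ^^ (i - k) \<circ> A ^^ k" using assms(2) by (simp flip: funpow_add)
  then show ?thesis using assms(1) by (simp add: Sigma_group_def comp_assoc)
qed

lemma ld_Sigma_group:
  assumes "\<sigma> \<in> Sigma_group (A ^^ k)"
  shows "ld k (\<sigma> z) = ld k z"
proof -
  have "rational_deg 1 \<sigma>" using assms moebius_rational_deg by (auto simp only: Sigma_group_def)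
  from local_degree_comp[OF rational_deg_iterate pow_pos this, of k z]
  have "local_degree (A ^^ k \<circ> \<sigma>) z = ld k (\<sigma> z) * local_degree \<sigma> z" by simp
  moreover have "A ^^ k \<circ> \<sigma> = A ^^ k" using assms by (simp add: Sigma_group_def)
  moreover have "local_degree \<sigma> z = 1" using assms by (intro local_degree_moebius) (simp add: Sigma_group_def)
  ultimately show ?thesis by simp
qed

text \<open>The backward orbit of \<open>c\<close>, a countable set, unlike the basin of attraction
  in the sense of Fatou.\<close>

definition basin :: "riemann_sphere \<Rightarrow> riemann_sphere set" where
  "basin c = {z. \<exists>i. (A ^^ i) z = c}"

definition periodic_critical :: "riemann_sphere \<Rightarrow> bool" where
  "periodic_critical c \<longleftrightarrow> local_degree A c \<ge> 2 \<and> (\<exists>p>0. (A ^^ p) c = c)"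

lemma basin_preimage: "A z \<in> basin c \<Longrightarrow> z \<in> basin c"
proof -
  assume "A z \<in> basin c"
  then obtain i where "(A ^^ i) (A z) = c" by (auto simp: basin_def)
  then have "(A ^^ Suc i) z = c" by (simp only: funpow_Suc_right o_apply)
  then show ?thesis unfolding basin_def by blast
qed

lemma iterate_period:
  assumes "(A ^^ p) c = c"
  shows "(A ^^ (p * t)) c = c" "ld (p * t) c = ld p c ^ t"
proof -
  show 1: "(A ^^ (p * t)) c = c" for t
    by (induction t) (simp_all only: mult_Suc_right mult_0_right iterate_add assms funpow_0)
  show "ld (p * t) c = ld p c ^ t"
    by (induction t) (simp_all only: mult_Suc_right mult_0_right ld_add 1 ld_0 power_0 power_Suc)
qed

text \<open>A symmetry of \<open>A ^^ k\<close> is guaranteed to be one of \<open>A ^^ i\<close>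
  only for \<open>i\<close> at least \<open>k\<close>, so late hits of \<open>c\<close> are needed;
  periodicity of \<open>c\<close> supplies them.\<close>

lemma basin_late:
  assumes "(A ^^ p) c = c" "p > 0" "z \<in> basin c"
  shows "\<exists>i\<ge>k. (A ^^ i) z = c"
proof -
  obtain i where i: "(A ^^ i) z = c" using assms(3) by (auto simp: basin_def)
  have "(A ^^ (p * k + i)) z = c" unfolding iterate_add i by (rule iterate_period[OF assms(1)])
  moreover have "p * k + i \<ge> k" using assms(2) by (cases p) auto
  ultimately show ?thesis by blast
qed

lemma Sigma_group_basin:
  assumes "(A ^^ p) c = c" "p > 0" "z \<in> basin c" "\<sigma> \<in> Sigma_group (A ^^ k)"
  shows "\<sigma> z \<in> basin c"
proof -
  obtain i where i: "i \<ge> k" "(A ^^ i) z = c" using basin_late[OF assms(1-3)] by blast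
  have "(A ^^ i) (\<sigma> z) = c"
    using Sigma_group_apply[OF Sigma_group_iterate[OF assms(4) i(1)], of z] i(2) by simp
  then show ?thesis unfolding basin_def by blast
qed

text \<open>The weight of a point \<open>z\<close> of the basin is the order of the logarithmic pole at \<open>z\<close> of a Green
  function with \<open>G (A z) = lam * G z\<close>. It is constant on the orbits of the symmetries of the iterates
  and increases along the orbit of \<open>z\<close> except at critical points.\<close>

lemma weight_exists:
  assumes c: "periodic_critical c"
  obtains w :: "riemann_sphere \<Rightarrow> real" and lam where "lam > 1" 
    "\<And>z i. (A ^^ i) z = c \<Longrightarrow> w z = ld i z / lam ^ i"
proof -
  obtain p where p: "p > 0" "(A ^^ p) c = c" and crit: "local_degree A c \<ge> 2"
    using c by (auto simp: periodic_critical_def)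
  define d where "d = ld p c"
  have d2: "d \<ge> 2"
  proof -
    have "ld p c = ld (p - 1) (A c) * local_degree A c" using ld_Suc'[of "p - 1" c] p(1) by simp
    then show ?thesis using crit ld_pos[of "p - 1" "A c"]
      by (metis d_def One_nat_def Suc_leI mult_le_mono mult_1)
  qed
  \<comment> \<open>The geometric mean of the local degrees of \<open>A\<close> over
    \<open>p\<close> steps from \<open>c\<close>.\<close>
  define lam where "lam = root p (real d)"
  have l1: "lam > 1" unfolding lam_def using d2 p(1) by simp
  have lp: "lam ^ p = d" unfolding lam_def using p(1) by simp
  \<comment> \<open>Both \<open>p\<close> and \<open>q\<close> are return times, so the local degree
    of the iterate of order \<open>p * q\<close> at \<open>c\<close> can be computed in two
    ways.\<close>
  have ret: "real (ld q c) = lam ^ q" if "(A ^^ q) c = c" for q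
  proof -
    have "ld q c ^ p = ld p c ^ q"
      using iterate_period(2)[OF that, of p] iterate_period(2)[OF p(2), of q] by (simp add: mult.commute)
    then have "real (ld q c) ^ p = (lam ^ q) ^ p"
      by (metis d_def lp of_nat_power power_commutes power_mult mult.commute)
    then show ?thesis
      by (rule power_eq_imp_eq_base) (use l1 p(1) in auto)
  qed
  \<comment> \<open>The least hitting time is only a choice: a later hit adds a return to
    \<open>c\<close>, which multiplies numerator and denominator by the same power of
    \<open>lam\<close>.\<close>
  define w where "w = (\<lambda>z. let i = (LEAST i. (A ^^ i) z = c) in ld i z / lam ^ i)"
  have "w z = ld i z / lam ^ i" if i: "(A ^^ i) z = c" for z i
  proof -
    define j where "j = (LEAST i. (A ^^ i) z = c)"
    have j: "(A ^^ j) z = c" "j \<le> i" unfolding j_def using i by (auto intro: LeastI Least_le)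
    have "i = (i - j) + j" using j(2) by simp
    then have 1: "(A ^^ i) z = (A ^^ (i - j)) c" "ld i z = ld (i - j) c * ld j z" "lam ^ i = lam ^ (i - j) * lam ^ j"
      using iterate_add[of "i - j" j z] ld_add[of "i - j" j z] power_add[of lam "i - j" j] j(1) by simp_all
    have "real (ld (i - j) c) = lam ^ (i - j)" using ret 1(1) i by simp
    then have "ld i z / lam ^ i = (lam ^ (i - j) * ld j z) / (lam ^ (i - j) * lam ^ j)"
      unfolding 1(2,3) by simp
    also have "\<dots> = ld j z / lam ^ j" using l1 by simp
    finally show ?thesis by (simp add: w_def Let_def j_def)
  qed
  then show ?thesis using that[OF l1] by blast
qed

text \<open>Superlevel sets of the weight are invariant, and finite at positive levels. At the
  highest level that still holds three points, at most two points lie strictly above; each point of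
  the level set is critical or is mapped to one of these two, which gives
  \<open>2 * n + 2 * n\<close>.\<close>

lemma large_basin_invariant_set:
  assumes c: "periodic_critical c" and T0: "T0 \<subseteq> basin c" "card T0 = 3"
  obtains T where "finite T" "3 \<le> card T" "card T \<le> 4 * n"
    "\<And>\<sigma> k x. \<sigma> \<in> Sigma_group (A ^^ k) \<Longrightarrow> x \<in> T \<Longrightarrow> \<sigma> x \<in> T"
proof -
  obtain p where p: "(A ^^ p) c = c" "p > 0" using c by (auto simp: periodic_critical_def)
  obtain w :: "riemann_sphere \<Rightarrow> real" and lam where l1: "lam > 1"
    and w: "\<And>z i. (A ^^ i) z = c \<Longrightarrow> w z = ld i z / lam ^ i"
    using weight_exists[OF c] by metis
  have wpos: "w z > 0" if "z \<in> basin c" for z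
    using that w ld_pos l1 by (auto simp: basin_def)
  have winv: "w (\<sigma> z) = w z" if s: "\<sigma> \<in> Sigma_group (A ^^ k)" and z: "z \<in> basin c" for \<sigma> k z
  proof -
    obtain i where i: "i \<ge> k" "(A ^^ i) z = c" using basin_late[OF p z] by blast
    have si: "\<sigma> \<in> Sigma_group (A ^^ i)" by (rule Sigma_group_iterate[OF s i(1)])
    have "(A ^^ i) (\<sigma> z) = c" using Sigma_group_apply[OF si, of z] i(2) by simp
    then show ?thesis using w[OF i(2)] w ld_Sigma_group[OF si, of z] by simp
  qed
  have wstep: "A z \<in> basin c \<and> w (A z) = lam * w z" if z: "z \<in> basin c" "local_degree A z < 2" for z
  proof -
    obtain i where i: "i \<ge> 1" "(A ^^ i) z = c" using basin_late[OF p z(1)] by blast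
    then obtain j where j: "i = Suc j" by (cases i) auto
    have Aj: "(A ^^ j) (A z) = c" using i(2) unfolding j by (simp only: funpow_Suc_right o_apply)
    have "local_degree A z = 1" using z(2) local_degree_bounds(1)[OF A n0, of z] by simp
    then have "ld i z = ld j (A z)" unfolding j ld_Suc' by simp
    then have "w (A z) = lam * w z" unfolding w[OF Aj] w[OF i(2)] j using l1 by simp
    then show ?thesis using Aj unfolding basin_def by blast
  qed
  define L where "L = (\<lambda>v. {z \<in> basin c. w z \<ge> v})"
  \<comment> \<open>Up to the first hit of \<open>c\<close> the local degree is at most a constant,
    so the weight decays geometrically in the hitting time.\<close>
  have finL: "finite (L v)" if v: "v > 0" for v
  proof -
    define M where "M = real (n ^ (2 * n))"
    obtain I where I: "M / v < lam ^ I" using real_arch_pow[OF l1] by blast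
    have "L v \<subseteq> (\<Union>i\<in>{..<I}. {z. (A ^^ i) z = c})"
    proof
      fix z assume z: "z \<in> L v"
      define i where "i = (LEAST i. (A ^^ i) z = c)"
      have ex: "\<exists>i. (A ^^ i) z = c" using z by (simp add: L_def basin_def)
      have i: "(A ^^ i) z = c" unfolding i_def by (rule LeastI_ex[OF ex])
      \<comment> \<open>A repetition before the first hit could be cut out, giving an earlier
        hit.\<close>
      have "\<not> (\<exists>k j. k < j \<and> j < i \<and> (A ^^ k) z = (A ^^ j) z \<and> local_degree A ((A ^^ k) z) \<ge> 2)"
      proof
        assume "\<exists>k j. k < j \<and> j < i \<and> (A ^^ k) z = (A ^^ j) z \<and> local_degree A ((A ^^ k) z) \<ge> 2"
        then obtain k j where kj: "k < j" "j < i" "(A ^^ k) z = (A ^^ j) z" by blast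
        have "(A ^^ (i - j + k)) z = (A ^^ (i - j + j)) z" unfolding iterate_add kj(3) ..
        then have "(A ^^ (i - j + k)) z = c" using i kj(2) by simp
        then have "i \<le> i - j + k" unfolding i_def by (rule Least_le)
        then show False using kj by simp
      qed
      then have "ld i z \<le> n ^ (2 * n)" using ld_le_or_recurrent[of i z] by blast
      then have "real (ld i z) \<le> M" unfolding M_def by (simp only: of_nat_le_iff)
      moreover have "v \<le> ld i z / lam ^ i" using z w[OF i] by (simp add: L_def)
      then have "v * lam ^ i \<le> ld i z" using l1 by (simp add: field_simps)
      ultimately have "lam ^ i \<le> M / v" using v by (simp add: field_simps)
      then have "lam ^ i < lam ^ I" using I by simp
      then have "i < I" using l1 by simp
      then show "z \<in> (\<Union>i\<in>{..<I}. {z. (A ^^ i) z = c})" using i by blast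
    qed
    moreover have "finite (\<Union>i\<in>{..<I}. {z. (A ^^ i) z = c})"
      using rational_deg_fibre_finite_card(1)[OF rational_deg_iterate pow_pos] by blast
    ultimately show ?thesis by (rule finite_subset)
  qed
  have T0': "finite T0" "T0 \<noteq> {}" using T0(2) by (auto intro: card_ge_0_finite)
  define \<delta> where "\<delta> = Min (w ` T0)"
  have \<delta>: "\<delta> \<in> w ` T0" "\<And>z. z \<in> T0 \<Longrightarrow> \<delta> \<le> w z" unfolding \<delta>_def using T0' by auto
  then have \<delta>0: "\<delta> > 0" using wpos T0(1) by auto
  have T0L: "T0 \<subseteq> L \<delta>" using T0(1) \<delta>(2) by (auto simp: L_def)
  define W where "W = {v \<in> w ` L \<delta>. card (L v) \<ge> 3}"
  have finW: "finite W" unfolding W_def using finL[OF \<delta>0] by simp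
  have "\<delta> \<in> W" unfolding W_def using card_mono[OF finL[OF \<delta>0] T0L] \<delta>(1) T0(2) T0L by auto
  define v where "v = Max W"
  have vW: "v \<in> W" unfolding v_def using finW \<open>\<delta> \<in> W\<close> by (intro Max_in) auto
  have v\<delta>: "\<delta> \<le> v" unfolding v_def using finW \<open>\<delta> \<in> W\<close> by simp
  then have v0: "v > 0" using \<delta>0 by simp
  define T' where "T' = {z \<in> basin c. w z > v}"
  have T'L: "T' \<subseteq> L v" by (auto simp: T'_def L_def)
  then have finT': "finite T'" using finL[OF v0] finite_subset by blast
  \<comment> \<open>If three points lay above \<open>v\<close>, the smallest of their weights would
    be a higher admissible level.\<close>
  have cT': "card T' \<le> 2"
  proof (rule ccontr)
    assume "\<not> card T' \<le> 2"
    then have c3: "card T' \<ge> 3" by simp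
    then have ne: "T' \<noteq> {}" by auto
    define v' where "v' = Min (w ` T')"
    have v': "v' \<in> w ` T'" "\<And>z. z \<in> T' \<Longrightarrow> v' \<le> w z" unfolding v'_def using finT' ne by auto
    have vv: "v < v'" using v'(1) by (auto simp: T'_def)
    have "T' \<subseteq> L v'" using v'(2) by (auto simp: L_def T'_def)
    then have "card (L v') \<ge> 3" using card_mono[OF finL, of v' T'] v0 vv c3 by simp
    moreover have "v' \<in> w ` L \<delta>" using v'(1) v\<delta> by (auto simp: T'_def L_def)
    ultimately have "v' \<in> W" by (simp add: W_def)
    then have "v' \<le> v" unfolding v_def using finW by simp
    then show False using vv by simp
  qed
  have sub: "L v \<subseteq> {z. local_degree A z \<ge> 2} \<union> (\<Union>y\<in>T'. {z. A z = y})"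
  proof
    fix z assume z: "z \<in> L v"
    show "z \<in> {z. local_degree A z \<ge> 2} \<union> (\<Union>y\<in>T'. {z. A z = y})"
    proof (cases "local_degree A z \<ge> 2")
      case False
      have zb: "z \<in> basin c" "w z \<ge> v" using z by (auto simp: L_def)
      have "A z \<in> basin c" "w (A z) = lam * w z" using wstep[OF zb(1)] False by auto
      moreover have "w z < lam * w z" using l1 wpos[OF zb(1)] by simp
      ultimately have "A z \<in> T'" using zb(2) by (simp add: T'_def)
      then show ?thesis by blast
    qed simp
  qed
  have "card (\<Union>y\<in>T'. {z. A z = y}) \<le> (\<Sum>y\<in>T'. card {z. A z = y})" by (rule card_UN_le[OF finT'])
  also have "\<dots> \<le> (\<Sum>y\<in>T'. n)" by (rule sum_mono) (rule rational_deg_fibre_finite_card(2)[OF A n0])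
  also have "\<dots> \<le> 2 * n" using cT' by simp
  finally have c1: "card (\<Union>y\<in>T'. {z. A z = y}) \<le> 2 * n" .
  have fin: "finite ({z. local_degree A z \<ge> 2} \<union> (\<Union>y\<in>T'. {z. A z = y}))"
    using card_critical(1)[OF A n0] finT' rational_deg_fibre_finite_card(1)[OF A n0] by simp
  have "card (L v) \<le> card {z. local_degree A z \<ge> 2} + card (\<Union>y\<in>T'. {z. A z = y})"
    using card_mono[OF fin sub] card_Un_le[of "{z. local_degree A z \<ge> 2}" "\<Union>y\<in>T'. {z. A z = y}"] by linarith
  then have "card (L v) \<le> 4 * n" using c1 card_critical(2)[OF A n0] by simp
  moreover have "\<sigma> x \<in> L v" if "\<sigma> \<in> Sigma_group (A ^^ k)" "x \<in> L v" for \<sigma> k x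
    using that winv[OF that(1)] Sigma_group_basin[OF p _ that(1)] by (simp add: L_def)
  moreover have "card (L v) \<ge> 3" using vW by (simp add: W_def)
  ultimately show ?thesis using that[of "L v"] finL[OF v0] by blast
qed

end

section \<open>The uniform bound on the symmetry groups\<close>

context rational_iteration
begin

lemma finite_map_group_Sigma: "finite_map_group (Sigma_group (A ^^ k))"
proof
  show "finite (Sigma_group (A ^^ k))" by (rule finite_Sigma_group[OF rational_deg_iterate pow_pos])
qed (auto simp only: id_Sigma_group comp_Sigma_group inverse_Sigma_group)

lemma periodic_criticalI:
  assumes "i < j" "(A ^^ i) z = (A ^^ j) z" "local_degree A ((A ^^ i) z) \<ge> 2"
  shows "periodic_critical ((A ^^ i) z)"
proof -
  have "(A ^^ (j - i)) ((A ^^ i) z) = (A ^^ i) z"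
    using assms(1,2) iterate_add[of "j - i" i z] by simp
  then show ?thesis unfolding periodic_critical_def using assms(1,3) by (intro conjI exI[of _ "j - i"]) auto
qed

text \<open>The entries of the maximum come from two cases, an invariant set of at most
  \<open>4 * n\<close> points and stabilizers of order at most \<open>n ^ (2 * n)\<close>; neither
  number involves \<open>k\<close>.\<close>

lemma card_Sigma_group_le:
  assumes not_power: "\<not> conjugate A (rat_map (monom 1 n) 1)" "\<not> conjugate A (rat_map 1 (monom 1 n))"
  shows "card (Sigma_group (A ^^ k)) \<le> max ((4 * n) ^ 3) (2 * fact (n ^ (2 * n)))"
proof (cases "\<exists>c T0. periodic_critical c \<and> T0 \<subseteq> basin c \<and> card T0 = 3")
  case True
  then obtain c T0 where c: "periodic_critical c" "T0 \<subseteq> basin c" "card T0 = 3" by blast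
  obtain T where T: "finite T" "3 \<le> card T" "card T \<le> 4 * n"
    "\<And>\<sigma> k x. \<sigma> \<in> Sigma_group (A ^^ k) \<Longrightarrow> x \<in> T \<Longrightarrow> \<sigma> x \<in> T"
    using large_basin_invariant_set[OF c] by metis
  have "card (Sigma_group (A ^^ k)) \<le> (4 * n) ^ 3"
  proof (rule card_moebius_le(2)[OF T(1,2), where X = "\<lambda>_. T"])
    show "moebius \<sigma>" if "\<sigma> \<in> Sigma_group (A ^^ k)" for \<sigma> using that by (rule Sigma_group_moebius)
    show "finite T \<and> card T \<le> 4 * n" using T by simp
    show "\<sigma> x \<in> T" if "\<sigma> \<in> Sigma_group (A ^^ k)" "x \<in> T" for \<sigma> x using T(4) that .
  qed
  then show ?thesis by simp
next
  case False
  then have small: "\<not> (T0 \<subseteq> basin c \<and> card T0 = 3)" if "periodic_critical c" for c T0 using that by blast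
  \<comment> \<open>Serves twice: the backward orbit of a periodic critical point cannot have
    exactly two points, and two such points with singleton backward orbits cannot coexist.\<close>
  have no_pair: "a = b" if ab: "\<And>z. A z \<in> {a, b} \<Longrightarrow> z \<in> {a, b}" for a b
    using exceptional_pair_conjugate[OF A n _ ab] not_power by blast
  define E where "E = (\<Union>c\<in>{c. periodic_critical c}. basin c)"
  have single: "basin c = {c}" if c: "periodic_critical c" for c
  proof -
    have cc: "c \<in> basin c" unfolding basin_def by (intro CollectI exI[of _ 0]) simp
    have "b = c" if b: "b \<in> basin c" for b
    proof (rule ccontr)
      assume bc: "b \<noteq> c"
      have two: "x \<in> {b, c}" if "x \<in> basin c" for x
      proof (rule ccontr)
        assume "x \<notin> {b, c}"
        then have "card {x, b, c} = 3" using bc by auto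
        moreover have "{x, b, c} \<subseteq> basin c" using that b cc by simp
        ultimately show False using small[OF c] by blast
      qed
      have "b = c"
      proof (rule no_pair)
        fix z assume "A z \<in> {b, c}"
        then have "A z \<in> basin c" using b cc by auto
        then show "z \<in> {b, c}" by (rule two[OF basin_preimage])
      qed
      then show False using bc by simp
    qed
    then show ?thesis using cc by blast
  qed
  have uniq: "c = c'" if c: "periodic_critical c" "periodic_critical c'" for c c'
  proof (rule no_pair)
    fix z assume "A z \<in> {c, c'}"
    then have "A z \<in> basin c \<or> A z \<in> basin c'" using single[OF c(1)] single[OF c(2)] by auto
    then have "z \<in> basin c \<or> z \<in> basin c'" using basin_preimage by blast
    then show "z \<in> {c, c'}" using single[OF c(1)] single[OF c(2)] by auto
  qed
  have Esub: "E \<subseteq> {c}" if "periodic_critical c" for c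
    using single uniq that unfolding E_def by blast
  have E: "finite E \<and> card E \<le> 1"
  proof (cases "\<exists>c. periodic_critical c")
    case True
    then obtain c where "E \<subseteq> {c}" using Esub by blast
    then show ?thesis using card_mono[of "{c}" E] finite_subset[of E "{c}"] by simp
  next
    case False
    then have "E = {}" by (simp add: E_def)
    then show ?thesis by simp
  qed
  interpret finite_map_group "Sigma_group (A ^^ k)" by (rule finite_map_group_Sigma)
  have "card (Sigma_group (A ^^ k)) \<le> 2 * fact (n ^ (2 * n))"
  proof (rule card_group_le)
    show "card {x. \<sigma> x = x} = 2" if "\<sigma> \<in> Sigma_group (A ^^ k)" "\<sigma> \<noteq> id" for \<sigma>
      using Sigma_group_fixed_points[OF rational_deg_iterate pow_pos that] .
    show "finite E" "card E \<le> 1" using E by auto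
    show "\<sigma> x = x" if s: "\<sigma> \<in> Sigma_group (A ^^ k)" "x \<in> E" for \<sigma> x
    proof -
      obtain c where c: "periodic_critical c" "x \<in> basin c" using s(2) by (auto simp: E_def)
      obtain p where p: "(A ^^ p) c = c" "p > 0" using c(1) by (auto simp: periodic_critical_def)
      have "\<sigma> x \<in> basin c" by (rule Sigma_group_basin[OF p c(2) s(1)])
      then show ?thesis using c(2) single[OF c(1)] by simp
    qed
    show "card (stab x) \<le> n ^ (2 * n)" if x: "x \<notin> E" for x
    proof -
      have "card (stab x) \<le> ld k x"
        unfolding stab_def by (rule card_stabilizer[OF rational_deg_iterate pow_pos])
      \<comment> \<open>A larger local degree forces a repeated, hence periodic, critical point on
        the orbit of \<open>x\<close>, and then \<open>x\<close> lies in its backward orbit.\<close>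
      also have "ld k x \<le> n ^ (2 * n)"
      proof (rule ccontr)
        assume "\<not> ?thesis"
        then obtain i j where ij: "i < j" "(A ^^ i) x = (A ^^ j) x" "local_degree A ((A ^^ i) x) \<ge> 2"
          using ld_le_or_recurrent[of k x] by blast
        have "periodic_critical ((A ^^ i) x)" by (rule periodic_criticalI[OF ij])
        moreover have "x \<in> basin ((A ^^ i) x)" unfolding basin_def by blast
        ultimately show False using x unfolding E_def by blast
      qed
      finally show ?thesis .
    qed
  qed
  then show ?thesis by simp
qed

text \<open>The groups increase with \<open>k\<close>. A uniform bound on them thus passes to finite
  subsets of the union, and from these to the union.\<close>

lemma Sigma_infinity_finite_subset:
  assumes "finite S" "S \<subseteq> Sigma_infinity A"
  shows "\<exists>k. S \<subseteq> Sigma_group (A ^^ k)"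
  using assms
proof (induction S)
  case (insert \<sigma> S)
  then obtain k where k: "S \<subseteq> Sigma_group (A ^^ k)" by blast
  obtain j where j: "\<sigma> \<in> Sigma_group (A ^^ j)" using insert.prems by (auto simp: Sigma_infinity_def)
  have "insert \<sigma> S \<subseteq> Sigma_group (A ^^ max j k)"
    using Sigma_group_iterate[of _ j "max j k"] Sigma_group_iterate[of _ k "max j k"] j k by auto
  then show ?case by blast
qed simp

lemma Sigma_infinity_bound:
  assumes not_power: "\<not> conjugate A (rat_map (monom 1 n) 1)" "\<not> conjugate A (rat_map 1 (monom 1 n))"
  shows "finite (Sigma_infinity A)" "card (Sigma_infinity A) \<le> max ((4 * n) ^ 3) (2 * fact (n ^ (2 * n)))"
proof -
  let ?N = "max ((4 * n) ^ 3) (2 * fact (n ^ (2 * n)))"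
  have *: "card S \<le> ?N" if S: "finite S" "S \<subseteq> Sigma_infinity A" for S
  proof -
    obtain k where "S \<subseteq> Sigma_group (A ^^ k)" using Sigma_infinity_finite_subset[OF S] by blast
    then have "card S \<le> card (Sigma_group (A ^^ k))"
      using finite_Sigma_group[OF rational_deg_iterate pow_pos] by (intro card_mono)
    also have "\<dots> \<le> ?N" by (rule card_Sigma_group_le[OF not_power])
    finally show ?thesis .
  qed
  show fin: "finite (Sigma_infinity A)"
  proof (rule ccontr)
    assume "infinite (Sigma_infinity A)"
    then obtain S where S: "finite S" "card S = Suc ?N" "S \<subseteq> Sigma_infinity A"
      using infinite_arbitrarily_large[OF \<open>infinite (Sigma_infinity A)\<close>, of "Suc ?N"] by (elim exE conjE)
    show False using *[OF S(1,3)] unfolding S(2) by (simp only: not_less_eq_eq[symmetric] le_refl not_True_eq_False)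
  qed
  show "card (Sigma_infinity A) \<le> ?N" by (rule *[OF fin]) simp
qed

end

section \<open>Luroth's theorem\<close>

lemma rat_map_eq_Fin_iff:
  assumes pq: "coprime p q" "q \<noteq> 0"
  shows "rat_map p q (Fin z) = Fin \<alpha> \<longleftrightarrow> poly (p - smult \<alpha> q) z = 0"
  using coprime_poly_nz[OF pq(1), of z] by (auto simp: rat_map_def field_simps)

text \<open>Away from \<open>Infty\<close>, the value at \<open>Infty\<close> and the critical
  values, a fibre consists of \<open>d\<close> finite points, the simple roots of
  \<open>p - smult \<alpha> q\<close>. Factorisations of such polynomials then amount to partitions
  of their root sets.\<close>

lemma generic_value:
  assumes pq: "coprime p q" "q \<noteq> 0" "max (degree p) (degree q) = d" "d > 0"
  obtains B where "finite B" "Infty \<in> B" "rat_map p q Infty \<in> B"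
    "\<And>\<alpha>. Fin \<alpha> \<notin> B \<Longrightarrow> degree (p - smult \<alpha> q) = d"
    "\<And>\<alpha>. Fin \<alpha> \<notin> B \<Longrightarrow> rsquarefree (p - smult \<alpha> q)"
proof -
  let ?F = "rat_map p q"
  define B where "B = {Infty, ?F Infty} \<union> ?F ` {x. local_degree ?F x \<ge> 2}"
  have F: "rational_deg d ?F" using pq rational_degI by blast
  have fin: "finite B" unfolding B_def using card_critical(1)[OF F pq(4)] by simp
  have deg: "degree (p - smult \<alpha> q) = d" if "Fin \<alpha> \<notin> B" for \<alpha>
  proof -
    have le: "degree (p - smult \<alpha> q) \<le> d" using pq(3)
      by (intro degree_diff_le order_trans[OF degree_smult_le]) auto
    have "coeff (p - smult \<alpha> q) d \<noteq> 0"
    proof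
      assume 0: "coeff (p - smult \<alpha> q) d = 0"
      have "coeff p d \<noteq> 0 \<or> coeff q d \<noteq> 0" by (rule coprime_coeff_nz[OF pq(1,2)]) (use pq(3) in simp)
      then have "coeff q d \<noteq> 0" using 0 by auto
      then have "?F Infty = Fin \<alpha>" using 0 by (simp add: rat_map_Infty[OF pq(3)] proj_point_def)
      then show False using that by (simp add: B_def)
    qed
    then show ?thesis using le le_degree by (metis order_antisym)
  qed
  have sqf: "rsquarefree (p - smult \<alpha> q)" if a: "Fin \<alpha> \<notin> B" for \<alpha>
    unfolding rsquarefree_roots
  proof (intro allI notI)
    fix z assume z: "poly (p - smult \<alpha> q) z = 0 \<and> poly (pderiv (p - smult \<alpha> q)) z = 0"
    have Fz: "?F (Fin z) = Fin \<alpha>" using z rat_map_eq_Fin_iff[OF pq(1,2)] by simp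
    then have qz: "poly q z \<noteq> 0" "\<alpha> = poly p z / poly q z" by (auto simp: rat_map_def split: if_splits)
    define f where "f = p - smult \<alpha> q"
    have fnz: "f \<noteq> 0" using deg[OF a] pq(4) by (auto simp: f_def)
    have f: "poly f z = 0" "poly (pderiv f) z = 0" using z by (simp_all add: f_def)
    have "smult (poly q z) p - smult (poly p z) q = smult (poly q z) f"
      using qz by (simp add: f_def smult_diff_right)
    then have "local_degree ?F (Fin z) = order z f"
      using qz(1) by (simp add: local_degree_def finite_local_degree_rat_map[OF pq(1,2)] order_smult_complex)
    moreover have "order z f \<noteq> 0" using f(1) fnz order_root by blast
    moreover have "order z f \<noteq> 1"
    proof
      assume 1: "order z f = 1"
      obtain h where h: "f = [:-z, 1:] ^ 1 * h" "\<not> [:-z, 1:] dvd h"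
        using order_decomp[OF fnz, of z] unfolding 1 by blast
      have h1: "f = [:-z, 1:] * h" using h(1) by (simp only: power_one_right)
      have "poly (pderiv f) z = poly h z" unfolding h1 pderiv_mult poly_add poly_mult by (simp add: pderiv_pCons)
      then show False using f(2) h(2) by (simp add: poly_eq_0_iff_dvd)
    qed
    ultimately have "local_degree ?F (Fin z) \<ge> 2" by simp
    then have "Fin \<alpha> \<in> B" unfolding B_def using Fz by (intro UnI2 image_eqI[of _ _ "Fin z"]) auto
    then show False using a by simp
  qed
  show ?thesis using that[OF fin _ _ deg sqf] by (simp add: B_def)
qed

lemma rsquarefree_card_roots:
  assumes "rsquarefree (f :: complex poly)"
  shows "card {z. poly f z = 0} = degree f"
proof -
  have nz: "f \<noteq> 0" using assms by (auto simp: rsquarefree_def)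
  have "degree f = degree (smult (lead_coeff f) (\<Prod>z|poly f z = 0. [:-z, 1:]))"
    using complex_poly_decompose_rsquarefree[OF assms] by simp
  also have "\<dots> = degree (\<Prod>z|poly f z = 0. [:-z, 1:])" using nz by simp
  also have "\<dots> = (\<Sum>z|poly f z = 0. 1)" by (subst degree_prod_eq_sum_degree) auto
  finally show ?thesis by simp
qed

lemma rsquarefree_dvd:
  assumes "rsquarefree (g :: complex poly)" "f dvd g"
  shows "rsquarefree f"
  unfolding rsquarefree_roots
proof (intro allI notI)
  fix a assume a: "poly f a = 0 \<and> poly (pderiv f) a = 0"
  obtain h where "g = f * h" using assms(2) by (rule dvdE)
  then have "poly g a = 0 \<and> poly (pderiv g) a = 0" using a by (simp add: pderiv_mult)
  then show False using assms(1) unfolding rsquarefree_roots by blast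
qed

lemma homog_comp_prod_linear:
  assumes "finite S" "v \<noteq> 0"
  shows "homog_comp (card S) (\<Prod>s\<in>S. [:-s, 1:]) u v = (\<Prod>s\<in>S. u - smult s v)"
  using assms(1)
proof (induction S)
  case empty
  show ?case by (simp add: homog_comp_def)
next
  case (insert s S)
  have d: "degree (\<Prod>s\<in>S. [:-s, 1::complex:]) \<le> card S"
    using degree_prod_sum_le[OF insert(1), of "\<lambda>s. [:-s, 1:]"] by simp
  have "homog_comp (1 + card S) ([:-s, 1:] * (\<Prod>s\<in>S. [:-s, 1:])) u v =
      homog_comp 1 [:-s, 1:] u v * homog_comp (card S) (\<Prod>s\<in>S. [:-s, 1:]) u v"
    by (rule homog_comp_mult) (use d assms(2) in auto)
  also have "homog_comp 1 [:-s, 1:] u v = u - smult s v"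
    using homog_comp_linear_power[OF assms(2), of 1 s u] by simp
  finally show ?case using insert by simp
qed

lemma Fin_outside_finite:
  assumes "finite C"
  obtains \<alpha> where "Fin \<alpha> \<notin> C"
proof -
  have "infinite (range Fin)"
    using infinite_UNIV_char_0[where 'a=complex] finite_imageD[of Fin UNIV] by (auto simp: inj_on_def)
  then have "\<not> range Fin \<subseteq> C" using assms finite_subset by blast
  then show ?thesis using that by blast
qed

lemma finite_preimage_rational_deg:
  assumes "rational_deg d F" "d > 0" "finite Y"
  shows "finite {x. F x \<in> Y}"
proof -
  have "{x. F x \<in> Y} = (\<Union>y\<in>Y. {x. F x = y})" by blast
  then show ?thesis using rational_deg_fibre_finite_card(1)[OF assms(1,2)] assms(3) by simp
qed

text \<open>For generic values \<open>\<alpha>\<close>, \<open>\<beta>\<close> the zeros and the poles of \<open>(X - \<alpha>) / (X - \<beta>)\<close> are simple and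
  unions of fibres of \<open>W\<close>.\<close>

lemma factor_through:
  assumes X: "rational_deg n X" "n > 0" and W: "rational_deg m W" "m > 0" and Bad: "finite Bad"
    and const: "\<And>x x'. x \<notin> Bad \<Longrightarrow> W x = W x' \<Longrightarrow> X x = X x'"
  obtains Y l where "rational_deg l Y" "l > 0" "X = Y \<circ> W" "n = l * m"
proof -
  from X(1) obtain p q where pq: "coprime p q" "q \<noteq> 0" "X = rat_map p q" "max (degree p) (degree q) = n"
    by (rule rational_degE)
  from W(1) obtain u v where uv: "coprime u v" "v \<noteq> 0" "W = rat_map u v" "max (degree u) (degree v) = m"
    by (rule rational_degE)
  obtain BX where BX: "finite BX" "Infty \<in> BX" "rat_map p q Infty \<in> BX"
    "\<And>\<alpha>. Fin \<alpha> \<notin> BX \<Longrightarrow> degree (p - smult \<alpha> q) = n"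
    "\<And>\<alpha>. Fin \<alpha> \<notin> BX \<Longrightarrow> rsquarefree (p - smult \<alpha> q)"
    using generic_value[OF pq(1,2,4) X(2)] by metis
  obtain BW where BW: "finite BW" "Infty \<in> BW" "rat_map u v Infty \<in> BW"
    "\<And>\<alpha>. Fin \<alpha> \<notin> BW \<Longrightarrow> degree (u - smult \<alpha> v) = m"
    "\<And>\<alpha>. Fin \<alpha> \<notin> BW \<Longrightarrow> rsquarefree (u - smult \<alpha> v)"
    using generic_value[OF uv(1,2,4) W(2)] by metis
  \<comment> \<open>The values of \<open>X\<close> to be avoided: those with a nongeneric fibre, and
    those taken at a point of \<open>Bad\<close> or over a nongeneric value of
    \<open>W\<close>.\<close>
  define C where "C = BX \<union> X ` (Bad \<union> {x. W x \<in> BW})"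
  have finC: "finite C" unfolding C_def using BX(1) Bad finite_preimage_rational_deg[OF W BW(1)] by simp
  \<comment> \<open>A generic fibre of \<open>X\<close> is a disjoint union of \<open>card S\<close>
    complete fibres of \<open>W\<close>; the products of linear factors turn this into a
    factorisation into the polynomials \<open>u - smult s v\<close>.\<close>
  have key: "\<exists>c S. c \<noteq> 0 \<and> finite S \<and> p - smult \<alpha> q = smult c (\<Prod>s\<in>S. u - smult s v) \<and> card S * m = n \<and>
      (\<forall>s\<in>S. \<exists>z. W (Fin z) = Fin s \<and> X (Fin z) = Fin \<alpha> \<and> Fin z \<notin> Bad)"
    if a: "Fin \<alpha> \<notin> C" for \<alpha>
  proof -
    define f where "f = p - smult \<alpha> q"
    have aBX: "Fin \<alpha> \<notin> BX" using a by (simp add: C_def)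
    have f: "degree f = n" "rsquarefree f" using BX(4,5)[OF aBX] by (simp_all add: f_def)
    define R where "R = {z. poly f z = 0}"
    have R: "X (Fin z) = Fin \<alpha> \<longleftrightarrow> z \<in> R" for z
      unfolding R_def f_def pq(3) by (simp add: rat_map_eq_Fin_iff[OF pq(1,2)])
    have fnz: "f \<noteq> 0" using f(1) X(2) by auto
    have finR: "finite R" unfolding R_def by (rule poly_roots_finite[OF fnz])
    have cR: "card R = n" unfolding R_def using rsquarefree_card_roots[OF f(2)] f(1) by simp
    have "X x \<in> C" if "x \<in> Bad \<or> W x \<in> BW" for x
      unfolding C_def using that by blast
    then have good: "Fin z \<notin> Bad" "W (Fin z) \<notin> BW" if "z \<in> R" for z
      using a R[of z] that by metis+
    define wv where "wv = (\<lambda>z. THE s. W (Fin z) = Fin s)"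
    have wv: "W (Fin z) = Fin (wv z)" if "z \<in> R" for z
      using good(2)[OF that] BW(2) by (cases "W (Fin z)") (auto simp: wv_def)
    define S where "S = wv ` R"
    define fib where "fib = (\<lambda>s. {z. poly (u - smult s v) z = 0})"
    have fib: "z \<in> fib s \<longleftrightarrow> W (Fin z) = Fin s" for z s
      unfolding fib_def uv(3) by (simp add: rat_map_eq_Fin_iff[OF uv(1,2)])
    have sBW: "Fin s \<notin> BW" if "s \<in> S" for s
      using that good(2) wv by (auto simp: S_def)
    have fibR: "fib s \<subseteq> R" if s: "s \<in> S" for s
    proof
      fix z' assume "z' \<in> fib s"
      then have z': "W (Fin z') = Fin s" by (simp add: fib)
      obtain z where z: "z \<in> R" "s = wv z" using s by (auto simp: S_def)
      have "X (Fin z) = X (Fin z')" by (rule const[OF good(1)[OF z(1)]]) (use wv[OF z(1)] z(2) z' in simp)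
      then show "z' \<in> R" using R z(1) by metis
    qed
    have Rfib: "R = (\<Union>s\<in>S. fib s)"
    proof
      show "R \<subseteq> (\<Union>s\<in>S. fib s)"
      proof
        fix z assume "z \<in> R"
        then show "z \<in> (\<Union>s\<in>S. fib s)" using wv[of z] by (auto simp: S_def fib)
      qed
    qed (use fibR in blast)
    have finS: "finite S" unfolding S_def using finR by simp
    have finfib: "\<forall>s\<in>S. finite (fib s)" using fibR finR finite_subset by blast
    have disj: "\<forall>s\<in>S. \<forall>t\<in>S. s \<noteq> t \<longrightarrow> fib s \<inter> fib t = {}" by (auto simp: fib)
    have cfib: "card (fib s) = m" if "s \<in> S" for s
      unfolding fib_def using rsquarefree_card_roots[OF BW(5)[OF sBW[OF that]]] BW(4)[OF sBW[OF that]] by simp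
    have "card R = (\<Sum>s\<in>S. card (fib s))" unfolding Rfib by (rule card_UN_disjoint[OF finS finfib disj])
    also have "\<dots> = card S * m" using cfib by simp
    finally have cS: "card S * m = n" using cR by simp
    define k where "k = (\<lambda>s. lead_coeff (u - smult s v))"
    have knz: "k s \<noteq> 0" if "s \<in> S" for s
    proof -
      have "u - smult s v \<noteq> 0" using arg_cong[of _ 0 degree] BW(4)[OF sBW[OF that]] W(2) by (metis degree_0 less_irrefl)
      then show ?thesis unfolding k_def by (simp only: leading_coeff_0_iff not_False_eq_True)
    qed
    have lin: "smult (k s) (\<Prod>z\<in>fib s. [:-z, 1:]) = u - smult s v" if "s \<in> S" for s
      unfolding k_def fib_def by (rule complex_poly_decompose_rsquarefree[OF BW(5)[OF sBW[OF that]]])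
    have "f = smult (lead_coeff f) (\<Prod>z\<in>R. [:-z, 1:])"
      unfolding R_def by (rule complex_poly_decompose_rsquarefree[OF f(2), symmetric])
    also have "(\<Prod>z\<in>R. [:-z, 1:]) = (\<Prod>s\<in>S. \<Prod>z\<in>fib s. [:-z, 1:])"
      unfolding Rfib by (rule prod.UNION_disjoint[OF finS finfib disj])
    finally have f1: "f = smult (lead_coeff f) (\<Prod>s\<in>S. \<Prod>z\<in>fib s. [:-z, 1:])" .
    have "(\<Prod>s\<in>S. u - smult s v) = (\<Prod>s\<in>S. smult (k s) (\<Prod>z\<in>fib s. [:-z, 1:]))"
      by (rule prod.cong) (simp_all add: lin)
    also have "\<dots> = smult (\<Prod>s\<in>S. k s) (\<Prod>s\<in>S. \<Prod>z\<in>fib s. [:-z, 1:])" by (rule prod_smult)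
    finally have f2: "(\<Prod>s\<in>S. u - smult s v) = smult (\<Prod>s\<in>S. k s) (\<Prod>s\<in>S. \<Prod>z\<in>fib s. [:-z, 1:])" .
    have Knz: "(\<Prod>s\<in>S. k s) \<noteq> 0" using knz finS by simp
    define c where "c = lead_coeff f / (\<Prod>s\<in>S. k s)"
    have "f = smult c (\<Prod>s\<in>S. u - smult s v)"
      unfolding f2 smult_smult c_def using Knz f1 by simp
    moreover have "c \<noteq> 0" unfolding c_def using Knz fnz by simp
    moreover have "\<forall>s\<in>S. \<exists>z. W (Fin z) = Fin s \<and> X (Fin z) = Fin \<alpha> \<and> Fin z \<notin> Bad"
      unfolding S_def using wv R good(1) by blast
    ultimately show ?thesis using finS cS unfolding f_def by blast
  qed
  obtain \<alpha> where \<alpha>: "Fin \<alpha> \<notin> C" by (rule Fin_outside_finite[OF finC])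
  have "finite (insert (Fin \<alpha>) C)" using finC by simp
  then obtain \<beta> where "Fin \<beta> \<notin> insert (Fin \<alpha>) C" by (rule Fin_outside_finite)
  then have ab: "\<beta> \<noteq> \<alpha>" "Fin \<beta> \<notin> C" by auto
  obtain c S where S: "c \<noteq> 0" "finite S" "p - smult \<alpha> q = smult c (\<Prod>s\<in>S. u - smult s v)" "card S * m = n"
    "\<forall>s\<in>S. \<exists>z. W (Fin z) = Fin s \<and> X (Fin z) = Fin \<alpha> \<and> Fin z \<notin> Bad" using key[OF \<alpha>] by blast
  obtain c' S' where S': "c' \<noteq> 0" "finite S'" "p - smult \<beta> q = smult c' (\<Prod>s\<in>S'. u - smult s v)" "card S' * m = n"
    "\<forall>s\<in>S'. \<exists>z. W (Fin z) = Fin s \<and> X (Fin z) = Fin \<beta> \<and> Fin z \<notin> Bad" using key[OF ab(2)] by blast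
  define l where "l = card S"
  have l: "card S = l" "card S' = l" using S(4) S'(4) W(2) by (auto simp: l_def)
  have l0: "l > 0" using S(4) X(2) l by (cases l) auto
  define a where "a = (\<Prod>s\<in>S. [:-s, 1:])"
  define b where "b = (\<Prod>s\<in>S'. [:-s, 1:])"
  have ha: "homog_comp l a u v = (\<Prod>s\<in>S. u - smult s v)" "homog_comp l b u v = (\<Prod>s\<in>S'. u - smult s v)"
    using homog_comp_prod_linear[OF S(2) uv(2), of u] homog_comp_prod_linear[OF S'(2) uv(2), of u]
    by (simp_all add: l a_def b_def)
  \<comment> \<open>Chosen so that \<open>p0 - \<alpha> q0 = c a\<close> and
    \<open>p0 - \<beta> q0 = c' b\<close>. The polynomials \<open>p\<close> and \<open>q\<close>
    satisfy the same linear relations with the factored right-hand sides, so substituting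
    \<open>u / v\<close> gives them back.\<close>
  define q0 where "q0 = smult (1 / (\<beta> - \<alpha>)) (smult c a - smult c' b)"
  define p0 where "p0 = smult c a + smult \<alpha> q0"
  have ab0: "\<beta> - \<alpha> \<noteq> 0" using ab by simp
  have hs: "homog_comp l (smult k f) u v = smult k (homog_comp l f u v)" for k f
    using homog_comp_diff_smult[of l k f 0 0] by simp
  have hq: "homog_comp l q0 u v = q"
  proof -
    have "homog_comp l q0 u v = smult (1 / (\<beta> - \<alpha>)) (smult c (homog_comp l a u v) - smult c' (homog_comp l b u v))"
      unfolding q0_def hs homog_comp_diff_smult ..
    also have "\<dots> = smult (1 / (\<beta> - \<alpha>)) ((p - smult \<alpha> q) - (p - smult \<beta> q))"
      unfolding ha S(3) S'(3) ..
    also have "(p - smult \<alpha> q) - (p - smult \<beta> q) = smult (\<beta> - \<alpha>) q" by (simp add: smult_diff_left)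
    finally show ?thesis using ab0 by simp
  qed
  have hp: "homog_comp l p0 u v = p"
  proof -
    have "p0 = smult c a - smult (-\<alpha>) q0" by (simp add: p0_def)
    then have "homog_comp l p0 u v = smult c (homog_comp l a u v) - smult (-\<alpha>) (homog_comp l q0 u v)"
      by (simp only: homog_comp_diff_smult)
    also have "\<dots> = (p - smult \<alpha> q) - smult (-\<alpha>) q" unfolding ha hq S(3) ..
    finally show ?thesis by simp
  qed
  have pa: "p0 - smult \<alpha> q0 = smult c a" by (simp add: p0_def)
  have pb: "p0 - smult \<beta> q0 = smult c' b"
  proof -
    have "smult (\<beta> - \<alpha>) q0 = smult c a - smult c' b" using ab0 by (simp add: q0_def)
    then show ?thesis by (simp add: p0_def smult_diff_left algebra_simps)
  qed
  \<comment> \<open>A common root would be a value of \<open>W\<close> taken both where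
    \<open>X\<close> is \<alpha> and where \<open>X\<close> is \<beta>.\<close>
  have cop: "coprime p0 q0"
  proof (rule coprimeI_poly, rule ccontr)
    fix y assume "\<not> (poly p0 y \<noteq> 0 \<or> poly q0 y \<noteq> 0)"
    then have 0: "poly p0 y = 0" "poly q0 y = 0" by auto
    have "poly (smult c a) y = 0" unfolding pa[symmetric] using 0 by simp
    then have "y \<in> S" using S(1,2) by (auto simp: a_def poly_prod)
    have "poly (smult c' b) y = 0" unfolding pb[symmetric] using 0 by simp
    then have "y \<in> S'" using S'(1,2) by (auto simp: b_def poly_prod)
    obtain z where z: "W (Fin z) = Fin y" "X (Fin z) = Fin \<alpha>" "Fin z \<notin> Bad" using S(5) \<open>y \<in> S\<close> by blast
    obtain z' where z': "W (Fin z') = Fin y" "X (Fin z') = Fin \<beta>" using S'(5) \<open>y \<in> S'\<close> by blast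
    have "X (Fin z) = X (Fin z')" by (rule const[OF z(3)]) (simp add: z z')
    then show False using z(2) z'(2) ab by simp
  qed
  have q0nz: "q0 \<noteq> 0"
  proof
    assume "q0 = 0"
    then have "q = 0" using hq by (simp add: homog_comp_def)
    then show False using pq(2) by simp
  qed
  have dega: "degree a = l" "degree b = l"
    unfolding a_def b_def using l by (subst degree_prod_eq_sum_degree; simp)+
  have "degree q0 \<le> l" unfolding q0_def using dega
    by (intro order_trans[OF degree_smult_le] degree_diff_le) (auto intro: order_trans[OF degree_smult_le])
  moreover have "degree p0 \<le> l" unfolding p0_def using dega \<open>degree q0 \<le> l\<close>
    by (intro degree_add_le) (auto intro: order_trans[OF degree_smult_le])
  moreover have "l \<le> max (degree p0) (degree q0)"
  proof -
    have "l = degree (p0 - smult \<alpha> q0)" unfolding pa using dega S(1) by simp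
    also have "\<dots> \<le> max (degree p0) (degree q0)"
      by (intro degree_diff_le) (auto intro: order_trans[OF degree_smult_le])
    finally show ?thesis .
  qed
  ultimately have deg: "max (degree p0) (degree q0) = l" by linarith
  have "rat_map p0 q0 \<circ> W = X"
    using rat_map_comp(4)[OF cop q0nz deg l0 uv(1,2,4) W(2)] unfolding uv(3) pq(3) hp hq .
  then show ?thesis using that[of l "rat_map p0 q0"] rational_degI[OF cop q0nz deg] l0 S(4) l by metis
qed

text \<open>The numerator of \<open>p(z) / q(z) - p(t) / q(t)\<close>. The outer variable is
  \<open>z\<close>; the coefficients are polynomials in \<open>t\<close>.\<close>

definition diag_poly :: "complex poly \<Rightarrow> complex poly \<Rightarrow> complex poly poly" where
  "diag_poly p q = map_poly (\<lambda>c. [:c:]) p * [:q:] - map_poly (\<lambda>c. [:c:]) q * [:p:]"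

definition ev2 :: "complex poly poly \<Rightarrow> complex \<Rightarrow> complex \<Rightarrow> complex" where
  "ev2 D z t = poly (poly D [:z:]) t"

definition specialize :: "complex \<Rightarrow> complex poly poly \<Rightarrow> complex poly" where
  "specialize t D = map_poly (\<lambda>c. poly c t) D"

lemma poly_map_const: "poly (map_poly (\<lambda>c. [:c:]) p) [:z:] = [:poly p z :: complex:]"
  by (induction p) (simp_all add: map_poly_pCons)

lemma poly_diag_poly: "poly (diag_poly p q) [:z:] = smult (poly p z) q - smult (poly q z) p"
  by (simp add: diag_poly_def poly_map_const)

lemma ev2_diag_poly: "ev2 (diag_poly p q) z t = poly p z * poly q t - poly q z * poly p t"
  by (simp add: ev2_def poly_diag_poly)

lemma ev2_simps:
  "ev2 (D + E) z t = ev2 D z t + ev2 E z t" "ev2 (D * E) z t = ev2 D z t * ev2 E z t"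
  "ev2 (smult c D) z t = poly c t * ev2 D z t"
  by (simp_all add: ev2_def)

lemma coeff_specialize: "coeff (specialize t D) i = poly (coeff D i) t"
  by (simp add: specialize_def coeff_map_poly)

lemma poly_specialize: "poly (specialize t D) z = ev2 D z t"
proof (induction D)
  case (pCons c D)
  have "specialize t (pCons c D) = pCons (poly c t) (specialize t D)"
    by (simp add: specialize_def map_poly_pCons)
  then show ?case using pCons by (simp add: ev2_def algebra_simps)
qed (simp add: specialize_def ev2_def)

lemma specialize_mult: "specialize t (D * E) = specialize t D * specialize t E"
proof -
  have "poly (specialize t (D * E)) z = poly (specialize t D * specialize t E) z" for z
    by (simp add: poly_specialize ev2_simps)
  then show ?thesis using poly_eq_poly_eq_iff by blast
qed

lemma specialize_diag_poly: "specialize t (diag_poly p q) = smult (poly q t) p - smult (poly p t) q"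
proof -
  have "poly (specialize t (diag_poly p q)) z = poly (smult (poly q t) p - smult (poly p t) q) z" for z
    by (simp add: poly_specialize ev2_diag_poly)
  then show ?thesis using poly_eq_poly_eq_iff by blast
qed

text \<open>By Gauss's lemma the content of \<open>E\<close> absorbs \<open>c\<close>, so that
  \<open>c\<close> can be cancelled from \<open>E\<close>.\<close>

lemma primitive_dvd_cancel:
  fixes P D E :: "complex poly poly"
  assumes "smult c P = D * E" "content D = 1" "c \<noteq> 0"
  shows "D dvd P"
proof -
  have "content (smult c P) = content E" unfolding assms(1) by (simp add: content_mult assms(2))
  then have "c dvd content E" by (metis content_smult dvd_mult2 dvd_normalize_iff dvd_refl normalize_mult dvd_trans)
  then obtain E1 where "E = [:c:] * E1" using const_poly_dvd_iff_dvd_content[of c E] by (auto elim: dvdE)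
  then have "smult c P = smult c (D * E1)" unfolding assms(1) by simp
  then have "smult c (P - D * E1) = 0" by (simp add: smult_diff_right)
  then have "P = D * E1" using assms(3) by (simp only: smult_eq_0_iff right_minus_eq) simp
  then show ?thesis by simp
qed

text \<open>A greatest common divisor in \<open>\<complex>(t)[z]\<close>, cleared of denominators and of its content.\<close>

lemma bivariate_gcd:
  fixes P Q :: "complex poly poly"
  assumes "P \<noteq> 0"
  obtains D g a b where "D \<noteq> 0" "D dvd P" "D dvd Q" "g \<noteq> 0" "smult g D = a * P + b * Q"
proof -
  \<comment> \<open>The ideal of \<open>P\<close> and \<open>Q\<close> without 0. Since the
    coefficient ring is not a field, an element of least degree divides only up to factors from that
    ring, which pseudo-division and the primitive part take care of.\<close>
  define I where "I = {D. D \<noteq> 0 \<and> (\<exists>a b. D = a * P + b * Q)}"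
  have "P = 1 * P + 0 * Q" by simp
  then have "P \<in> I" unfolding I_def using assms by blast
  then obtain D where D: "D \<in> I" and min: "\<And>E. E \<in> I \<Longrightarrow> degree D \<le> degree E"
    using ex_has_least_nat[of "\<lambda>D. D \<in> I" P degree] by blast
  have Dnz: "D \<noteq> 0" using D by (simp add: I_def)
  obtain a b where ab: "D = a * P + b * Q" using D by (auto simp: I_def)
  define g D0 where "g = content D" and "D0 = primitive_part D"
  have gD: "D = smult g D0" unfolding g_def D0_def by (simp add: content_times_primitive_part)
  have gnz: "g \<noteq> 0" using Dnz gD by auto
  have D0nz: "D0 \<noteq> 0" using Dnz gD by auto
  have cont: "content D0 = 1" unfolding D0_def using Dnz by (simp add: content_primitive_part)
  have dvd: "D0 dvd R" if R: "R = a' * P + b' * Q" for R a' b'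
  proof -
    obtain E r where Er: "pseudo_divmod R D = (E, r)" by (cases "pseudo_divmod R D")
    define c where "c = coeff D (degree D) ^ (Suc (degree R) - degree D)"
    have pd: "smult c R = D * E + r" "r = 0 \<or> degree r < degree D"
      using pseudo_divmod[OF Dnz Er] unfolding c_def by auto
    have cnz: "c \<noteq> 0" unfolding c_def using Dnz by simp
    have "r = (smult c a' - a * E) * P + (smult c b' - b * E) * Q"
    proof -
      have "r = smult c R - D * E" using pd(1) by simp
      then show ?thesis unfolding R by (subst (asm) ab) (simp add: algebra_simps smult_add_right)
    qed
    then have "r = 0" using pd(2) min[of r] unfolding I_def by (metis (mono_tags, lifting) mem_Collect_eq not_le)
    then have "smult c R = D0 * smult g E" using pd(1) gD by simp
    then show "D0 dvd R" by (rule primitive_dvd_cancel[OF _ cont cnz])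
  qed
  have "D0 dvd P" by (rule dvd[of _ 1 0]) simp
  moreover have "D0 dvd Q" by (rule dvd[of _ 0 1]) simp
  moreover have "smult g D0 = a * P + b * Q" using gD ab by simp
  ultimately show ?thesis using that D0nz gnz by blast
qed

lemma coeff_poly_const: "coeff (poly D [:z::complex:]) e = poly (map_poly (\<lambda>c. coeff c e) D) z"
  by (induction D) (simp_all add: map_poly_pCons)

text \<open>Luroth's theorem for the field generated by \<open>X\<close> and \<open>B\<close>. A generic class of the relation
  \<open>sim\<close> is the set of roots of \<open>D\<close>, the greatest common divisor of \<open>X(z) - X(t)\<close> and
  \<open>B(z) - B(t)\<close>, and a nonconstant quotient \<open>V\<close> of two of its coefficients is constant on these
  classes. As \<open>D\<close> has the same degree in \<open>t\<close> as in \<open>z\<close>, the classes are the fibres of \<open>V\<close>.\<close>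

lemma luroth:
  assumes X: "rational_deg n X" "n > 0" and B: "rational_deg k B" "k > 0"
    and inf: "infinite {u. \<exists>u'. u' \<noteq> u \<and> X u = X u' \<and> B u = B u'}"
  obtains V m X' lx B' lb where "rational_deg m V" "m \<ge> 2" "rational_deg lx X'" "lx > 0" "rational_deg lb B'" "lb > 0"
    "X = X' \<circ> V" "B = B' \<circ> V" "n = lx * m"
proof -
  from X(1) obtain p q where pq: "coprime p q" "q \<noteq> 0" "X = rat_map p q" "max (degree p) (degree q) = n"
    by (rule rational_degE)
  from B(1) obtain r s where rs: "coprime r s" "s \<noteq> 0" "B = rat_map r s" "max (degree r) (degree s) = k"
    by (rule rational_degE)
  define sim where "sim = (\<lambda>x y. X x = X y \<and> B x = B y)"
  define P Q where "P = diag_poly p q" and "Q = diag_poly r s"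
  have P0: "ev2 P z t = 0 \<longleftrightarrow> X (Fin z) = X (Fin t)" for z t
    unfolding P_def ev2_diag_poly pq(3) rat_map_Fin
    using proj_point_eq_iff[OF coprime_poly_nz[OF pq(1), of z] coprime_poly_nz[OF pq(1), of t]] by (simp add: mult.commute)
  have Q0: "ev2 Q z t = 0 \<longleftrightarrow> B (Fin z) = B (Fin t)" for z t
    unfolding Q_def ev2_diag_poly rs(3) rat_map_Fin
    using proj_point_eq_iff[OF coprime_poly_nz[OF rs(1), of z] coprime_poly_nz[OF rs(1), of t]] by (simp add: mult.commute)
  have Pnz: "P \<noteq> 0"
  proof
    assume "P = 0"
    then have "smult (poly q 0) p - smult (poly p 0) q = 0"
      using specialize_diag_poly[of 0 p q] by (simp add: P_def specialize_def)
    moreover have "smult (poly q 0) p - smult (poly p 0) q \<noteq> 0"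
      by (rule comb_nonzero[OF pq(1)]) (use pq(4) X(2) coprime_poly_nz[OF pq(1), of 0] in auto)
    ultimately show False by simp
  qed
  obtain D g a b where D: "D \<noteq> 0" "D dvd P" "D dvd Q" "g \<noteq> 0" "smult g D = a * P + b * Q"
    by (rule bivariate_gcd[OF Pnz, of Q])
  have D_sim: "sim (Fin z) (Fin t)" if "ev2 D z t = 0" for z t
  proof -
    obtain E1 where E1: "P = D * E1" using D(2) by (rule dvdE)
    obtain E2 where E2: "Q = D * E2" using D(3) by (rule dvdE)
    have "ev2 P z t = 0" "ev2 Q z t = 0" unfolding E1 E2 ev2_simps that by simp_all
    then show ?thesis using P0 Q0 by (simp add: sim_def)
  qed
  have sim_D: "ev2 D z t = 0" if "sim (Fin z) (Fin t)" "poly g t \<noteq> 0" for z t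
  proof -
    have "ev2 P z t = 0" "ev2 Q z t = 0" using P0 Q0 that(1) by (simp_all add: sim_def)
    then have "ev2 (smult g D) z t = 0" unfolding D(5) ev2_simps by simp
    then show ?thesis using that(2) by (simp add: ev2_simps)
  qed
  define m where "m = degree D"
  define v where "v = coeff D m"
  have vnz: "v \<noteq> 0" using D(1) by (simp add: v_def m_def)
  define I where "I = {i. i \<le> m \<and> coeff D i \<noteq> 0}"
  have finI: "finite I" and mI: "m \<in> I" using vnz by (auto simp: I_def v_def)
  \<comment> \<open>The degree of \<open>D\<close> in \<open>t\<close>; below, \<open>ec\<close> is
    the coefficient of \<open>t ^ e\<close>, a polynomial in \<open>z\<close>.\<close>
  define e where "e = Max ((\<lambda>i. degree (coeff D i)) ` I)"
  have "e \<in> (\<lambda>i. degree (coeff D i)) ` I" unfolding e_def using finI mI by (intro Max_in) auto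
  then obtain i0 where i0: "i0 \<in> I" "degree (coeff D i0) = e" by auto
  have e: "degree (coeff D i) \<le> e" for i
  proof (cases "i \<in> I")
    case True
    then show ?thesis unfolding e_def using finI by simp
  next
    case False
    then have "coeff D i = 0" using coeff_eq_0[of D i] by (auto simp: I_def m_def)
    then show ?thesis by simp
  qed
  define ec where "ec = map_poly (\<lambda>c. coeff c e) D"
  have "coeff ec i0 = coeff (coeff D i0) e" by (simp add: ec_def coeff_map_poly)
  also have "\<dots> \<noteq> 0" using i0 by (auto simp: I_def)
  finally have ecnz: "ec \<noteq> 0" by auto
  obtain BX where BX: "finite BX" "Infty \<in> BX" "rat_map p q Infty \<in> BX"
    "\<And>\<alpha>. Fin \<alpha> \<notin> BX \<Longrightarrow> degree (p - smult \<alpha> q) = n"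
    "\<And>\<alpha>. Fin \<alpha> \<notin> BX \<Longrightarrow> rsquarefree (p - smult \<alpha> q)"
    using generic_value[OF pq(1,2,4) X(2)] by metis
  define Bt where "Bt = {t. poly g t = 0} \<union> {t. poly v t = 0} \<union> {t. poly ec t = 0} \<union> {t. X (Fin t) \<in> BX}"
  have finBt: "finite Bt"
  proof -
    have "{t. X (Fin t) \<in> BX} = Fin -` {x. X x \<in> BX}" by auto
    moreover have "finite (Fin -` {x. X x \<in> BX})"
      by (rule finite_vimageI[OF finite_preimage_rational_deg[OF X BX(1)]]) (simp add: inj_def)
    ultimately show ?thesis unfolding Bt_def
      using poly_roots_finite[OF D(4)] poly_roots_finite[OF vnz] poly_roots_finite[OF ecnz] by simp
  qed
  define cl where "cl = (\<lambda>t. {z. sim (Fin z) (Fin t)})"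
  have good: "poly g t \<noteq> 0" "poly v t \<noteq> 0" "poly ec t \<noteq> 0" "X (Fin t) \<notin> BX" if "t \<notin> Bt" for t
    using that by (auto simp: Bt_def)
  have gen: "\<exists>\<alpha>. poly p t = \<alpha> * poly q t \<and> poly q t \<noteq> 0 \<and> rsquarefree (p - smult \<alpha> q)" if "t \<notin> Bt" for t
  proof -
    have "X (Fin t) \<noteq> Infty" using good(4)[OF that] BX(2) by auto
    then have qt: "poly q t \<noteq> 0" "X (Fin t) = Fin (poly p t / poly q t)"
      by (auto simp: pq(3) rat_map_def split: if_splits)
    show ?thesis
      by (rule exI[of _ "poly p t / poly q t"]) (use qt BX(5) good(4)[OF that] in auto)
  qed
  have sqf_smult: "rsquarefree (smult c f)" if "rsquarefree f" "c \<noteq> 0" for c and f :: "complex poly"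
  proof -
    have "smult c f dvd f" using that(2) by (simp add: smult_dvd_iff)
    then show ?thesis by (rule rsquarefree_dvd[OF that(1)])
  qed
  have evD: "rsquarefree (specialize t D)" "degree (specialize t D) = m" "cl t = {z. poly (specialize t D) z = 0}" "card (cl t) = m"
    if t: "t \<notin> Bt" for t
  proof -
    obtain \<alpha> where \<alpha>: "poly p t = \<alpha> * poly q t" "poly q t \<noteq> 0" "rsquarefree (p - smult \<alpha> q)" using gen[OF t] by blast
    have "specialize t P = smult (poly q t) (p - smult \<alpha> q)"
      unfolding P_def specialize_diag_poly \<alpha>(1) by (simp add: smult_diff_right mult.commute)
    then have "rsquarefree (specialize t P)" using sqf_smult[OF \<alpha>(3,2)] by simp
    moreover have "specialize t D dvd specialize t P"
    proof -
      obtain E1 where E1: "P = D * E1" using D(2) by (rule dvdE)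
      show ?thesis unfolding E1 specialize_mult by simp
    qed
    ultimately show sq: "rsquarefree (specialize t D)" by (rule rsquarefree_dvd)
    have "degree (specialize t D) \<le> m" by (rule degree_le) (simp add: coeff_specialize m_def coeff_eq_0)
    moreover have "coeff (specialize t D) m \<noteq> 0" using good(2)[OF t] by (simp add: coeff_specialize v_def)
    ultimately show dg: "degree (specialize t D) = m" using le_degree by (metis order_antisym)
    show cl: "cl t = {z. poly (specialize t D) z = 0}"
      unfolding cl_def poly_specialize using D_sim sim_D good(1)[OF t] by blast
    show "card (cl t) = m" unfolding cl using rsquarefree_card_roots[OF sq] dg by simp
  qed
  have evD_prod: "specialize t D = smult (poly v t) (\<Prod>z\<in>cl t. [:-z, 1:])" if t: "t \<notin> Bt" for t
  proof -
    have "lead_coeff (specialize t D) = poly v t" unfolding evD(2)[OF t] by (simp add: coeff_specialize v_def)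
    then show ?thesis using complex_poly_decompose_rsquarefree[OF evD(1)[OF t]] unfolding evD(3)[OF t] by simp
  qed
  \<comment> \<open>With \<open>z\<close> fixed instead of \<open>t\<close>, the polynomial
    \<open>D(z, _)\<close> has at least \<open>e\<close> distinct roots for generic
    \<open>z\<close>. They all lie in the class of \<open>z\<close>, as the relation is symmetric,
    and this class has \<open>m\<close> points.\<close>
  have em: "e \<le> m"
  proof -
    obtain z where z: "z \<notin> Bt" using ex_new_if_finite[OF infinite_UNIV_char_0 finBt] by blast
    obtain \<alpha> where \<alpha>: "poly p z = \<alpha> * poly q z" "poly q z \<noteq> 0" "rsquarefree (p - smult \<alpha> q)" using gen[OF z] by blast
    have "poly P [:z:] = smult (- poly q z) (p - smult \<alpha> q)"
      unfolding P_def poly_diag_poly \<alpha>(1) by (simp add: smult_diff_right mult.commute)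
    then have "rsquarefree (poly P [:z:])" using sqf_smult[OF \<alpha>(3), of "- poly q z"] \<alpha>(2) by simp
    moreover have "poly D [:z:] dvd poly P [:z:]"
    proof -
      obtain E1 where E1: "P = D * E1" using D(2) by (rule dvdE)
      show ?thesis unfolding E1 poly_mult by simp
    qed
    ultimately have sq: "rsquarefree (poly D [:z:])" by (rule rsquarefree_dvd)
    have "coeff (poly D [:z:]) e \<noteq> 0" using good(3)[OF z] by (simp add: coeff_poly_const ec_def)
    then have "e \<le> degree (poly D [:z:])" by (rule le_degree)
    also have "\<dots> = card {t. poly (poly D [:z:]) t = 0}" using rsquarefree_card_roots[OF sq] by simp
    also have "\<dots> \<le> card (cl z)"
    proof (rule card_mono)
      have "specialize z D \<noteq> 0" using evD(1)[OF z] by (auto simp: rsquarefree_def)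
      then show "finite (cl z)" unfolding evD(3)[OF z] by (rule poly_roots_finite)
      show "{t. poly (poly D [:z:]) t = 0} \<subseteq> cl z"
        using D_sim[of z] unfolding ev2_def cl_def sim_def by auto
    qed
    also have "\<dots> = m" by (rule evD(4)[OF z])
    finally show ?thesis .
  qed
  have sim_refl: "sim x x" for x by (simp add: sim_def)
  have fincl: "finite (cl t)" if "t \<notin> Bt" for t
  proof -
    have "specialize t D \<noteq> 0" using evD(1)[OF that] by (auto simp: rsquarefree_def)
    then show ?thesis unfolding evD(3)[OF that] by (rule poly_roots_finite)
  qed
  obtain t1 where t1: "t1 \<notin> Bt" using ex_new_if_finite[OF infinite_UNIV_char_0 finBt] by blast
  have "finite (Bt \<union> cl t1)" using finBt fincl[OF t1] by simp
  then obtain t2 where "t2 \<notin> Bt \<union> cl t1" using ex_new_if_finite[OF infinite_UNIV_char_0] by blast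
  then have t2: "t2 \<notin> Bt" "t2 \<notin> cl t1" by auto
  \<comment> \<open>Were all ratios equal, the specialisations of \<open>D\<close> at
    \<open>t1\<close> and \<open>t2\<close> would be proportional and the two classes would
    coincide.\<close>
  have "\<exists>i. poly (coeff D i) t1 / poly v t1 \<noteq> poly (coeff D i) t2 / poly v t2"
  proof (rule ccontr)
    assume "\<not> ?thesis"
    then have eq: "poly (coeff D i) t1 / poly v t1 = poly (coeff D i) t2 / poly v t2" for i by blast
    have "specialize t1 D = smult (poly v t1 / poly v t2) (specialize t2 D)"
    proof (rule poly_eqI)
      fix i
      show "coeff (specialize t1 D) i = coeff (smult (poly v t1 / poly v t2) (specialize t2 D)) i"
        using eq[of i] good(2)[OF t1] good(2)[OF t2(1)] by (simp add: coeff_specialize field_simps)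
    qed
    then have "cl t1 = cl t2" unfolding evD(3)[OF t1] evD(3)[OF t2(1)]
      using good(2)[OF t1] good(2)[OF t2(1)] by simp
    moreover have "t2 \<in> cl t2" by (simp add: cl_def sim_refl)
    ultimately show False using t2(2) by simp
  qed
  then obtain i where i: "poly (coeff D i) t1 / poly v t1 \<noteq> poly (coeff D i) t2 / poly v t2" by blast
  define u where "u = coeff D i"
  have "gcd u v \<noteq> 0" using vnz by simp
  then obtain u1 v1 where uv: "u = u1 * gcd u v" "v = v1 * gcd u v" "coprime u1 v1"
    using gcd_coprime_exists[of u v] by metis
  define h where "h = gcd u v"
  have uvh: "u = u1 * h" "v = v1 * h" using uv by (simp_all add: h_def)
  have v1nz: "v1 \<noteq> 0" using vnz uvh(2) by auto
  \<comment> \<open>Here \<open>e \<le> m\<close> enters: it keeps the fibres of \<open>V\<close>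
    from being larger than the classes.\<close>
  have du: "degree u1 \<le> m" "degree v1 \<le> m"
  proof -
    have "degree u \<le> m" "degree v \<le> m" using e[of i] e[of m] em by (simp_all add: u_def v_def)
    moreover have "degree v1 \<le> degree v" using vnz uvh(2) by (intro dvd_imp_degree_le) auto
    moreover have "degree u1 \<le> degree u"
    proof (cases "u = 0")
      case True
      then have "u1 = 0" using uvh vnz by auto
      then show ?thesis by simp
    next
      case False
      then show ?thesis using uvh(1) by (intro dvd_imp_degree_le) auto
    qed
    ultimately show "degree u1 \<le> m" "degree v1 \<le> m" by linarith+
  qed
  define \<mu> where "\<mu> = max (degree u1) (degree v1)"
  have \<mu>m: "\<mu> \<le> m" using du by (simp add: \<mu>_def)
  define V where "V = rat_map u1 v1"
  have V: "rational_deg \<mu> V" unfolding V_def \<mu>_def using uv(3) v1nz by (intro rational_degI) auto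
  have Vt: "V (Fin t) = Fin (poly u t / poly v t)" if t: "t \<notin> Bt" for t
    using good(2)[OF t] unfolding uvh by (simp add: V_def rat_map_def)
  have \<mu>0: "\<mu> > 0"
  proof (rule ccontr)
    assume "\<not> \<mu> > 0"
    then have "degree u1 = 0" "degree v1 = 0" by (simp_all add: \<mu>_def)
    then obtain a' b' where "u1 = [:a':]" "v1 = [:b':]" by (metis degree_eq_zeroE)
    then have "V (Fin t1) = V (Fin t2)" by (simp add: V_def rat_map_def)
    then show False using i Vt[OF t1] Vt[OF t2(1)] by (simp add: u_def)
  qed
  define Bs where "Bs = insert Infty (Fin ` Bt)"
  \<comment> \<open>Saturated under \<open>X\<close>, so that the class of a point outside
    \<open>Bad\<close> avoids \<open>Bt\<close> and \<open>Infty\<close> altogether.\<close>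
  define Bad where "Bad = {x. X x \<in> X ` Bs}"
  have finBad: "finite Bad" unfolding Bad_def
    by (rule finite_preimage_rational_deg[OF X]) (simp add: Bs_def finBt)
  have ng: "\<exists>t. x' = Fin t \<and> t \<notin> Bt" if "x \<notin> Bad" "X x' = X x" for x x'
  proof -
    have "x' \<notin> Bs" using that unfolding Bad_def by (metis (mono_tags, lifting) image_eqI mem_Collect_eq)
    then show ?thesis by (cases x') (auto simp: Bs_def)
  qed
  have fibre: "Fin ` cl t \<subseteq> {y. V y = V (Fin t)}" if x: "Fin t \<notin> Bad" for t
  proof
    fix y assume "y \<in> Fin ` cl t"
    then obtain z where z: "y = Fin z" "sim (Fin z) (Fin t)" by (auto simp: cl_def)
    have tB: "t \<notin> Bt" using ng[OF x refl] by auto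
    have "X (Fin z) = X (Fin t)" using z(2) by (simp add: sim_def)
    then have zB: "z \<notin> Bt" using ng[OF x] by auto
    have cz: "cl z = cl t" using z(2) by (auto simp: cl_def sim_def)
    have "poly u z / poly v z = poly u t / poly v t"
    proof -
      define c where "c = coeff (\<Prod>z\<in>cl t. [:-z, 1:]) i"
      have "poly u z = poly v z * c" "poly u t = poly v t * c"
        using arg_cong[OF evD_prod[OF zB], of "\<lambda>f. coeff f i"] arg_cong[OF evD_prod[OF tB], of "\<lambda>f. coeff f i"]
        unfolding cz by (simp_all add: coeff_specialize u_def c_def)
      then show ?thesis using good(2)[OF zB] good(2)[OF tB] by simp
    qed
    then show "y \<in> {y. V y = V (Fin t)}" using Vt[OF zB] Vt[OF tB] z(1) by simp
  qed
  have cardF: "card (Fin ` cl t) = m" if "t \<notin> Bt" for t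
    using evD(4)[OF that] by (subst card_image) (auto simp: inj_on_def)
  \<comment> \<open>The class has \<open>m\<close> points and lies in a fibre of \<open>V\<close>,
    which has at most \<mu> \<le> \<open>m\<close> points, so the two are equal.\<close>
  have VS: "sim x x'" if x: "x \<notin> Bad" and V': "V x = V x'" for x x'
  proof -
    obtain t where t: "x = Fin t" "t \<notin> Bt" using ng[OF x refl] by blast
    have xt: "Fin t \<notin> Bad" using x t by simp
    have "Fin ` cl t = {y. V y = V (Fin t)}"
      by (rule card_seteq[OF rational_deg_fibre_finite_card(1)[OF V \<mu>0] fibre[OF xt]])
        (use rational_deg_fibre_finite_card(2)[OF V \<mu>0] cardF[OF t(2)] \<mu>m in \<open>auto intro: order_trans\<close>)
    moreover have "x' \<in> {y. V y = V (Fin t)}" using V' t(1) by simp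
    ultimately have "x' \<in> Fin ` cl t" by simp
    then show ?thesis by (auto simp: cl_def sim_def t(1))
  qed
  have "infinite ({u. \<exists>u'. u' \<noteq> u \<and> X u = X u' \<and> B u = B u'} - Bad)"
    using inf finBad by (rule Diff_infinite_finite[rotated])
  then obtain y where "y \<in> {u. \<exists>u'. u' \<noteq> u \<and> X u = X u' \<and> B u = B u'} - Bad"
    using infinite_imp_nonempty by blast
  then obtain y' where y: "y \<notin> Bad" "y' \<noteq> y" "X y = X y'" "B y = B y'" by blast
  obtain t where t: "y = Fin t" "t \<notin> Bt" using ng[OF y(1) refl] by blast
  obtain t' where t': "y' = Fin t'" "t' \<notin> Bt" using ng[OF y(1) y(3)[symmetric]] by blast
  have tt: "{t, t'} \<subseteq> cl t" using y t t' by (auto simp: cl_def sim_def)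
  have "card {t, t'} = 2" using y(2) t t' by auto
  then have "2 \<le> m" using card_mono[OF fincl[OF t(2)] tt] evD(4)[OF t(2)] by simp
  moreover have yt: "Fin t \<notin> Bad" using y(1) t by simp
  have "m \<le> \<mu>"
    using card_mono[OF rational_deg_fibre_finite_card(1)[OF V \<mu>0] fibre[OF yt]] rational_deg_fibre_finite_card(2)[OF V \<mu>0, of "V (Fin t)"]
      cardF[OF t(2)] by linarith
  ultimately have \<mu>2: "\<mu> \<ge> 2" by simp
  obtain X' lx where X': "rational_deg lx X'" "lx > 0" "X = X' \<circ> V" "n = lx * \<mu>"
  proof (rule factor_through[OF X V \<mu>0 finBad])
    show "X x = X x'" if "x \<notin> Bad" "V x = V x'" for x x' using VS[OF that] by (simp add: sim_def)
  qed blast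
  obtain B' lb where B': "rational_deg lb B'" "lb > 0" "B = B' \<circ> V" "k = lb * \<mu>"
  proof (rule factor_through[OF B V \<mu>0 finBad])
    show "B x = B x'" if "x \<notin> Bad" "V x = V x'" for x x' using VS[OF that] by (simp add: sim_def)
  qed blast
  show ?thesis using that[OF V \<mu>2 X'(1,2) B'(1,2) X'(3) B'(3) X'(4)] .
qed

section \<open>Semiconjugate functions\<close>

lemma finite_nongeneric_fibres:
  assumes F: "rational_deg d F" "d > 0"
  shows "finite {y. card {x. F x = y} \<noteq> d}"
proof -
  from F(1) obtain p q where pq: "coprime p q" "q \<noteq> 0" "F = rat_map p q" "max (degree p) (degree q) = d"
    by (rule rational_degE)
  obtain B where B: "finite B" "Infty \<in> B" "rat_map p q Infty \<in> B"
    "\<And>\<alpha>. Fin \<alpha> \<notin> B \<Longrightarrow> degree (p - smult \<alpha> q) = d"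
    "\<And>\<alpha>. Fin \<alpha> \<notin> B \<Longrightarrow> rsquarefree (p - smult \<alpha> q)"
    using generic_value[OF pq(1,2,4) F(2)] by metis
  have "card {x. F x = y} = d" if y: "y \<notin> B" for y
  proof -
    obtain \<alpha> where \<alpha>: "y = Fin \<alpha>" using y B(2) by (cases y) auto
    have "{x. F x = y} = Fin ` {z. poly (p - smult \<alpha> q) z = 0}"
    proof (intro set_eqI iffI)
      fix x assume x: "x \<in> {x. F x = y}"
      then obtain z where z: "x = Fin z" using y B(3) by (cases x) (auto simp: pq(3))
      then have "poly (p - smult \<alpha> q) z = 0" using x rat_map_eq_Fin_iff[OF pq(1,2)] by (simp add: pq(3) \<alpha>)
      then show "x \<in> Fin ` {z. poly (p - smult \<alpha> q) z = 0}" using z by blast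
    next
      fix x assume "x \<in> Fin ` {z. poly (p - smult \<alpha> q) z = 0}"
      then show "x \<in> {x. F x = y}" using rat_map_eq_Fin_iff[OF pq(1,2)] by (auto simp: pq(3) \<alpha>)
    qed
    then have "card {x. F x = y} = card {z. poly (p - smult \<alpha> q) z = 0}"
      by (simp add: card_image inj_on_def)
    then show ?thesis using rsquarefree_card_roots[OF B(5)] B(4) y \<alpha> by simp
  qed
  then have "{y. card {x. F x = y} \<noteq> d} \<subseteq> B" by blast
  then show ?thesis using B(1) finite_subset by blast
qed

lemma elementary_transformation_sym: "elementary_transformation F G \<Longrightarrow> elementary_transformation G F"
  unfolding elementary_transformation_def by blast

lemma elementary_equiv_sym: "F \<sim>\<^sub>e G \<Longrightarrow> G \<sim>\<^sub>e F"
  unfolding elementary_equiv_def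
  by (induction rule: rtranclp_induct)
    (auto intro: converse_rtranclp_into_rtranclp elementary_transformation_sym)

lemma elementary_equiv_step: "F \<sim>\<^sub>e G \<Longrightarrow> elementary_transformation G H \<Longrightarrow> F \<sim>\<^sub>e H"
  unfolding elementary_equiv_def by (rule rtranclp.rtrancl_into_rtrancl)

lemma semiconjugate_iterate:
  assumes "A \<circ> X = X \<circ> B"
  shows "X ((B ^^ j) u) = (A ^^ j) (X u)"
proof (induction j)
  case (Suc j)
  have "X (B y) = A (X y)" for y using fun_cong[OF assms, of y] by simp
  then show ?case using Suc by simp
qed simp

context rational_iteration
begin

text \<open>If \<open>(X, B)\<close> were generically injective, then so would be \<open>(X, B\<^sup>k)\<close>, and \<open>B\<^sup>k\<close> would map a
  generic fibre \<open>X\<inverse>(y)\<close> onto \<open>X\<inverse>(A\<^sup>k y)\<close>. But \<open>W y\<close> belongs to the latter for every \<open>y\<close>, which makes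
  \<open>B\<^sup>k = W \<circ> X\<close> constant on the fibres of \<open>X\<close>.\<close>

lemma semiconjugacy_not_generically_injective:
  assumes X: "rational_deg a X" "a \<ge> 2" and B: "rational_deg b B" "b > 0" and W: "rational_deg w W" "w > 0"
    and semi: "A \<circ> X = X \<circ> B" and XW: "X \<circ> W = A ^^ k"
  shows "infinite {u. \<exists>u'. u' \<noteq> u \<and> X u = X u' \<and> B u = B u'}"
proof
  define U where "U = {u. \<exists>u'. u' \<noteq> u \<and> X u = X u' \<and> B u = B u'}"
  assume "finite {u. \<exists>u'. u' \<noteq> u \<and> X u = X u' \<and> B u = B u'}"
  then have finU: "finite U" by (simp add: U_def)
  have a0: "a > 0" using X(2) by simp
  \<comment> \<open>A collision under \<open>B ^^ k\<close> has a first time, and the iterates just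
    before it collide under \<open>B\<close>, so they lie in \<open>U\<close>. Hence
    \<open>Uk\<close> is finite.\<close>
  define Uk where "Uk = {u. \<exists>u'. u' \<noteq> u \<and> X u = X u' \<and> (B ^^ k) u = (B ^^ k) u'}"
  have "Uk \<subseteq> (\<Union>j\<in>{..<k}. {u. (B ^^ j) u \<in> U})"
  proof
    fix u assume "u \<in> Uk"
    then obtain u' where u': "u' \<noteq> u" "X u = X u'" "(B ^^ k) u = (B ^^ k) u'" by (auto simp: Uk_def)
    define i where "i = (LEAST i. (B ^^ i) u = (B ^^ i) u')"
    have i: "(B ^^ i) u = (B ^^ i) u'" unfolding i_def by (rule LeastI[of _ k]) (rule u'(3))
    have ik: "i \<le> k" unfolding i_def by (rule Least_le) (rule u'(3))
    have "i \<noteq> 0" using i u'(1) by (intro notI) simp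
    then obtain j where j: "i = Suc j" by (cases i) auto
    have "(B ^^ j) u \<noteq> (B ^^ j) u'"
      using not_less_Least[of j "\<lambda>i. (B ^^ i) u = (B ^^ i) u'"] j unfolding i_def by auto
    moreover have "X ((B ^^ j) u) = X ((B ^^ j) u')"
      unfolding semiconjugate_iterate[OF semi] u'(2) ..
    moreover have "B ((B ^^ j) u) = B ((B ^^ j) u')" using i unfolding j by simp
    ultimately have "(B ^^ j) u \<in> U" unfolding U_def by (intro CollectI exI[of _ "(B ^^ j) u'"]) auto
    then show "u \<in> (\<Union>j\<in>{..<k}. {u. (B ^^ j) u \<in> U})" using ik j by auto
  qed
  moreover have "finite {u. (B ^^ j) u \<in> U}" for j
    by (rule finite_preimage_rational_deg[OF rational_deg_funpow[OF B] _ finU]) (use B(2) in simp)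
  ultimately have finUk: "finite Uk" using finite_subset by blast
  define Bad where "Bad = X ` Uk \<union> {y. card {x. X x = y} \<noteq> a}"
  have finBad: "finite Bad" unfolding Bad_def using finUk finite_nongeneric_fibres[OF X(1) a0] by simp
  have fibre: "card {x. X x = y} = a" "inj_on (B ^^ k) {x. X x = y}" if y: "y \<notin> Bad" for y
  proof -
    show "card {x. X x = y} = a" using y by (simp add: Bad_def)
    show "inj_on (B ^^ k) {x. X x = y}"
    proof (rule inj_onI, rule ccontr)
      fix u u' assume u: "u \<in> {x. X x = y}" "u' \<in> {x. X x = y}" "(B ^^ k) u = (B ^^ k) u'" "u \<noteq> u'"
      then have "u \<in> Uk" unfolding Uk_def by (intro CollectI exI[of _ u']) auto
      then show False using y u(1) by (auto simp: Bad_def)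
    qed
  qed
  \<comment> \<open>Surjectivity is by counting: a generic fibre has \<open>a\<close> points, their
    images are distinct, and no fibre of \<open>X\<close> has more than \<open>a\<close>.\<close>
  have ex: "\<exists>u. X u = y \<and> (B ^^ k) u = W y" if y: "y \<notin> Bad" for y
  proof -
    have sub: "(B ^^ k) ` {x. X x = y} \<subseteq> {x. X x = (A ^^ k) y}"
      using semiconjugate_iterate[OF semi] by auto
    have "card ((B ^^ k) ` {x. X x = y}) = a" using card_image[OF fibre(2)[OF y]] fibre(1)[OF y] by simp
    then have "(B ^^ k) ` {x. X x = y} = {x. X x = (A ^^ k) y}"
      using rational_deg_fibre_finite_card[OF X(1) a0, of "(A ^^ k) y"] by (intro card_seteq[OF _ sub]) simp_all
    moreover have "X (W y) = (A ^^ k) y" using fun_cong[OF XW, of y] by simp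
    ultimately have "W y \<in> (B ^^ k) ` {x. X x = y}" by simp
    then show ?thesis by auto
  qed
  have infB: "infinite (- Bad)" using infinite_riemann_sphere finBad by (simp add: finite_compl)
  have "- Bad \<subseteq> X ` {u. (B ^^ k) u = (W \<circ> X) u}"
  proof
    fix y assume "y \<in> - Bad"
    then obtain u where u: "X u = y" "(B ^^ k) u = W y" using ex[of y] by auto
    then show "y \<in> X ` {u. (B ^^ k) u = (W \<circ> X) u}" by (intro image_eqI[of _ _ u]) auto
  qed
  then have "infinite (X ` {u. (B ^^ k) u = (W \<circ> X) u})" using infB infinite_super by blast
  then have "infinite {u. (B ^^ k) u = (W \<circ> X) u}" by (rule contrapos_nn) (rule finite_imageI)
  then have eq: "B ^^ k = W \<circ> X"
    by (rule rational_deg_agree_infinite[OF rational_deg_funpow[OF B] rational_deg_comp[OF W(1) X(1) W(2) a0]])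
  obtain y where y: "y \<notin> Bad" using infB infinite_imp_nonempty by blast
  have "inj_on (B ^^ k) {x. X x = y}" by (rule fibre(2)[OF y])
  moreover have "(B ^^ k) u = W y" if "u \<in> {x. X x = y}" for u using that by (simp add: eq)
  ultimately have "card {x. X x = y} \<le> card {W y}" by (intro card_inj_on_le) auto
  then show False using fibre(1)[OF y] X(2) by simp
qed

text \<open>Induction on the degree of \<open>X\<close>. The map \<open>W\<close> varies along with
  it, since the left factor condition passes to \<open>X'\<close> with \<open>V \<circ> W\<close> in
  its place. In degree 1 the semiconjugacy is a conjugation, itself an elementary
  transformation.\<close>

lemma semiconjugate_elementary_equiv:
  assumes "rational_deg a X" "a > 0" "rational_deg b B" "b > 0" "rational_deg w W" "w > 0"
    "A \<circ> X = X \<circ> B" "X \<circ> W = A ^^ k"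
  shows "A \<sim>\<^sub>e B"
  using assms
proof (induction a arbitrary: X b B w W rule: less_induct)
  case (less a)
  note X = less.prems(1,2) and B = less.prems(3,4) and W = less.prems(5,6) and semi = less.prems(7) and XW = less.prems(8)
  show ?case
  proof (cases "a = 1")
    case True
    then have m: "moebius X" using X by (simp only: moebius_rational_deg)
    obtain \<tau> where t: "moebius \<tau>" "\<tau> \<circ> X = id" "X \<circ> \<tau> = id" by (rule moebius_inverse[OF m])
    have "A = (A \<circ> X) \<circ> \<tau>" by (simp only: comp_assoc t(3) comp_id)
    moreover have "B = \<tau> \<circ> (A \<circ> X)" unfolding semi by (simp only: comp_assoc[symmetric] t(2) id_comp)
    moreover have "rational_function (A \<circ> X)" using rational_deg_rational[OF rational_deg_comp[OF A X(1) n0 X(2)]] .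
    moreover have "rational_function \<tau>" using t(1) rational_deg_rational unfolding moebius_rational_deg by blast
    ultimately have "elementary_transformation A B" unfolding elementary_transformation_def by blast
    then show ?thesis unfolding elementary_equiv_def by blast
  next
    case False
    then have a2: "a \<ge> 2" using X(2) by simp
    obtain V m X' lx B' lb where L: "rational_deg m V" "m \<ge> 2" "rational_deg lx X'" "lx > 0" "rational_deg lb B'" "lb > 0"
      "X = X' \<circ> V" "B = B' \<circ> V" "a = lx * m"
      by (rule luroth[OF X B semiconjugacy_not_generically_injective[OF X(1) a2 B W semi XW]])
    have m0: "m > 0" using L(2) by simp
    have "A \<sim>\<^sub>e V \<circ> B'"
    proof (rule less.IH)
      show "lx < a" using L(2,4,9) by simp
      show "rational_deg lx X'" "lx > 0" using L by auto
      show "rational_deg (m * lb) (V \<circ> B')" by (rule rational_deg_comp[OF L(1,5) m0 L(6)])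
      show "m * lb > 0" using m0 L(6) by simp
      show "rational_deg (m * w) (V \<circ> W)" by (rule rational_deg_comp[OF L(1) W(1) m0 W(2)])
      show "m * w > 0" using m0 W(2) by simp
      \<comment> \<open>\<open>V\<close> is surjective, so it can be cancelled on the right of
        \<open>A \<circ> X' \<circ> V = X' \<circ> V \<circ> B' \<circ> V\<close>.\<close>
      show "A \<circ> X' = X' \<circ> (V \<circ> B')"
      proof
        fix x
        obtain z where z: "V z = x" using rational_deg_surj[OF L(1) m0, of x] by blast
        have "(A \<circ> X) z = (X \<circ> B) z" unfolding semi ..
        then show "(A \<circ> X') x = (X' \<circ> (V \<circ> B')) x" unfolding L(7,8) by (simp add: z)
      qed
      show "X' \<circ> (V \<circ> W) = A ^^ k" using XW unfolding L(7) by (simp only: comp_assoc)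
    qed
    moreover have "elementary_transformation (V \<circ> B') B"
      unfolding elementary_transformation_def L(8) using rational_deg_rational[OF L(1)] rational_deg_rational[OF L(5)] by blast
    ultimately show ?thesis by (rule elementary_equiv_step)
  qed
qed

text \<open>The descent is applied to \<open>X = A ^^ k\<close>,
  \<open>B = \<sigma> \<circ> A\<close> and \<open>W = id\<close>: the symmetry can be inserted
  between \<open>A ^^ k\<close> and the preceding \<open>A\<close>. Exchanging the two factors of
  \<open>\<sigma> \<circ> A\<close> then gives \<open>A \<circ> \<sigma>\<close>.\<close>

lemma Sigma_infinity_elementary_equiv:
  assumes "\<sigma> \<in> Sigma_infinity A"
  shows "A \<circ> \<sigma> \<sim>\<^sub>e A"
proof -
  obtain k where s: "\<sigma> \<in> Sigma_group (A ^^ k)" using assms by (auto simp: Sigma_infinity_def)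
  have m: "moebius \<sigma>" "A ^^ k \<circ> \<sigma> = A ^^ k" using s by (simp_all add: Sigma_group_def)
  have "A \<sim>\<^sub>e \<sigma> \<circ> A"
  proof (rule semiconjugate_elementary_equiv[OF rational_deg_iterate pow_pos rational_deg_moebius_comp(1)[OF A n0 m(1)] n0 rational_deg_id])
    have "A \<circ> A ^^ k = A ^^ k \<circ> A" by (rule trans[OF funpow.simps(2)[symmetric] funpow_Suc_right])
    also have "\<dots> = A ^^ k \<circ> (\<sigma> \<circ> A)" unfolding comp_assoc[symmetric] m(2) ..
    finally show "A \<circ> A ^^ k = A ^^ k \<circ> (\<sigma> \<circ> A)" .
    show "A ^^ k \<circ> id = A ^^ k" by simp
  qed simp
  moreover have "elementary_transformation (\<sigma> \<circ> A) (A \<circ> \<sigma>)"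
  proof -
    have "rational_function A" using A by (rule rational_deg_rational)
    moreover have "rational_function \<sigma>" using m(1) rational_deg_rational unfolding moebius_rational_deg by blast
    ultimately show ?thesis unfolding elementary_transformation_def by blast
  qed
  ultimately have "A \<sim>\<^sub>e A \<circ> \<sigma>" by (rule elementary_equiv_step)
  then show ?thesis by (rule elementary_equiv_sym)
qed

end

theorem theorem1p3:
  "\<exists>N :: nat \<Rightarrow> nat. \<forall>n \<ge> 2. \<forall>A :: riemann_sphere \<Rightarrow> riemann_sphere.
     rational_function A \<and> rat_degree A = n \<and>
     \<not> conjugate A (rat_map (monom 1 n) 1) \<and>
     \<not> conjugate A (rat_map 1 (monom 1 n)) \<longrightarrow>
       finite (Sigma_infinity A) \<and> card (Sigma_infinity A) \<le> N n \<and>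
       (\<forall>\<sigma> \<in> Sigma_infinity A. (A \<circ> \<sigma>) \<sim>\<^sub>e A)"
proof (intro exI[of _ "\<lambda>n. max ((4 * n) ^ 3) (2 * fact (n ^ (2 * n)))"] allI impI)
  fix n :: nat and A
  assume n: "n \<ge> 2" and F: "rational_function A \<and> rat_degree A = n \<and>
     \<not> conjugate A (rat_map (monom 1 n) 1) \<and> \<not> conjugate A (rat_map 1 (monom 1 n))"
  then interpret rational_iteration A n using n F by unfold_locales (simp_all add: rational_deg_iff)
  show "finite (Sigma_infinity A) \<and> card (Sigma_infinity A) \<le> max ((4 * n) ^ 3) (2 * fact (n ^ (2 * n))) \<and>
      (\<forall>\<sigma> \<in> Sigma_infinity A. (A \<circ> \<sigma>) \<sim>\<^sub>e A)"
    using Sigma_infinity_bound Sigma_infinity_elementary_equiv F by blast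
qed

end
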